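(* For any divisibly weighted triangulation $(K,\mu)$ of a weighted polyhedron $(X,\lambda)$, there is an isomorphism between the weighted simplicial homology $H_*(K,\partial^{\mu})$ and the weighted singular homology $\mathcal H^W_*(X,\lambda)$.
   Context: Weighted complexes. An ascending weight on a simplicial complex $K$ is a function $\mu$ assigning a positive integer to each simplex such that $\mu(\sigma')\mid\mu(\sigma)$ whenever $\sigma'$ is a face of $\sigma$; a descending weight satisfies instead $\mu(\sigma)\mid\mu(\sigma')$. A weighted simplicial complex $(K,\mu)$ is a simplicial complex with a weight of one of these two types. $C_n(K)$ is the free abelian group generated by oriented $n$-simplices, $\partial_j[v_0,\dots,v_n]=[v_0,\dots,\widehat{v_j},\dots,v_n]$, and $\partial^{\mu}\sigma=\sum_{j=0}^n(-1)^jc^{\mu}_j(\sigma)\,\partial_j\sigma$ with $c^{\mu}_j(\sigma)=\mu(\sigma)/\mu(\partial_j\sigma)$ if $\mu$ is ascending, $c^{\mu}_j(\sigma)=\mu(\partial_j\sigma)/\mu(\sigma)$ if $\mu$ is descending. $H_*(K,\partial^{\mu})$ is the homology of $(C_*(K),\partial^\mu)$. $(K,\mu)$ is divisibly weighted if the vertices of every simplex can be ordered $v_0,\dots,v_k$ with $\mu(v_0)\mid\cdots\mid\mu(v_k)$, and the weight of that simplex is $\mu(v_k)$ if $\mu$ is ascending and $\mu(v_0)$ if $\mu$ is descending. Weighted polyhedra. $|K|\subseteq\mathbb R^N$ is a geometric realization; $\mathrm{Car}_K(x)$ is the unique simplex of $K$ containing $x\in|K|$ in the relative interior of its realization; $\lambda_\mu(x)=\mu(\mathrm{Car}_K(x))$.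 A weighted space is a pair $(X,\lambda)$ with $X$ a topological space and $\lambda:X\to\mathbb Z_+$; an isomorphism of weighted spaces is a homeomorphism preserving the functions $\lambda$. A weighted polyhedron is a weighted space isomorphic to some $(|K|,\lambda_\mu)$; $(K,\mu)$ is then called a weighted triangulation, and the type (ascending/descending) of $(X,\lambda)$ is that of $\mu$. A divisibly weighted triangulation is a weighted triangulation that is divisibly weighted. W-continuity. For weighted polyhedra of the same type, a W-continuous map $f:(X,\lambda)\to(X',\lambda')$ is a continuous map $X\to X'$ such that for all $x$: $\lambda'(f(x))\mid\lambda(x)$ in the ascending case, $\lambda(x)\mid\lambda'(f(x))$ in the descending case. Weighted singular homology. A weighted singular $n$-simplex of $(X,\lambda)$ is a W-continuous map $\theta:(|\Delta^n|,\lambda_\xi)\to(X,\lambda)$, where $\xi$ is a divisible weight on the standard $n$-simplex $\Delta^n$ (with its facial simplicial structure) of the same type as $(X,\lambda)$; the weight $\xi$ is part of the data. $\mathcal W_n(X,\lambda)$ is the free abelian group generated by these, with boundary $\partial^\lambda\theta=\sum_{j=0}^n(-1)^jc^\xi_j(\Delta^n)\,\theta|_{\partial_j\Delta^n}$, where $\partial_j\Delta^n$ carries the restricted weight and is canonically identified with $\Delta^{n-1}$. $\mathcal H^W_*(X,\lambda)$ is the homology of $(\mathcal W_*(X,\lambda),\partial^\lambda)$. *)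

theory Defs
  imports "HOL-Homology.Homology" "HOL-Combinatorics.Permutations"
begin

section \<open>Weighted simplicial complexes\<close>

text \<open>Simplices are represented by their vertex sets; the empty simplex is excluded.\<close>

definition abs_simplicial_complex :: "'v set set \<Rightarrow> bool" where
  "abs_simplicial_complex K \<longleftrightarrow>
     (\<forall>\<sigma>\<in>K. finite \<sigma> \<and> \<sigma> \<noteq> {}) \<and>
     (\<forall>\<sigma>\<in>K. \<forall>\<tau>. \<tau> \<subseteq> \<sigma> \<and> \<tau> \<noteq> {} \<longrightarrow> \<tau> \<in> K)"

datatype weight_type = Ascending | Descending

definition is_weight :: "weight_type \<Rightarrow> 'v set set \<Rightarrow> ('v set \<Rightarrow> nat) \<Rightarrow> bool" where
  "is_weight t K \<mu> \<longleftrightarrow>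
     (\<forall>\<sigma>\<in>K. 0 < \<mu> \<sigma>) \<and>
     (\<forall>\<sigma>\<in>K. \<forall>\<sigma>'\<in>K. \<sigma>' \<subseteq> \<sigma> \<longrightarrow>
        (case t of Ascending \<Rightarrow> \<mu> \<sigma>' dvd \<mu> \<sigma> | Descending \<Rightarrow> \<mu> \<sigma> dvd \<mu> \<sigma>'))"

definition weighted_complex :: "weight_type \<Rightarrow> 'v set set \<Rightarrow> ('v set \<Rightarrow> nat) \<Rightarrow> bool" where
  "weighted_complex t K \<mu> \<longleftrightarrow> abs_simplicial_complex K \<and> is_weight t K \<mu>"

definition divisibly_weighted :: "weight_type \<Rightarrow> 'v set set \<Rightarrow> ('v set \<Rightarrow> nat) \<Rightarrow> bool" where
  "divisibly_weighted t K \<mu> \<longleftrightarrow>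
     weighted_complex t K \<mu> \<and>
     (\<forall>\<sigma>\<in>K. \<exists>vs. distinct vs \<and> set vs = \<sigma> \<and>
        sorted_wrt (\<lambda>u v. \<mu> {u} dvd \<mu> {v}) vs \<and>
        \<mu> \<sigma> = (case t of Ascending \<Rightarrow> \<mu> {last vs} | Descending \<Rightarrow> \<mu> {hd vs}))"

text \<open>The coefficient attached to a face \<open>\<tau>\<close> of \<open>\<sigma>\<close>; for a weight of type \<open>t\<close> the division is exact.\<close>

definition weight_coeff :: "weight_type \<Rightarrow> ('v set \<Rightarrow> nat) \<Rightarrow> 'v set \<Rightarrow> 'v set \<Rightarrow> int" where
  "weight_coeff t \<mu> \<sigma> \<tau> =
     int (case t of Ascending \<Rightarrow> \<mu> \<sigma> div \<mu> \<tau> | Descending \<Rightarrow> \<mu> \<tau> div \<mu> \<sigma>)"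


section \<open>Homology of a chain complex of abelian groups\<close>

text \<open>The groups \<open>C n\<close> are indexed by natural numbers, \<open>d n\<close> maps \<open>C n\<close> to \<open>C (n - 1)\<close>, and the
  complex vanishes in negative degrees, so every \<open>0\<close>-chain is a cycle and \<open>d 0\<close> is irrelevant.\<close>

definition cycle_set :: "(nat \<Rightarrow> 'c monoid) \<Rightarrow> (nat \<Rightarrow> 'c \<Rightarrow> 'c) \<Rightarrow> nat \<Rightarrow> 'c set" where
  "cycle_set C d n =
     (if n = 0 then carrier (C 0) else kernel (C n) (C (n - 1)) (d n))"

definition boundary_set :: "(nat \<Rightarrow> 'c monoid) \<Rightarrow> (nat \<Rightarrow> 'c \<Rightarrow> 'c) \<Rightarrow> nat \<Rightarrow> 'c set" where
  "boundary_set C d n = d (Suc n) ` carrier (C (Suc n))"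

definition complex_homology ::
  "(nat \<Rightarrow> 'c monoid) \<Rightarrow> (nat \<Rightarrow> 'c \<Rightarrow> 'c) \<Rightarrow> nat \<Rightarrow> 'c set monoid" where
  "complex_homology C d n = subgroup_generated (C n) (cycle_set C d n) Mod boundary_set C d n"


section \<open>Weighted simplicial homology\<close>

text \<open>The chain group is the quotient of the free abelian group on ordered \<open>n\<close>-simplices
  \<open>[v\<^sub>0,\<dots>,v\<^sub>n]\<close> by the relations \<open>[v\<^sub>\<pi>\<^sub>0,\<dots>,v\<^sub>\<pi>\<^sub>n] = sign \<pi> \<cdot> [v\<^sub>0,\<dots>,v\<^sub>n]\<close>: it is free abelian with one
  generator, up to sign, for each \<open>n\<close>-simplex.\<close>

definition ordered_simplices :: "'v set set \<Rightarrow> nat \<Rightarrow> 'v list set" where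
  "ordered_simplices K n = {vs. distinct vs \<and> length vs = Suc n \<and> set vs \<in> K}"

definition ordered_chain_group :: "'v set set \<Rightarrow> nat \<Rightarrow> ('v list \<Rightarrow>\<^sub>0 int) monoid" where
  "ordered_chain_group K n = free_Abelian_group (ordered_simplices K n)"

definition orientation_relations :: "'v set set \<Rightarrow> nat \<Rightarrow> ('v list \<Rightarrow>\<^sub>0 int) set" where
  "orientation_relations K n =
     generate (ordered_chain_group K n)
       {frag_of (permute_list \<pi> vs) - frag_cmul (sign \<pi>) (frag_of vs) | \<pi> vs.
          \<pi> permutes {..<Suc n} \<and> vs \<in> ordered_simplices K n}"

definition oriented_chain_group :: "'v set set \<Rightarrow> nat \<Rightarrow> ('v list \<Rightarrow>\<^sub>0 int) set monoid" where
  "oriented_chain_group K n = ordered_chain_group K n Mod orientation_relations K n"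

definition list_face :: "nat \<Rightarrow> 'v list \<Rightarrow> 'v list" where
  "list_face j vs = take j vs @ drop (Suc j) vs"

definition ordered_weighted_boundary ::
  "weight_type \<Rightarrow> ('v set \<Rightarrow> nat) \<Rightarrow> nat \<Rightarrow> ('v list \<Rightarrow>\<^sub>0 int) \<Rightarrow> ('v list \<Rightarrow>\<^sub>0 int)" where
  "ordered_weighted_boundary t \<mu> n =
     frag_extend (\<lambda>vs. \<Sum>j\<le>n.
       frag_cmul ((-1) ^ j * weight_coeff t \<mu> (set vs) (set (list_face j vs)))
                 (frag_of (list_face j vs)))"

text \<open>The induced map on the quotients: the boundaries of all representatives of an oriented chain
  \<open>A\<close> lie in the same coset.\<close>

definition weighted_boundary ::
  "weight_type \<Rightarrow> 'v set set \<Rightarrow> ('v set \<Rightarrow> nat) \<Rightarrow> nat \<Rightarrow>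
     ('v list \<Rightarrow>\<^sub>0 int) set \<Rightarrow> ('v list \<Rightarrow>\<^sub>0 int) set" where
  "weighted_boundary t K \<mu> n A =
     the_elem ((\<lambda>c. orientation_relations K (n - 1)
                      #>\<^bsub>ordered_chain_group K (n - 1)\<^esub> ordered_weighted_boundary t \<mu> n c) ` A)"

definition weighted_simplicial_homology ::
  "weight_type \<Rightarrow> 'v set set \<Rightarrow> ('v set \<Rightarrow> nat) \<Rightarrow> nat \<Rightarrow> ('v list \<Rightarrow>\<^sub>0 int) set set monoid" where
  "weighted_simplicial_homology t K \<mu> n =
     complex_homology (oriented_chain_group K) (weighted_boundary t K \<mu>) n"


section \<open>Weighted spaces and weighted polyhedra\<close>

definition weighted_space :: "'b topology \<Rightarrow> ('b \<Rightarrow> nat) \<Rightarrow> bool" where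
  "weighted_space X wX \<longleftrightarrow> (\<forall>x\<in>topspace X. 0 < wX x)"

definition weighted_space_iso ::
  "'a topology \<Rightarrow> ('a \<Rightarrow> nat) \<Rightarrow> 'b topology \<Rightarrow> ('b \<Rightarrow> nat) \<Rightarrow> ('a \<Rightarrow> 'b) \<Rightarrow> bool" where
  "weighted_space_iso X wX Y wY f \<longleftrightarrow>
     homeomorphic_map X Y f \<and> (\<forall>x\<in>topspace X. wY (f x) = wX x)"

text \<open>A vertex map \<open>p\<close> places the vertices of \<open>K\<close> in a Euclidean space. Complexes may be infinite;
  local finiteness says that the subspace topology of the union of the realized simplices is their
  coherent topology.\<close>

definition realized_simplex :: "('v \<Rightarrow> 'a::euclidean_space) \<Rightarrow> 'v set \<Rightarrow> 'a set" where
  "realized_simplex p \<sigma> = convex hull (p ` \<sigma>)"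

definition polyhedron_of :: "'v set set \<Rightarrow> ('v \<Rightarrow> 'a::euclidean_space) \<Rightarrow> 'a set" where
  "polyhedron_of K p = (\<Union>\<sigma>\<in>K. realized_simplex p \<sigma>)"

definition geometric_realization :: "'v set set \<Rightarrow> ('v \<Rightarrow> 'a::euclidean_space) \<Rightarrow> bool" where
  "geometric_realization K p \<longleftrightarrow>
     inj_on p (\<Union>K) \<and>
     (\<forall>\<sigma>\<in>K. \<not> affine_dependent (p ` \<sigma>)) \<and>
     (\<forall>\<sigma>\<in>K. \<forall>\<tau>\<in>K.
        realized_simplex p \<sigma> \<inter> realized_simplex p \<tau> = realized_simplex p (\<sigma> \<inter> \<tau>)) \<and>
     (\<forall>x\<in>polyhedron_of K p.
        \<exists>U. open U \<and> x \<in> U \<and> finite {\<sigma>\<in>K. realized_simplex p \<sigma> \<inter> U \<noteq> {}})"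

definition carrier_simplex :: "'v set set \<Rightarrow> ('v \<Rightarrow> 'a::euclidean_space) \<Rightarrow> 'a \<Rightarrow> 'v set" where
  "carrier_simplex K p x = (THE \<sigma>. \<sigma> \<in> K \<and> x \<in> rel_interior (realized_simplex p \<sigma>))"

definition polyhedron_weight ::
  "'v set set \<Rightarrow> ('v set \<Rightarrow> nat) \<Rightarrow> ('v \<Rightarrow> 'a::euclidean_space) \<Rightarrow> 'a \<Rightarrow> nat" where
  "polyhedron_weight K \<mu> p x = \<mu> (carrier_simplex K p x)"

text \<open>\<open>(X, wX)\<close> is a weighted polyhedron of type \<open>t\<close> if it has a weighted triangulation of type \<open>t\<close>.\<close>

definition weighted_triangulation ::
  "weight_type \<Rightarrow> 'v set set \<Rightarrow> ('v set \<Rightarrow> nat) \<Rightarrow> ('v \<Rightarrow> 'a::euclidean_space) \<Rightarrow>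
     'b topology \<Rightarrow> ('b \<Rightarrow> nat) \<Rightarrow> bool" where
  "weighted_triangulation t K \<mu> p X wX \<longleftrightarrow>
     weighted_complex t K \<mu> \<and> geometric_realization K p \<and> weighted_space X wX \<and>
     (\<exists>f. weighted_space_iso (top_of_set (polyhedron_of K p)) (polyhedron_weight K \<mu> p) X wX f)"

definition divisibly_weighted_triangulation ::
  "weight_type \<Rightarrow> 'v set set \<Rightarrow> ('v set \<Rightarrow> nat) \<Rightarrow> ('v \<Rightarrow> 'a::euclidean_space) \<Rightarrow>
     'b topology \<Rightarrow> ('b \<Rightarrow> nat) \<Rightarrow> bool" where
  "divisibly_weighted_triangulation t K \<mu> p X wX \<longleftrightarrow>
     weighted_triangulation t K \<mu> p X wX \<and> divisibly_weighted t K \<mu>"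


section \<open>Weighted singular homology\<close>

definition W_continuous ::
  "weight_type \<Rightarrow> 'a topology \<Rightarrow> ('a \<Rightarrow> nat) \<Rightarrow> 'b topology \<Rightarrow> ('b \<Rightarrow> nat) \<Rightarrow> ('a \<Rightarrow> 'b) \<Rightarrow> bool" where
  "W_continuous t X wX Y wY f \<longleftrightarrow>
     continuous_map X Y f \<and>
     (\<forall>x\<in>topspace X.
        case t of Ascending \<Rightarrow> wY (f x) dvd wX x | Descending \<Rightarrow> wX x dvd wY (f x))"

definition simplex_complex :: "nat \<Rightarrow> nat set set" where
  "simplex_complex n = {\<sigma>. \<sigma> \<noteq> {} \<and> \<sigma> \<subseteq> {..n}}"

text \<open>A point of the standard simplex lies in the relative interior of the face spanned by the
  vertices at which its coordinate is nonzero.\<close>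

definition simplex_weight :: "(nat set \<Rightarrow> nat) \<Rightarrow> (nat \<Rightarrow> real) \<Rightarrow> nat" where
  "simplex_weight \<xi> x = \<xi> {i. x i \<noteq> 0}"

text \<open>A weighted singular simplex is a pair \<open>(\<xi>, \<theta>)\<close>. Both functions are made canonical outside
  their domains, so that equality of pairs is equality of weighted singular simplices.\<close>

type_synonym 'b wsimplex = "(nat set \<Rightarrow> nat) \<times> ((nat \<Rightarrow> real) \<Rightarrow> 'b)"

definition weighted_singular_simplices ::
  "weight_type \<Rightarrow> 'b topology \<Rightarrow> ('b \<Rightarrow> nat) \<Rightarrow> nat \<Rightarrow> 'b wsimplex set" where
  "weighted_singular_simplices t X wX n =
     {(\<xi>, \<theta>). \<xi> \<in> extensional (simplex_complex n) \<and>
        divisibly_weighted t (simplex_complex n) \<xi> \<and>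
        \<theta> \<in> extensional (standard_simplex n) \<and>
        W_continuous t (subtopology (powertop_real UNIV) (standard_simplex n)) (simplex_weight \<xi>)
          X wX \<theta>}"

text \<open>The \<open>j\<close>-th face is identified with the standard \<open>(n-1)\<close>-simplex by the order-preserving
  bijection of vertices that skips \<open>j\<close>; on points this is \<^const>\<open>simplical_face\<close>.\<close>

definition skip_vertex :: "nat \<Rightarrow> nat \<Rightarrow> nat" where
  "skip_vertex j i = (if i < j then i else Suc i)"

definition weighted_singular_face :: "nat \<Rightarrow> nat \<Rightarrow> 'b wsimplex \<Rightarrow> 'b wsimplex" where
  "weighted_singular_face n j = (\<lambda>(\<xi>, \<theta>).
     (restrict (\<lambda>\<sigma>. \<xi> (skip_vertex j ` \<sigma>)) (simplex_complex (n - 1)), singular_face n j \<theta>))"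

definition weighted_singular_chain_group ::
  "weight_type \<Rightarrow> 'b topology \<Rightarrow> ('b \<Rightarrow> nat) \<Rightarrow> nat \<Rightarrow> ('b wsimplex \<Rightarrow>\<^sub>0 int) monoid" where
  "weighted_singular_chain_group t X wX n =
     free_Abelian_group (weighted_singular_simplices t X wX n)"

definition weighted_singular_boundary ::
  "weight_type \<Rightarrow> nat \<Rightarrow> ('b wsimplex \<Rightarrow>\<^sub>0 int) \<Rightarrow> ('b wsimplex \<Rightarrow>\<^sub>0 int)" where
  "weighted_singular_boundary t n =
     frag_extend (\<lambda>(\<xi>, \<theta>). \<Sum>j\<le>n.
       frag_cmul ((-1) ^ j * weight_coeff t \<xi> {..n} ({..n} - {j}))
                 (frag_of (weighted_singular_face n j (\<xi>, \<theta>))))"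

definition weighted_singular_homology ::
  "weight_type \<Rightarrow> 'b topology \<Rightarrow> ('b \<Rightarrow> nat) \<Rightarrow> nat \<Rightarrow> ('b wsimplex \<Rightarrow>\<^sub>0 int) set monoid" where
  "weighted_singular_homology t X wX n =
     complex_homology (weighted_singular_chain_group t X wX) (weighted_singular_boundary t) n"

end

theory Submission
  imports Defs
begin

text \<open>A weighted singular simplex of a polyhedron is subdivided until the vertex of largest barycentric
  coordinate at any of its points lies in the carrier of every other of its points. Sending each
  corner to that vertex is a simplicial approximation. It respects weights because the chosen vertices
  lie in the carriers, and for the same reason the straight-line homotopy to the approximation moves
  every point inside its carrier and is W-continuous. Hence every singular cycle is homologous to a
  simplicial one. Conversely, by a Sperner-type argument the approximation of an iterated subdivision
  of a simplex of \<open>K\<close> is that simplex, so no simplicial cycle becomes a boundary.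

  Weights enter formally: if a chain operator without weights sends a simplex of weight \<open>a\<close> to simplices
  of weight \<open>b\<close> with \<open>b\<close> dividing \<open>a\<close> (or conversely, for descending weights), multiplying these terms by
  the ratio of the weights gives the weighted operator, and all identities between operators survive.\<close>

section \<open>Chains of lists\<close>

text \<open>The approximation of a weighted singular simplex does not end in \<open>K\<close> with
  its own weights: a corner \<open>z\<close> is sent to a vertex \<open>v\<close> but keeps the
  weight of the singular simplex at \<open>z\<close>, which is only known to dominate
  \<open>\<mu> {v}\<close>, and the labels may repeat or come in any order. Two homotopies are
  therefore used: a prism moves the simplex to the linear simplex on its labels with the old
  weights, and a cone construction then resets the weights, sorts the vertices and kills degenerate
  lists. All operators are first built on plain lists, where cones over the augmented boundary give
  the chain identities by a uniform induction. The simplicial side consists of cosets; an arbitrary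
  total order of the vertices provides normal forms, and the wedge product of labels makes the
  labelling a chain map to them.\<close>

lemma frag_extend_extend: "frag_extend f (frag_extend g c) = frag_extend (\<lambda>x. frag_extend f (g x)) c"
  using subset_UNIV
  by (induction c rule: frag_induction) (auto simp: frag_extend_diff)

lemma frag_extend_fun_diff: "frag_extend (\<lambda>x. f x - g x) c = frag_extend f c - frag_extend g c"
  using subset_UNIV
  by (induction c rule: frag_induction) (auto simp: frag_extend_diff)

lemma frag_extend_fun_cmul: "frag_extend (\<lambda>x. frag_cmul k (f x)) c = frag_cmul k (frag_extend f c)"
  unfolding frag_extend_def by (simp add: frag_cmul_sum mult.commute)

lemma keys_frag_extend_subset:
  assumes "Poly_Mapping.keys c \<subseteq> S" "\<And>x. x \<in> S \<Longrightarrow> Poly_Mapping.keys (f x) \<subseteq> T"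
  shows "Poly_Mapping.keys (frag_extend f c) \<subseteq> T"
  using keys_frag_extend[of f c] assms by blast

lemma keys_diff_subset:
  fixes a b :: "'a \<Rightarrow>\<^sub>0 int"
  assumes "Poly_Mapping.keys a \<subseteq> T" "Poly_Mapping.keys b \<subseteq> T"
  shows "Poly_Mapping.keys (a - b) \<subseteq> T"
  using keys_diff[of a b] assms by blast

definition frag_image :: "('a \<Rightarrow> 'b) \<Rightarrow> ('a \<Rightarrow>\<^sub>0 int) \<Rightarrow> ('b \<Rightarrow>\<^sub>0 int)" where
  "frag_image g = frag_extend (\<lambda>x. frag_of (g x))"

lemma frag_image_simps [simp]:
  "frag_image g 0 = 0" "frag_image g (frag_of x) = frag_of (g x)"
  "frag_image g (a - b) = frag_image g a - frag_image g b"
  "frag_image g (a + b) = frag_image g a + frag_image g b"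
  "frag_image g (- a) = - frag_image g a"
  "frag_image g (frag_cmul k a) = frag_cmul k (frag_image g a)"
  by (auto simp: frag_image_def frag_extend_diff frag_extend_add frag_extend_cmul frag_extend_minus)

lemma frag_extend_image: "frag_extend f (frag_image g c) = frag_extend (\<lambda>x. f (g x)) c"
  by (simp add: frag_image_def frag_extend_extend)

lemma frag_image_extend: "frag_image g (frag_extend f c) = frag_extend (\<lambda>x. frag_image g (f x)) c"
  by (simp add: frag_image_def frag_extend_extend)

lemma frag_image_image: "frag_image g (frag_image f c) = frag_image (\<lambda>x. g (f x)) c"
  by (simp add: frag_image_def frag_extend_extend)

lemma frag_image_id: "(\<And>x. x \<in> Poly_Mapping.keys c \<Longrightarrow> g x = x) \<Longrightarrow> frag_image g c = c"
  unfolding frag_image_def using frag_expansion[of c] frag_extend_eq[of c "\<lambda>x. frag_of (g x)" frag_of]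
  by simp

lemma keys_frag_image: "Poly_Mapping.keys (frag_image g c) \<subseteq> g ` Poly_Mapping.keys c"
  unfolding frag_image_def by (rule order.trans[OF keys_frag_extend]) (auto simp: keys_frag_of)

lemma keys_frag_extendE:
  assumes "y \<in> Poly_Mapping.keys (frag_extend f c)"
  obtains x where "x \<in> Poly_Mapping.keys c" "y \<in> Poly_Mapping.keys (f x)"
  using set_mp[OF keys_frag_extend assms] by blast

lemma keys_frag_imageE:
  assumes "y \<in> Poly_Mapping.keys (frag_image g c)"
  obtains x where "x \<in> Poly_Mapping.keys c" "y = g x"
  using set_mp[OF keys_frag_image assms] by blast

lemma frag_cmul_neg: "frag_cmul k (- c) = frag_cmul (- k) c"
  by (rule poly_mapping_eqI) simp

lemma keys_diff_cmul: "Poly_Mapping.keys (frag_of a - frag_cmul k (frag_of b)) \<subseteq> {a, b}"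
  by (rule keys_diff_subset) (use keys_cmul[of k "frag_of b"] in \<open>auto simp: keys_frag_of\<close>)

text \<open>The simplicial boundary is augmented: the boundary of a one-element list is the empty list.
  This makes prefixing an element a contraction (\<open>list_chain_bd_Cons\<close> below).\<close>

primrec list_bd :: "'x list \<Rightarrow> ('x list \<Rightarrow>\<^sub>0 int)" where
  "list_bd [] = 0"
| "list_bd (x # xs) = frag_of xs - frag_image (Cons x) (list_bd xs)"

abbreviation list_chain_bd :: "('x list \<Rightarrow>\<^sub>0 int) \<Rightarrow> ('x list \<Rightarrow>\<^sub>0 int)" where
  "list_chain_bd \<equiv> frag_extend list_bd"

lemma list_chain_bd_Cons: "list_chain_bd (frag_image (Cons x) c) = c - frag_image (Cons x) (list_chain_bd c)"
proof -
  have "list_chain_bd (frag_image (Cons x) c) = frag_extend (\<lambda>l. frag_of l - frag_image (Cons x) (list_bd l)) c"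
    by (simp add: frag_extend_image)
  also have "\<dots> = c - frag_image (Cons x) (list_chain_bd c)"
    by (simp add: frag_extend_fun_diff frag_image_extend flip: frag_expansion)
  finally show ?thesis .
qed

lemma list_bd_bd: "list_chain_bd (list_bd l) = 0"
  by (induction l) (auto simp: frag_extend_diff list_chain_bd_Cons)

lemma list_face_Cons [simp]: "list_face 0 (x # xs) = xs" "list_face (Suc j) (x # xs) = x # list_face j xs"
  by (auto simp: list_face_def)

text \<open>The bridge from the recursive boundary to the alternating sums over faces by which both
  weighted boundaries are defined.\<close>

lemma list_bd_sum: "list_bd l = (\<Sum>j<length l. frag_cmul ((-1) ^ j) (frag_of (list_face j l)))"
proof (induction l)
  case (Cons x xs)
  have "frag_image (Cons x) (\<Sum>j<length xs. frag_cmul ((-1) ^ j) (frag_of (list_face j xs)))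
      = (\<Sum>j<length xs. frag_cmul ((-1) ^ j) (frag_of (x # list_face j xs)))"
    unfolding frag_image_def by (subst frag_extend_sum) (auto simp: frag_extend_cmul o_def)
  with Cons show ?case
    by (simp add: sum.lessThan_Suc_shift sum_negf flip: minus_frag_cmul del: sum.lessThan_Suc)
qed auto

lemma length_list_face: "j < length l \<Longrightarrow> length (list_face j l) = length l - 1"
  by (auto simp: list_face_def)

lemma set_list_face: "set (list_face j l) \<subseteq> set l"
  by (auto simp: list_face_def dest: in_set_takeD in_set_dropD)

lemma keys_list_bd:
  "Poly_Mapping.keys (list_bd l) \<subseteq> {m. length l = Suc (length m) \<and> set m \<subseteq> set l}"
proof (induction l)
  case (Cons x l)
  show ?case unfolding list_bd.simps
    by (rule keys_diff_subset) (use Cons keys_frag_image[of "(#) x" "list_bd l"] in \<open>fastforce simp: keys_frag_of\<close>)+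
qed auto

lemma frag_image_map_list_bd: "frag_image (map g) (list_bd l) = list_bd (map g l)"
proof (induction l)
  case (Cons x l)
  show ?case by (simp add: frag_image_image flip: Cons.IH)
qed auto

lemma frag_image_map_list_chain_bd:
  "frag_image (map g) (list_chain_bd c) = list_chain_bd (frag_image (map g) c)"
  by (simp add: frag_image_extend frag_extend_image frag_image_map_list_bd)

subsection \<open>Barycentric subdivision\<close>

text \<open>\<open>b\<close> assigns a barycentre to a list; the natural number is the length of the list.\<close>

primrec subdiv_aux :: "('x list \<Rightarrow> 'x) \<Rightarrow> nat \<Rightarrow> 'x list \<Rightarrow> ('x list \<Rightarrow>\<^sub>0 int)" where
  "subdiv_aux b 0 l = frag_of []"
| "subdiv_aux b (Suc n) l = frag_image (Cons (b l)) (frag_extend (subdiv_aux b n) (list_bd l))"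

definition subdiv :: "('x list \<Rightarrow> 'x) \<Rightarrow> 'x list \<Rightarrow> ('x list \<Rightarrow>\<^sub>0 int)" where
  "subdiv b l = subdiv_aux b (length l) l"

text \<open>The homotopy between the identity and a chain map \<open>\<Phi>\<close>, built by coning off.\<close>

primrec cone_htpy_aux ::
  "('x list \<Rightarrow> 'x) \<Rightarrow> ('x list \<Rightarrow> 'x list \<Rightarrow>\<^sub>0 int) \<Rightarrow> nat \<Rightarrow> 'x list \<Rightarrow> ('x list \<Rightarrow>\<^sub>0 int)" where
  "cone_htpy_aux b \<Phi> 0 l = 0"
| "cone_htpy_aux b \<Phi> (Suc n) l =
     frag_image (Cons (b l)) (frag_of l - \<Phi> l - frag_extend (cone_htpy_aux b \<Phi> n) (list_bd l))"

definition cone_htpy ::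
  "('x list \<Rightarrow> 'x) \<Rightarrow> ('x list \<Rightarrow> 'x list \<Rightarrow>\<^sub>0 int) \<Rightarrow> 'x list \<Rightarrow> ('x list \<Rightarrow>\<^sub>0 int)" where
  "cone_htpy b \<Phi> l = cone_htpy_aux b \<Phi> (length l) l"

lemma frag_extend_list_bd_cong:
  "(\<And>m. length l = Suc (length m) \<Longrightarrow> set m \<subseteq> set l \<Longrightarrow> f m = g m)
     \<Longrightarrow> frag_extend f (list_bd l) = frag_extend g (list_bd l)"
  using keys_list_bd[of l] by (intro frag_extend_eq) blast

lemma subdiv_Nil [simp]: "subdiv b [] = frag_of []"
  by (simp add: subdiv_def)

lemma subdiv_step: "l \<noteq> [] \<Longrightarrow> subdiv b l = frag_image (Cons (b l)) (frag_extend (subdiv b) (list_bd l))"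
  by (cases "length l")
     (auto simp: subdiv_def intro!: arg_cong[where f = "frag_image _"] frag_extend_list_bd_cong)

lemma cone_htpy_Nil [simp]: "cone_htpy b \<Phi> [] = 0"
  by (simp add: cone_htpy_def)

lemma cone_htpy_step:
  "l \<noteq> [] \<Longrightarrow> cone_htpy b \<Phi> l =
     frag_image (Cons (b l)) (frag_of l - \<Phi> l - frag_extend (cone_htpy b \<Phi>) (list_bd l))"
  by (cases "length l")
     (auto simp: cone_htpy_def simp del: frag_image_simps
       intro!: arg_cong[where f = "frag_image _"] arg_cong2[where f = "(-)"] frag_extend_list_bd_cong)

text \<open>Every operator below is a cone over an expression in its values on the boundary, so
  statements about it are proved by induction on the length of the list.\<close>

lemma list_bd_induct [case_names Nil step]:
  assumes "P []" "\<And>l. l \<noteq> [] \<Longrightarrow> (\<And>m. length l = Suc (length m) \<Longrightarrow> set m \<subseteq> set l \<Longrightarrow> P m) \<Longrightarrow> P l"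
  shows "P l"
proof (induction "length l" arbitrary: l rule: less_induct)
  case less
  show ?case by (cases "l = []") (use assms less in auto)
qed

text \<open>The boundary of a cone is its base minus the cone over the boundary of the base. Here
  the base is the subdivided boundary of \<open>l\<close>, whose own boundary vanishes by the
  induction hypothesis and \<open>list_bd_bd\<close>.\<close>

lemma list_chain_bd_subdiv: "list_chain_bd (subdiv b l) = frag_extend (subdiv b) (list_bd l)"
proof (induction l rule: list_bd_induct)
  case (step l)
  have "frag_extend (\<lambda>m. list_chain_bd (subdiv b m)) (list_bd l)
      = frag_extend (\<lambda>m. frag_extend (subdiv b) (list_bd m)) (list_bd l)"
    by (rule frag_extend_list_bd_cong) (rule step)
  also have "\<dots> = 0"
    by (simp add: list_bd_bd flip: frag_extend_extend)
  finally show ?case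
    using step(1) by (simp add: subdiv_step list_chain_bd_Cons frag_extend_extend)
qed auto

text \<open>The cone is taken over exactly the chain that its boundary should be. By the induction
  hypothesis for the faces that chain is a cycle, so the correction term of
  \<open>list_chain_bd_Cons\<close> vanishes. That \<Phi> fixes the empty list starts the
  induction.\<close>

lemma list_chain_bd_cone_htpy:
  assumes "\<And>l. list_chain_bd (\<Phi> l) = frag_extend \<Phi> (list_bd l)" "\<Phi> [] = frag_of []"
  shows "list_chain_bd (cone_htpy b \<Phi> l) = frag_of l - \<Phi> l - frag_extend (cone_htpy b \<Phi>) (list_bd l)"
proof (induction l rule: list_bd_induct)
  case (step l)
  have "frag_extend (\<lambda>m. list_chain_bd (cone_htpy b \<Phi> m)) (list_bd l)
      = frag_extend (\<lambda>m. frag_of m - \<Phi> m - frag_extend (cone_htpy b \<Phi>) (list_bd m)) (list_bd l)"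
    by (rule frag_extend_list_bd_cong) (rule step)
  also have "\<dots> = list_bd l - frag_extend \<Phi> (list_bd l)"
    by (simp add: frag_extend_fun_diff list_bd_bd flip: frag_extend_extend frag_expansion)
  finally show ?case
    using step(1) by (simp add: assms cone_htpy_step list_chain_bd_Cons frag_extend_extend frag_extend_diff)
qed (auto simp: assms)

lemma subdiv_natural:
  assumes "\<And>m. m \<noteq> [] \<Longrightarrow> set m \<subseteq> set l \<Longrightarrow> g (b m) = b' (map g m)"
  shows "frag_image (map g) (subdiv b l) = subdiv b' (map g l)"
  using assms
proof (induction l rule: list_bd_induct)
  case (step l)
  have "frag_extend (\<lambda>m. frag_image (map g) (subdiv b m)) (list_bd l)
      = frag_extend (\<lambda>m. subdiv b' (map g m)) (list_bd l)"
    by (rule frag_extend_list_bd_cong) (use step in blast)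
  with step(1) step.prems[of l] show ?case
    by (simp add: subdiv_step frag_image_image flip: frag_image_map_list_bd)
       (simp add: frag_image_image frag_extend_image frag_image_extend flip: frag_image_image[of "(#) _" "map g"])
qed auto

lemma cone_htpy_natural:
  assumes "\<And>m. m \<noteq> [] \<Longrightarrow> set m \<subseteq> set l \<Longrightarrow> g (b m) = b' (map g m)"
    and "\<And>m. set m \<subseteq> set l \<Longrightarrow> frag_image (map g) (\<Phi> m) = \<Phi>' (map g m)"
  shows "frag_image (map g) (cone_htpy b \<Phi> l) = cone_htpy b' \<Phi>' (map g l)"
  using assms
proof (induction l rule: list_bd_induct)
  case (step l)
  have "frag_extend (\<lambda>m. frag_image (map g) (cone_htpy b \<Phi> m)) (list_bd l)
      = frag_extend (\<lambda>m. cone_htpy b' \<Phi>' (map g m)) (list_bd l)"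
    by (rule frag_extend_list_bd_cong) (use step in blast)
  with step(1) step.prems(1)[of l] step.prems(2)[of l, symmetric] show ?case
    by (simp add: cone_htpy_step frag_image_image flip: frag_image_map_list_bd)
       (simp add: frag_image_image frag_extend_image frag_image_extend flip: frag_image_image[of "(#) _" "map g"])
qed auto

text \<open>Any set closed under \<open>b\<close> confines the subdivision. It is applied to
  standard simplices, to their faces and to sup-norm balls.\<close>

lemma keys_subdiv:
  assumes "set l \<subseteq> D" "\<And>m. m \<noteq> [] \<Longrightarrow> set m \<subseteq> D \<Longrightarrow> b m \<in> D"
  shows "Poly_Mapping.keys (subdiv b l) \<subseteq> {m. length m = length l \<and> set m \<subseteq> D}"
  using assms(1)
proof (induction l rule: list_bd_induct)
  case (step l)
  have "Poly_Mapping.keys (frag_extend (subdiv b) (list_bd l)) \<subseteq> {m. Suc (length m) = length l \<and> set m \<subseteq> D}"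
    by (rule keys_frag_extend_subset[OF keys_list_bd]) (use step in fastforce)
  then show ?case
    using step assms(2)[of l] keys_frag_image[of "(#) (b l)" "frag_extend (subdiv b) (list_bd l)"]
    by (fastforce simp: subdiv_step)
qed (auto simp: keys_frag_of)

lemma keys_cone_htpy:
  assumes "set l \<subseteq> D" "\<And>m. m \<noteq> [] \<Longrightarrow> set m \<subseteq> D \<Longrightarrow> b m \<in> D"
    and "\<And>m. set m \<subseteq> D \<Longrightarrow> Poly_Mapping.keys (\<Phi> m) \<subseteq> {m'. length m' = length m \<and> set m' \<subseteq> D}"
  shows "Poly_Mapping.keys (cone_htpy b \<Phi> l) \<subseteq> {m. length m = Suc (length l) \<and> set m \<subseteq> D}"
  using assms(1)
proof (induction l rule: list_bd_induct)
  case (step l)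
  let ?c = "frag_of l - \<Phi> l - frag_extend (cone_htpy b \<Phi>) (list_bd l)"
  have "Poly_Mapping.keys ?c \<subseteq> {m. length m = length l \<and> set m \<subseteq> D}"
    by (intro keys_diff_subset assms(3) step.prems keys_frag_extend_subset[OF keys_list_bd])
       (use step in \<open>fastforce simp: keys_frag_of\<close>)+
  then show ?case
    using step assms(2)[of l] keys_frag_image[of "(#) (b l)" ?c]
    by (fastforce simp: cone_htpy_step simp del: frag_image_simps)
qed auto

subsection \<open>The prism operator\<close>

text \<open>A list of pairs \<open>(a\<^sub>i, b\<^sub>i)\<close> stands for the prism with bottom \<open>a\<^sub>0\<dots>a\<^sub>n\<close> and top \<open>b\<^sub>0\<dots>b\<^sub>n\<close>.\<close>

primrec prism_chain :: "('x \<times> 'x) list \<Rightarrow> ('x list \<Rightarrow>\<^sub>0 int)" where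
  "prism_chain [] = 0"
| "prism_chain (c # L) = frag_image (Cons (fst c)) (frag_of (snd c # map snd L) - prism_chain L)"

text \<open>Unrolled, \<open>prism_chain\<close> is the classical sum of (-1)^i
  [a_0,...,a_i,b_i,...,b_n]. The recursion is a cone from a_0 over the top and the smaller prism, so
  the cone formula reduces the claim to the tail of the list.\<close>

lemma list_chain_bd_prism:
  "list_chain_bd (prism_chain L) = frag_of (map snd L) - frag_of (map fst L) - frag_extend prism_chain (list_bd L)"
proof (induction L)
  case (Cons c L)
  have "frag_extend (\<lambda>l. prism_chain (c # l)) (list_bd L)
      = frag_image (Cons (fst c)) (frag_image (Cons (snd c)) (list_bd (map snd L)) - frag_extend prism_chain (list_bd L))"
    by (simp add: frag_extend_fun_diff frag_image_extend frag_image_image flip: frag_image_map_list_bd)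
       (simp add: frag_image_def)
  with Cons show ?case
    by (simp add: frag_extend_diff frag_extend_image[of prism_chain] list_chain_bd_Cons)
qed auto

lemma prism_natural:
  "frag_image (map g) (prism_chain L) = prism_chain (map (map_prod g g) L)"
proof (induction L)
  case (Cons c L)
  have "frag_image (map g) (frag_image ((#) (fst c)) (prism_chain L)) = frag_image ((#) (g (fst c))) (frag_image (map g) (prism_chain L))"
    by (simp add: frag_image_image)
  with Cons show ?case by (simp add: o_def)
qed auto

lemma keys_prism:
  "Poly_Mapping.keys (prism_chain L) \<subseteq> {m. length m = Suc (length L) \<and> set m \<subseteq> fst ` set L \<union> snd ` set L}"
proof (induction L)
  case (Cons c L)
  have "Poly_Mapping.keys (frag_of (snd c # map snd L) - prism_chain L) \<subseteq> {m. length m = Suc (length L) \<and> set m \<subseteq> fst ` set (c # L) \<union> snd ` set (c # L)}"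
    by (rule keys_diff_subset) (use Cons in \<open>force simp: keys_frag_of\<close>)+
  then show ?case
    using keys_frag_image[of "(#) (fst c)" "frag_of (snd c # map snd L) - prism_chain L"]
    by (fastforce simp del: frag_image_simps)
qed auto

section \<open>Alternating normal forms of lists\<close>

text \<open>The value of \<open>insert_alt\<close> is the wedge product of one vertex with a strictly sorted list.\<close>

locale strict_total_order =
  fixes lt :: "'v \<Rightarrow> 'v \<Rightarrow> bool"
  assumes irrefl: "\<not> lt x x" and trans: "lt x y \<Longrightarrow> lt y z \<Longrightarrow> lt x z"
    and total: "x \<noteq> y \<Longrightarrow> lt x y \<or> lt y x"
begin

primrec insert_alt :: "'v \<Rightarrow> 'v list \<Rightarrow> ('v list \<Rightarrow>\<^sub>0 int)" where
  "insert_alt x [] = frag_of [x]"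
| "insert_alt x (y # ys) = (if lt x y then frag_of (x # y # ys) else if x = y then 0
     else - frag_image (Cons y) (insert_alt x ys))"

text \<open>The wedge product of the entries: 0 if an entry repeats, otherwise the sorted list with
  the sign of the sorting permutation. Degenerate simplices produced by a labelling disappear
  here.\<close>

primrec sort_alt :: "'v list \<Rightarrow> ('v list \<Rightarrow>\<^sub>0 int)" where
  "sort_alt [] = frag_of []"
| "sort_alt (x # xs) = frag_extend (insert_alt x) (sort_alt xs)"

lemma asym: "lt x y \<Longrightarrow> \<not> lt y x"
  using irrefl[of x] trans[of x y x] by blast

lemma keys_insert_alt:
  "sorted_wrt lt l \<Longrightarrow> Poly_Mapping.keys (insert_alt x l)
     \<subseteq> {m. sorted_wrt lt m \<and> set m = insert x (set l) \<and> length m = Suc (length l)}"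
proof (induction l)
  case (Cons y ys)
  consider "lt x y" | "x = y" | "lt y x" using total by blast
  then show ?case
  proof cases
    case 3
    then have "\<not> lt x y" "x \<noteq> y" using asym[OF 3] irrefl by auto
    then show ?thesis
      using Cons 3 keys_frag_image[of "(#) y" "insert_alt x ys"] by fastforce
  next
    case 1
    then show ?thesis using Cons.prems trans[OF 1] by (auto simp: keys_frag_of)
  next
    case 2
    then show ?thesis by (simp add: irrefl)
  qed
qed (auto simp: keys_frag_of)

lemma keys_sort_alt:
  "Poly_Mapping.keys (sort_alt l) \<subseteq> {m. sorted_wrt lt m \<and> set m = set l \<and> length m = length l}"
proof (induction l)
  case (Cons x l)
  show ?case unfolding sort_alt.simps
    by (rule keys_frag_extend_subset[OF Cons]) (use keys_insert_alt in fastforce)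
qed (auto simp: keys_frag_of)

lemma sorted_imp_distinct: "sorted_wrt lt l \<Longrightarrow> distinct l"
  by (induction l) (auto simp: irrefl)

lemma sorted_unique:
  "sorted_wrt lt l \<Longrightarrow> sorted_wrt lt m \<Longrightarrow> set l = set m \<Longrightarrow> l = m"
proof (induction l arbitrary: m)
  case (Cons x l)
  then obtain y m' where m: "m = y # m'" by (cases m) auto
  have "x = y \<or> y \<in> set l" "x = y \<or> x \<in> set m'" using Cons.prems(3) unfolding m by auto
  then have "x = y" using Cons.prems(1,2) asym[of x y] unfolding m by auto
  moreover have "set l = set m'"
    using Cons.prems m \<open>x = y\<close> sorted_imp_distinct[of "x # l"] sorted_imp_distinct[of m] by auto
  ultimately show ?case using Cons m by auto
qed auto

lemma ex_sorted: "finite A \<Longrightarrow> \<exists>l. sorted_wrt lt l \<and> set l = A"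
proof (induction A rule: finite_induct)
  case (insert x A)
  then obtain l where l: "sorted_wrt lt l" "set l = A" by blast
  let ?m = "filter (\<lambda>y. lt y x) l @ x # filter (lt x) l"
  have "lt u v" if "lt u x" "lt x v" for u v using that by (rule trans)
  then have "sorted_wrt lt ?m" using l by (auto simp: sorted_wrt_append sorted_wrt_filter)
  moreover have "set ?m = insert x A" using l total[of _ x] insert by fastforce
  ultimately show ?case by blast
qed auto

lemma insert_alt_less: "(\<And>z. z \<in> set m \<Longrightarrow> lt x z) \<Longrightarrow> insert_alt x m = frag_of (x # m)"
  by (cases m) auto

lemma sort_alt_sorted: "sorted_wrt lt l \<Longrightarrow> sort_alt l = frag_of l"
  by (induction l) (auto simp: insert_alt_less)

text \<open>The wedge with \<open>x\<close> is the cone from \<open>x\<close> up to order and sign,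
  hence it obeys the formula that \<open>list_chain_bd_Cons\<close> gives for
  \<open>Cons x\<close>.\<close>

lemma list_chain_bd_insert_alt:
  "sorted_wrt lt l \<Longrightarrow>
    list_chain_bd (insert_alt x l) = frag_of l - frag_extend (insert_alt x) (list_bd l)"
proof (induction l)
  case (Cons y ys)
  consider "lt x y" | "x = y" | "lt y x" using total by blast
  then show ?case
  proof cases
    case 1
    have "frag_extend (insert_alt x) (list_bd (y # ys)) = frag_extend (\<lambda>m. frag_of (x # m)) (list_bd (y # ys))"
      by (intro frag_extend_list_bd_cong insert_alt_less) (use 1 Cons.prems trans[OF 1] in auto)
    with 1 show ?thesis by (simp add: frag_image_def)
  next
    case 2
    \<comment> \<open>The face that omits \<open>y\<close> is turned back into
      \<open>y # ys\<close>, and the faces that still begin with \<open>y\<close> are killed, so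
      both sides are 0.\<close>
    have "insert_alt y ys = frag_of (y # ys)" using Cons.prems by (auto intro: insert_alt_less)
    with 2 show ?thesis by (simp add: irrefl frag_extend_diff frag_extend_image frag_extend_eq_0)
  next
    case 3
    then have neg: "\<not> lt x y" "x \<noteq> y" using asym[OF 3] irrefl by auto
    have "frag_extend (insert_alt x) (frag_image (Cons y) c) = - frag_image (Cons y) (frag_extend (insert_alt x) c)" for c
      using neg by (simp add: frag_extend_image frag_image_extend flip: frag_extend_fun_cmul frag_cmul_minus_one)
    with 3 neg Cons show ?thesis
      by (simp add: frag_extend_diff frag_extend_minus list_chain_bd_Cons)
  qed
qed auto

lemma list_chain_bd_sort_alt: "list_chain_bd (sort_alt l) = frag_extend sort_alt (list_bd l)"
proof (induction l)
  case (Cons x l)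
  have "list_chain_bd (sort_alt (x # l)) = frag_extend (\<lambda>m. frag_of m - frag_extend (insert_alt x) (list_bd m)) (sort_alt l)"
    unfolding sort_alt.simps frag_extend_extend
    by (intro frag_extend_eq list_chain_bd_insert_alt) (use keys_sort_alt in blast)
  also have "\<dots> = sort_alt l - frag_extend (insert_alt x) (list_chain_bd (sort_alt l))"
    by (simp add: frag_extend_fun_diff flip: frag_expansion frag_extend_extend)
  also have "\<dots> = frag_extend sort_alt (list_bd (x # l))"
    by (simp add: Cons frag_extend_diff frag_extend_image frag_extend_extend)
  finally show ?case .
qed auto

text \<open>The defining relation of the exterior algebra, obtained by comparing both vertices with
  the head \<open>z\<close> and moving them past it.\<close>

lemma insert_alt_anticommute:
  "frag_extend (insert_alt x) (insert_alt y l) = - frag_extend (insert_alt y) (insert_alt x l)"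
proof (induction l)
  case Nil
  consider "lt x y" | "x = y" | "lt y x" using total by blast
  then show ?case using asym[of x y] asym[of y x] irrefl[of x] by cases auto
next
  case (Cons z l)
  have ge: "frag_extend (insert_alt u) (frag_image (Cons z) c) = - frag_image (Cons z) (frag_extend (insert_alt u) c)"
    if "lt z u" for u c
  proof -
    have "\<not> lt u z" "u \<noteq> z" using asym[OF that] irrefl that by auto
    then show ?thesis
      by (simp add: frag_extend_image frag_image_extend flip: frag_extend_fun_cmul frag_cmul_minus_one)
  qed
  have le: "frag_extend (insert_alt u) (frag_image (Cons z) c) = frag_image (\<lambda>l. u # z # l) c" if "lt u z" for u c
    using that by (simp add: frag_extend_image) (simp add: frag_image_def)
  have eq: "frag_extend (insert_alt z) (frag_image (Cons z) c) = 0" for c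
    by (simp add: frag_extend_image irrefl frag_extend_eq_0)
  have cmp: "(lt u v \<and> \<not> lt v u \<and> u \<noteq> v \<and> v \<noteq> u) \<or> (u = v \<and> \<not> lt v u) \<or> (lt v u \<and> \<not> lt u v \<and> u \<noteq> v \<and> v \<noteq> u)" for u v
    using total[of u v] asym[of u v] asym[of v u] irrefl[of v] by blast
  show ?case
  proof (cases "x = y")
    case True
    \<comment> \<open>Free abelian groups have no 2-torsion, so for equal vertices anticommutation
      in the tail forces the double wedge there to vanish.\<close>
    have "c = 0" if "c = - c" for c :: "'v list \<Rightarrow>\<^sub>0 int"
    proof (rule poly_mapping_eqI)
      fix l show "Poly_Mapping.lookup c l = Poly_Mapping.lookup 0 l"
        using arg_cong[OF that, of "\<lambda>c. Poly_Mapping.lookup c l"] by simp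
    qed
    with Cons True have "frag_extend (insert_alt y) (insert_alt y l) = 0" by blast
    with cmp[of y z] True show ?thesis
      by (elim disjE) (simp_all add: irrefl ge le eq frag_extend_minus frag_image_image)
  next
    case False
    \<comment> \<open>The claim is symmetric in the two vertices, so the smaller one is called
      \<open>u\<close>; \<open>z\<close> then has five possible positions.\<close>
    have cases: ?thesis if lt: "lt u v" and xy: "x = u \<and> y = v \<or> x = v \<and> y = u" for u v
    proof -
      have uv: "\<not> lt v u" "u \<noteq> v" "v \<noteq> u" using asym[OF lt] lt irrefl by auto
      have "frag_extend (insert_alt u) (insert_alt v (z # l)) = - frag_extend (insert_alt v) (insert_alt u (z # l))"
      proof -
        consider "lt u z" "lt v z" | "lt u z" "v = z" | "lt u z" "lt z v" | "u = z" "lt z v" | "lt z u" "lt z v"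
          using total[of u z] total[of v z] trans[OF lt, of z] trans[OF _ lt, of z] lt by blast
        then show ?thesis
        proof cases
          case 1
          then show ?thesis using lt uv by simp
        next
          case 2
          then show ?thesis using uv lt by (simp add: irrefl)
        next
          case 3
          then have "\<not> lt v z" "v \<noteq> z" using asym[of z v] irrefl[of z] by auto
          then show ?thesis using 3 uv by (simp add: frag_extend_minus le frag_image_image)
        next
          case 4
          then show ?thesis using uv by (simp add: frag_extend_minus eq irrefl)
        next
          case 5
          then have "\<not> lt v z" "v \<noteq> z" "\<not> lt u z" "u \<noteq> z" using asym[of z v] asym[of z u] irrefl[of z] by auto
          moreover have "frag_extend (insert_alt u) (insert_alt v l) = - frag_extend (insert_alt v) (insert_alt u l)"
            using Cons xy by (elim disjE) simp_all
          ultimately show ?thesis using 5 by (simp add: frag_extend_minus ge)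
        qed
      qed
      with xy show ?thesis by (elim disjE) simp_all
    qed
    show ?thesis using total[OF False] cases[of x y] cases[of y x] by blast
  qed
qed

lemma sort_alt_append: "sort_alt (xs @ ys) = foldr (\<lambda>x. frag_extend (insert_alt x)) xs (sort_alt ys)"
  by (induction xs) auto

lemma insert_alt_commute_foldr:
  "frag_extend (insert_alt a) (foldr (\<lambda>x. frag_extend (insert_alt x)) ys c)
     = frag_cmul ((-1) ^ length ys) (foldr (\<lambda>x. frag_extend (insert_alt x)) ys (frag_extend (insert_alt a) c))"
proof (induction ys)
  case (Cons y ys)
  have "frag_extend (insert_alt a) (frag_extend (insert_alt y) d) = - frag_extend (insert_alt y) (frag_extend (insert_alt a) d)" for d
    by (simp add: frag_extend_extend insert_alt_anticommute[of a y] flip: frag_extend_fun_cmul frag_cmul_minus_one)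
  then show ?case by (simp add: Cons frag_extend_cmul)
qed auto

lemma foldr_insert_alt_cmul:
  "foldr (\<lambda>x. frag_extend (insert_alt x)) ys (frag_cmul k c) = frag_cmul k (foldr (\<lambda>x. frag_extend (insert_alt x)) ys c)"
  by (induction ys) (auto simp: frag_extend_cmul)

text \<open>Moving the first of the two entries past \<open>ys\<close> costs the same sign in both
  arrangements, so only the exchange of two adjacent entries remains.\<close>

lemma sort_alt_swap: "sort_alt (xs @ a # ys @ b # zs) = - sort_alt (xs @ b # ys @ a # zs)"
proof -
  let ?F = "foldr (\<lambda>x. frag_extend (insert_alt x))"
  have expand: "sort_alt (a # ys @ b # zs)
      = frag_cmul ((-1) ^ length ys) (?F ys (frag_extend (insert_alt a) (frag_extend (insert_alt b) (sort_alt zs))))" for a b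
    by (simp add: sort_alt_append insert_alt_commute_foldr)
  have anti: "frag_extend (insert_alt a) (frag_extend (insert_alt b) d) = frag_cmul (-1) (frag_extend (insert_alt b) (frag_extend (insert_alt a) d))" for d
    by (simp add: frag_extend_extend insert_alt_anticommute[of a b] flip: frag_extend_fun_cmul frag_cmul_minus_one)
  have "sort_alt (a # ys @ b # zs) = frag_cmul (-1) (sort_alt (b # ys @ a # zs))"
    unfolding expand anti foldr_insert_alt_cmul by (simp add: frag_cmul_neg)
  then show ?thesis
    unfolding sort_alt_append[of xs] by (simp add: foldr_insert_alt_cmul del: sort_alt.simps frag_cmul_minus_one) simp
qed

lemma permute_list_transpose:
  assumes "a < b" "b < length l"
  shows "\<exists>xs ys zs. l = xs @ l ! a # ys @ l ! b # zs
    \<and> permute_list (Transposition.transpose a b) l = xs @ l ! b # ys @ l ! a # zs"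
proof (intro exI conjI)
  let ?xs = "take a l" and ?ys = "take (b - Suc a) (drop (Suc a) l)" and ?zs = "drop (Suc b) l"
  have *: "drop (Suc a) l = ?ys @ l ! b # ?zs"
    using assms id_take_nth_drop[of "b - Suc a" "drop (Suc a) l"] by (simp add: add.commute)
  show l: "l = ?xs @ l ! a # ?ys @ l ! b # ?zs"
    using assms id_take_nth_drop[of a l] * by simp
  show "permute_list (Transposition.transpose a b) l = ?xs @ l ! b # ?ys @ l ! a # ?zs"
  proof (rule nth_equalityI)
    fix i assume "i < length (permute_list (Transposition.transpose a b) l)"
    then have i: "i < length l" by simp
    show "permute_list (Transposition.transpose a b) l ! i = (?xs @ l ! b # ?ys @ l ! a # ?zs) ! i"
      using i assms
      by (auto simp: permute_list_def nth_append nth_Cons' Transposition.transpose_def)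
  qed (use assms in auto)
qed

text \<open>A permutation is a product of transpositions, each contributing the sign of
  \<open>sort_alt_swap\<close>. This is the orientation relation of the simplicial chain
  group.\<close>

lemma sort_alt_permute:
  assumes "\<pi> permutes {..<n}" "length l = n"
  shows "sort_alt (permute_list \<pi> l) = frag_cmul (sign \<pi>) (sort_alt l)"
  using assms(1) finite_lessThan assms(2)
proof (induction arbitrary: l rule: permutes_induct)
  case (swap a b p)
  note 4 = swap
  have tr: "Transposition.transpose a b permutes {..<n}" using 4 by (simp add: permutes_swap_id)
  have perm: "permutation p" using 4 by (auto simp: permutation_permutes)
  have "sort_alt (permute_list (Transposition.transpose a b \<circ> p) l) = sort_alt (permute_list p (permute_list (Transposition.transpose a b) l))"
    using 4 by (simp add: permute_list_compose)
  also have "\<dots> = frag_cmul (sign p) (sort_alt (permute_list (Transposition.transpose a b) l))"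
    using 4 by simp
  also have "sort_alt (permute_list (Transposition.transpose a b) l) = - sort_alt l"
  proof (cases "a < b")
    case True
    then show ?thesis using permute_list_transpose[of a b l] 4 sort_alt_swap by (metis lessThan_iff)
  next
    case False
    then show ?thesis using permute_list_transpose[of b a l] 4 sort_alt_swap
      by (metis lessThan_iff linorder_neqE_nat Transposition.transpose_commute)
  qed
  also have "frag_cmul (sign p) (- sort_alt l) = frag_cmul (sign (Transposition.transpose a b \<circ> p)) (sort_alt l)"
  proof -
    have "sign (Transposition.transpose a b \<circ> p) = - sign p"
      using 4 perm by (simp add: sign_compose permutation_swap_id sign_swap_id)
    then show ?thesis
      by (simp add: frag_cmul_neg)
  qed
  finally show ?case .
qed (auto simp: permute_list_id)

lemma ex_sorting_permutation:
  assumes "distinct l"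
  obtains \<pi> where "\<pi> permutes {..<length l}" "sorted_wrt lt (permute_list \<pi> l)"
    "sort_alt l = frag_cmul (sign \<pi>) (frag_of (permute_list \<pi> l))"
proof -
  obtain m where m: "sorted_wrt lt m" "set m = set l" using ex_sorted[of "set l"] by blast
  then have "mset m = mset l" using assms sorted_imp_distinct by (simp add: set_eq_iff_mset_eq_distinct[symmetric])
  then obtain \<pi> where \<pi>: "\<pi> permutes {..<length l}" "permute_list \<pi> l = m"
    by (rule mset_eq_permutation)
  have "frag_of m = frag_cmul (sign \<pi>) (sort_alt l)"
    using sort_alt_permute[OF \<pi>(1)] \<pi>(2) m(1) sort_alt_sorted by force
  then have "frag_cmul (sign \<pi>) (frag_of m) = sort_alt l"
    by (simp add: sign_idempotent)
  with that \<pi> m show ?thesis by metis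
qed

text \<open>Ends the Sperner argument: a cycle supported on one nondegenerate simplex vanishes.
  Through the augmentation this includes a single vertex, whose boundary is the empty list and not
  0.\<close>

lemma multiple_sorted_eq_0:
  assumes "Poly_Mapping.keys c \<subseteq> {m}" "m \<noteq> []" "distinct m" "list_chain_bd c = 0"
  shows "c = 0"
proof -
  define k where "k = Poly_Mapping.lookup c m"
  have c: "c = frag_cmul k (frag_of m)"
    using assms(1) by (intro poly_mapping_eqI) (auto simp: k_def lookup_single when_def in_keys_iff)
  obtain x xs where m: "m = x # xs" using assms(2) by (cases m) auto
  \<comment> \<open>All faces other than \<open>xs\<close> contain \<open>x\<close>, so nothing
    cancels it.\<close>
  have "xs \<notin> Poly_Mapping.keys (frag_image (Cons x) (list_bd xs))"
    using keys_frag_image[of "Cons x" "list_bd xs"] assms(3) m by auto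
  then have "Poly_Mapping.lookup (list_bd m) xs = 1"
    by (simp add: m lookup_minus in_keys_iff)
  moreover have "Poly_Mapping.lookup (list_chain_bd c) xs = 0" using assms(4) by simp
  ultimately have "k = 0" by (simp add: c frag_extend_cmul)
  then show ?thesis by (simp add: c)
qed

end

text \<open>The vertices come without an order; the well-ordering theorem supplies one.\<close>

lemma ex_strict_total_order: "\<exists>lt :: 'v \<Rightarrow> 'v \<Rightarrow> bool. strict_total_order lt"
proof -
  obtain r :: "'v rel" where r: "well_order_on UNIV r" using well_order_on by blast
  have "strict_total_order (\<lambda>x y. (x, y) \<in> r \<and> x \<noteq> y)"
    using r unfolding well_order_on_def linear_order_on_def partial_order_on_def preorder_on_def
    by unfold_locales (auto dest: transD antisymD simp: total_on_def)
  then show ?thesis by blast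
qed

section \<open>Weighted chain maps\<close>

text \<open>\<open>weight_le t b a\<close> says that a simplex of weight \<open>b\<close> may be a face of a simplex of weight \<open>a\<close>;
  \<open>weight_ratio t a b\<close> is then the coefficient of that face.\<close>

definition weight_le :: "weight_type \<Rightarrow> nat \<Rightarrow> nat \<Rightarrow> bool" where
  "weight_le t b a = (case t of Ascending \<Rightarrow> b dvd a | Descending \<Rightarrow> a dvd b)"

definition weight_ratio :: "weight_type \<Rightarrow> nat \<Rightarrow> nat \<Rightarrow> int" where
  "weight_ratio t a b = int (case t of Ascending \<Rightarrow> a div b | Descending \<Rightarrow> b div a)"

lemma weight_coeff_eq: "weight_coeff t \<mu> \<sigma> \<tau> = weight_ratio t (\<mu> \<sigma>) (\<mu> \<tau>)"
  by (simp add: weight_coeff_def weight_ratio_def)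

lemma weight_le_refl [simp]: "weight_le t a a"
  by (simp add: weight_le_def split: weight_type.split)

lemma weight_le_trans [trans]: "weight_le t a b \<Longrightarrow> weight_le t b c \<Longrightarrow> weight_le t a c"
  by (auto simp: weight_le_def split: weight_type.splits intro: dvd_trans)

lemma weight_le_antisym: "weight_le t a b \<Longrightarrow> weight_le t b a \<Longrightarrow> a = b"
  by (auto simp: weight_le_def split: weight_type.splits)

lemma weight_ratio_self [simp]: "0 < a \<Longrightarrow> weight_ratio t a a = 1"
  by (simp add: weight_ratio_def split: weight_type.split)

text \<open>The only arithmetic behind the passage to weights: ratios along a chain of
  divisibilities multiply, because all the divisions are exact.\<close>

lemma weight_ratio_mult:
  "weight_le t b a \<Longrightarrow> weight_le t c b \<Longrightarrow> 0 < a \<Longrightarrow> 0 < b \<Longrightarrow> 0 < c \<Longrightarrow>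
    weight_ratio t a b * weight_ratio t b c = weight_ratio t a c"
  unfolding weight_le_def weight_ratio_def
  by (cases t) (auto simp flip: of_nat_mult elim!: dvdE)

text \<open>If \<open>\<Phi>\<close> is a chain operator without weights, \<open>\<lambda>x. weighted t w H (w x) (\<Phi> x)\<close> is its weighted
  version. By \<open>weighted_weighted\<close> every identity between unweighted operators lifts.\<close>

definition weighted ::
  "weight_type \<Rightarrow> ('x \<Rightarrow> nat) \<Rightarrow> ('x \<Rightarrow> 'y \<Rightarrow>\<^sub>0 int) \<Rightarrow> nat \<Rightarrow> ('x \<Rightarrow>\<^sub>0 int) \<Rightarrow> ('y \<Rightarrow>\<^sub>0 int)" where
  "weighted t w H a c = frag_extend (\<lambda>x. frag_cmul (weight_ratio t a (w x)) (H x)) c"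

lemma weighted_simps [simp]:
  "weighted t w H a 0 = 0"
  "weighted t w H a (frag_of x) = frag_cmul (weight_ratio t a (w x)) (H x)"
  "weighted t w H a (c - d) = weighted t w H a c - weighted t w H a d"
  "weighted t w H a (c + d) = weighted t w H a c + weighted t w H a d"
  "weighted t w H a (- c) = - weighted t w H a c"
  "weighted t w H a (frag_cmul k c) = frag_cmul k (weighted t w H a c)"
  by (auto simp: weighted_def frag_extend_diff frag_extend_add frag_extend_cmul frag_extend_minus)

lemma weighted_cong:
  "(\<And>x. x \<in> Poly_Mapping.keys c \<Longrightarrow> w x = w' x \<and> H x = H' x) \<Longrightarrow> weighted t w H a c = weighted t w' H' a c"
  unfolding weighted_def by (rule frag_extend_eq) simp

lemma frag_extend_weighted:
  "frag_extend F (weighted t w H a c) = weighted t w (\<lambda>x. frag_extend F (H x)) a c"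
  unfolding weighted_def by (simp add: frag_extend_extend frag_extend_cmul)

lemma weighted_image: "weighted t w H a (frag_image g c) = weighted t (\<lambda>x. w (g x)) (\<lambda>x. H (g x)) a c"
  unfolding weighted_def by (simp add: frag_extend_image)

lemma weighted_weighted:
  assumes "0 < a"
    and "\<And>x. x \<in> Poly_Mapping.keys c \<Longrightarrow> 0 < w x \<and> weight_le t (w x) a \<and> H x = weighted t w' H' (w x) (\<Phi> x)"
    and "\<And>x y. x \<in> Poly_Mapping.keys c \<Longrightarrow> y \<in> Poly_Mapping.keys (\<Phi> x) \<Longrightarrow> 0 < w' y \<and> weight_le t (w' y) (w x)"
  shows "weighted t w H a c = weighted t w' H' a (frag_extend \<Phi> c)"
proof -
  have "frag_cmul (weight_ratio t a (w x)) (H x) = weighted t w' H' a (\<Phi> x)" if "x \<in> Poly_Mapping.keys c" for x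
  proof -
    have "frag_cmul (weight_ratio t a (w x)) (H x)
        = frag_extend (\<lambda>y. frag_cmul (weight_ratio t a (w x) * weight_ratio t (w x) (w' y)) (H' y)) (\<Phi> x)"
      using assms(2)[OF that] by (simp add: weighted_def flip: frag_extend_fun_cmul)
    also have "\<dots> = weighted t w' H' a (\<Phi> x)"
      unfolding weighted_def
      using assms(1,2,3) that by (intro frag_extend_eq) (auto simp: weight_ratio_mult)
    finally show ?thesis .
  qed
  then have "weighted t w H a c = frag_extend (\<lambda>x. weighted t w' H' a (\<Phi> x)) c"
    unfolding weighted_def[of t w] by (intro frag_extend_eq)
  also have "\<dots> = weighted t w' H' a (frag_extend \<Phi> c)"
    unfolding weighted_def by (simp add: frag_extend_extend)
  finally show ?thesis .
qed

lemma weighted_same: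
  assumes "\<And>x. x \<in> Poly_Mapping.keys c \<Longrightarrow> w x = a" "0 < a"
  shows "weighted t w H a c = frag_extend H c"
  unfolding weighted_def by (rule frag_extend_eq) (use assms in simp)

lemma keys_weighted:
  "(\<And>x. x \<in> Poly_Mapping.keys c \<Longrightarrow> Poly_Mapping.keys (H x) \<subseteq> T) \<Longrightarrow> Poly_Mapping.keys (weighted t w H a c) \<subseteq> T"
  unfolding weighted_def
  by (rule keys_frag_extend_subset[OF order.refl]) (meson keys_cmul order.trans)

lemma frag_image_weighted: "frag_image f (weighted t w H a c) = weighted t w (\<lambda>x. frag_image f (H x)) a c"
  unfolding frag_image_def by (rule frag_extend_weighted)

lemma frag_image_weighted_frag_of: "frag_image f (weighted t w frag_of a c) = weighted t w (\<lambda>x. frag_of (f x)) a c"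
  by (simp add: frag_image_weighted)

text \<open>The weight of the intermediate \<open>x\<close> cancels by
  \<open>weight_ratio_mult\<close>, leaving only the ambient weight \<open>a\<close> and the final
  weights. The boundary formulas for subdivisions, prisms and cones below come from this
  form.\<close>

lemma frag_extend_weighted_weighted:
  assumes "0 < a"
    and "\<And>x. x \<in> Poly_Mapping.keys c \<Longrightarrow> 0 < w x \<and> weight_le t (w x) a"
    and "\<And>x. x \<in> Poly_Mapping.keys c \<Longrightarrow> frag_extend F (H x) = weighted t w' H' (w x) (\<Phi> x)"
    and "\<And>x y. x \<in> Poly_Mapping.keys c \<Longrightarrow> y \<in> Poly_Mapping.keys (\<Phi> x) \<Longrightarrow> 0 < w' y \<and> weight_le t (w' y) (w x)"
  shows "frag_extend F (weighted t w H a c) = weighted t w' H' a (frag_extend \<Phi> c)"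
  unfolding frag_extend_weighted by (rule weighted_weighted) (use assms in auto)

lemma weighted_sum: "weighted t w H a (sum f I) = (\<Sum>i\<in>I. weighted t w H a (f i))"
  by (induction I rule: infinite_finite_induct) auto

definition weighted_bd :: "weight_type \<Rightarrow> ('x list \<Rightarrow> nat) \<Rightarrow> 'x list \<Rightarrow> ('x list \<Rightarrow>\<^sub>0 int)" where
  "weighted_bd t w l = weighted t w frag_of (w l) (list_bd l)"

text \<open>Monotone under inclusion of vertex sets, so order and repetition of the entries do not
  affect the weight. The empty list, which the augmented boundary produces, is left out.\<close>

definition list_weight :: "weight_type \<Rightarrow> ('x list \<Rightarrow> nat) \<Rightarrow> 'x set \<Rightarrow> bool" where
  "list_weight t w S \<longleftrightarrow>
     (\<forall>m m'. m \<noteq> [] \<longrightarrow> set m \<subseteq> set m' \<longrightarrow> set m' \<subseteq> S \<longrightarrow> 0 < w m \<and> weight_le t (w m) (w m'))"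

lemma list_weightD:
  "list_weight t w S \<Longrightarrow> m \<noteq> [] \<Longrightarrow> set m \<subseteq> S \<Longrightarrow> 0 < w m"
  "list_weight t w S \<Longrightarrow> m \<noteq> [] \<Longrightarrow> set m \<subseteq> set m' \<Longrightarrow> set m' \<subseteq> S \<Longrightarrow> weight_le t (w m) (w m')"
  unfolding list_weight_def by blast+

lemma list_bd_keysD:
  assumes "x \<in> Poly_Mapping.keys (list_bd l)" "2 \<le> length l"
  shows "x \<noteq> []" "set x \<subseteq> set l" "length l = Suc (length x)"
  using assms keys_list_bd[of l] by auto

text \<open>From three entries two boundary steps reach only nonempty lists, where the weight is
  controlled; there \<open>list_bd_bd\<close> can be lifted.\<close>

lemma weighted_bd_bd:
  assumes "list_weight t w (set l)" "3 \<le> length l"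
  shows "frag_extend (weighted_bd t w) (weighted_bd t w l) = 0"
proof -
  have "frag_extend (weighted_bd t w) (weighted t w frag_of (w l) (list_bd l))
      = weighted t w frag_of (w l) (frag_extend list_bd (list_bd l))"
  proof (rule frag_extend_weighted_weighted)
    show "0 < w l" using assms by (intro list_weightD(1)[OF assms(1)]) auto
    fix x assume x: "x \<in> Poly_Mapping.keys (list_bd l)"
    note x' = list_bd_keysD[OF x]
    show "0 < w x \<and> weight_le t (w x) (w l)"
      using list_weightD[OF assms(1), of x] list_weightD(2)[OF assms(1), of x l] x' assms(2) by simp
    show "frag_extend (weighted_bd t w) (frag_of x) = weighted t w frag_of (w x) (list_bd x)"
      by (simp add: weighted_bd_def)
    fix y assume y: "y \<in> Poly_Mapping.keys (list_bd x)"
    have "y \<noteq> []" "set y \<subseteq> set x" using list_bd_keysD[OF y] x' assms(2) by auto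
    then show "0 < w y \<and> weight_le t (w y) (w x)"
      using list_weightD[OF assms(1), of y] list_weightD(2)[OF assms(1), of y x] x' assms(2) by auto
  qed
  then show ?thesis by (simp add: weighted_bd_def list_bd_bd)
qed

section \<open>Homology of quasi-isomorphic complexes\<close>

lemma
  assumes A: "\<And>n. comm_group (A n)" and e: "\<And>n. e (Suc n) \<in> hom (A (Suc n)) (A n)"
  shows subgroup_cycle_set: "subgroup (cycle_set A e n) (A n)"
    and subgroup_boundary_set: "subgroup (boundary_set A e n) (A n)"
proof -
  have gr: "group (A n)" for n using A by (simp add: comm_group.axioms)
  have gh: "group_hom (A (Suc n)) (A n) (e (Suc n))" for n
    using gr e by (simp add: group_hom_def group_hom_axioms_def)
  show "subgroup (cycle_set A e n) (A n)"
    using group.subgroup_self[OF gr] group_hom.subgroup_kernel[OF gh]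
    by (cases n) (auto simp: cycle_set_def)
  show "subgroup (boundary_set A e n) (A n)"
    using group_hom.img_is_subgroup[OF gh] by (simp add: boundary_set_def)
qed

lemma boundary_subset_cycle:
  assumes "\<And>n. e (Suc n) \<in> hom (A (Suc n)) (A n)"
    and "\<And>n c. c \<in> carrier (A (Suc (Suc n))) \<Longrightarrow> e (Suc n) (e (Suc (Suc n)) c) = \<one>\<^bsub>A n\<^esub>"
  shows "boundary_set A e n \<subseteq> cycle_set A e n"
  using hom_carrier[OF assms(1)] assms(2) by (cases n) (fastforce simp: boundary_set_def cycle_set_def kernel_def)+

text \<open>First isomorphism theorem for the map from the cycles of \<open>C\<close> to the
  homology of \<open>C'\<close> induced by \<open>h\<close>: \<open>inj\<close> makes its kernel the
  boundaries, \<open>surj\<close> makes it onto. The hypotheses are elementwise because the geometry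
  delivers explicit cycles and bounding chains.\<close>

lemma complex_homology_iso:
  assumes C: "\<And>n. comm_group (C n)" and C': "\<And>n. comm_group (C' n)"
    and d: "\<And>n. d (Suc n) \<in> hom (C (Suc n)) (C n)" and d': "\<And>n. d' (Suc n) \<in> hom (C' (Suc n)) (C' n)"
    and dd: "\<And>n c. c \<in> carrier (C (Suc (Suc n))) \<Longrightarrow> d (Suc n) (d (Suc (Suc n)) c) = \<one>\<^bsub>C n\<^esub>"
    and dd': "\<And>n c. c \<in> carrier (C' (Suc (Suc n))) \<Longrightarrow> d' (Suc n) (d' (Suc (Suc n)) c) = \<one>\<^bsub>C' n\<^esub>"
    and h: "\<And>n. h n \<in> hom (C n) (C' n)"
    and hd: "\<And>n c. c \<in> carrier (C (Suc n)) \<Longrightarrow> h n (d (Suc n) c) = d' (Suc n) (h (Suc n) c)"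
    and surj: "\<And>n z. z \<in> cycle_set C' d' n \<Longrightarrow>
       \<exists>c \<in> cycle_set C d n. \<exists>w \<in> carrier (C' (Suc n)). z = d' (Suc n) w \<otimes>\<^bsub>C' n\<^esub> h n c"
    and inj: "\<And>n c. c \<in> cycle_set C d n \<Longrightarrow> h n c \<in> boundary_set C' d' n \<Longrightarrow> c \<in> boundary_set C d n"
  shows "complex_homology C d n \<cong> complex_homology C' d' n"
proof -
  have cycC: "subgroup (cycle_set C d n) (C n)" "subgroup (boundary_set C d n) (C n)" "boundary_set C d n \<subseteq> cycle_set C d n"
    using subgroup_cycle_set[of C d n] subgroup_boundary_set[of C d n] boundary_subset_cycle[of d C n] C d dd by auto
  have cycC': "subgroup (cycle_set C' d' n) (C' n)" "subgroup (boundary_set C' d' n) (C' n)" "boundary_set C' d' n \<subseteq> cycle_set C' d' n"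
    using subgroup_cycle_set[of C' d' n] subgroup_boundary_set[of C' d' n] boundary_subset_cycle[of d' C' n] C' d' dd' by auto
  define Z where "Z = subgroup_generated (C n) (cycle_set C d n)"
  define Z' where "Z' = subgroup_generated (C' n) (cycle_set C' d' n)"
  define B where "B = boundary_set C d n"
  define B' where "B' = boundary_set C' d' n"
  have gr: "group (C n)" "group (C' n)" using C C' by (auto simp: comm_group.axioms)
  have carrZ: "carrier Z = cycle_set C d n" "carrier Z' = cycle_set C' d' n"
    using cycC cycC'
    by (auto simp: Z_def Z'_def subgroup.carrier_subgroup_generated_subgroup)
  have cg: "comm_group Z" "comm_group Z'"
    using C C' by (auto simp: Z_def Z'_def intro!: group.abelian_subgroup_generated comm_group.axioms(2))
  then have gZ: "group Z" "group Z'" by (auto simp: comm_group.axioms)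
  have B': "subgroup B' Z'"
    unfolding Z'_def B'_def using cycC' gr by (intro group.subgroup_of_subgroup_generated) auto
  then have nB': "B' \<lhd> Z'" using cg comm_group.normal_iff_subgroup by blast
  have hcyc: "h n c \<in> cycle_set C' d' n" if "c \<in> cycle_set C d n" for c
  proof (cases n)
    case 0
    then show ?thesis using that hom_carrier[OF h] by (auto simp: cycle_set_def)
  next
    case (Suc k)
    then have c: "c \<in> carrier (C (Suc k))" "d (Suc k) c = \<one>\<^bsub>C k\<^esub>"
      using that by (auto simp: cycle_set_def kernel_def)
    have "d' (Suc k) (h (Suc k) c) = \<one>\<^bsub>C' k\<^esub>"
      using hd[OF c(1)] c(2) hom_one[OF h[of k]] C C' by (simp add: comm_group.axioms)
    then show ?thesis
      using Suc c hom_carrier[OF h] by (auto simp: cycle_set_def kernel_def)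
  qed
  have hZ: "h n \<in> hom Z Z'"
    using h[of n] hcyc carrZ subgroup.subset[OF cycC(1)]
    by (auto simp: hom_def Z_def Z'_def subset_iff)
  have mod: "(\<lambda>a. B' #>\<^bsub>Z'\<^esub> a) \<in> hom Z' (Z' Mod B')"
    by (rule normal.r_coset_hom_Mod[OF nB'])
  define \<phi> where "\<phi> = (\<lambda>c. B' #>\<^bsub>Z'\<^esub> h n c)"
  have \<phi>: "\<phi> \<in> hom Z (Z' Mod B')"
    using hom_compose[OF hZ mod] by (simp add: \<phi>_def o_def)
  have gM: "group (Z' Mod B')" using normal.factorgroup_is_group[OF nB'] .
  interpret gh: group_hom Z "Z' Mod B'" \<phi>
    using gZ gM \<phi> by (simp add: group_hom_def group_hom_axioms_def)
  have "kernel Z (Z' Mod B') \<phi> = B"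
  proof -
    have "\<phi> c = B' \<longleftrightarrow> c \<in> B" if "c \<in> carrier Z" for c
    proof
      assume "\<phi> c = B'"
      then have "h n c \<in> B'"
        using group.coset_join1[OF gZ(2) _ _ B'] hom_carrier[OF hZ] that by (auto simp: \<phi>_def)
      then show "c \<in> B" using inj that carrZ by (simp add: B_def B'_def)
    next
      assume "c \<in> B"
      then obtain w where w: "w \<in> carrier (C (Suc n))" "c = d (Suc n) w"
        by (auto simp: B_def boundary_set_def)
      then have "h (Suc n) w \<in> carrier (C' (Suc n))" using hom_carrier[OF h, of "Suc n"] by blast
      with w have "h n c \<in> B'"
        using hd[OF w(1)] by (auto simp: B'_def boundary_set_def)
      then show "\<phi> c = B'"
        using group.coset_join2[OF gZ(2) _ B'] subgroup.subset[OF B'] by (auto simp: \<phi>_def)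
    qed
    moreover have "B \<subseteq> carrier Z" using cycC carrZ by (simp add: B_def)
    ultimately show ?thesis by (auto simp: kernel_def)
  qed
  moreover have "\<phi> ` carrier Z = carrier (Z' Mod B')"
  proof
    show "\<phi> ` carrier Z \<subseteq> carrier (Z' Mod B')" using hom_carrier[OF \<phi>] by auto
    show "carrier (Z' Mod B') \<subseteq> \<phi> ` carrier Z"
    proof
      fix A assume "A \<in> carrier (Z' Mod B')"
      then obtain z where z: "z \<in> carrier Z'" "A = B' #>\<^bsub>Z'\<^esub> z"
        by (auto simp: carrier_FactGroup)
      obtain c w where cw: "c \<in> cycle_set C d n" "w \<in> carrier (C' (Suc n))" "z = d' (Suc n) w \<otimes>\<^bsub>C' n\<^esub> h n c"
        using surj z carrZ by blast
      have "h n c \<in> carrier Z'" using hcyc cw carrZ by simp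
      moreover have "z \<in> B' #>\<^bsub>Z'\<^esub> h n c"
        using cw by (auto simp: r_coset_def B'_def boundary_set_def Z'_def)
      ultimately have "A = \<phi> c"
        using group.repr_independence[OF gZ(2) _ _ B'] z by (simp add: \<phi>_def)
      then show "A \<in> \<phi> ` carrier Z" using cw carrZ by blast
    qed
  qed
  ultimately have "Z Mod B \<cong> Z' Mod B'"
    using gh.FactGroup_iso by simp
  then show ?thesis by (simp add: complex_homology_def Z_def Z'_def B_def B'_def)
qed

section \<open>Oriented weighted chains\<close>

lemma abs_simplicial_complexD:
  "abs_simplicial_complex K \<Longrightarrow> \<sigma> \<in> K \<Longrightarrow> finite \<sigma> \<and> \<sigma> \<noteq> {}"
  "abs_simplicial_complex K \<Longrightarrow> \<sigma> \<in> K \<Longrightarrow> \<tau> \<subseteq> \<sigma> \<Longrightarrow> \<tau> \<noteq> {} \<Longrightarrow> \<tau> \<in> K"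
  unfolding abs_simplicial_complex_def by blast+

lemma is_weightD:
  "is_weight t K \<mu> \<Longrightarrow> \<sigma> \<in> K \<Longrightarrow> 0 < \<mu> \<sigma>"
  "is_weight t K \<mu> \<Longrightarrow> \<sigma> \<in> K \<Longrightarrow> \<tau> \<in> K \<Longrightarrow> \<tau> \<subseteq> \<sigma> \<Longrightarrow> weight_le t (\<mu> \<tau>) (\<mu> \<sigma>)"
  unfolding is_weight_def weight_le_def by (cases t; simp)+

locale ordered_weighted_complex = strict_total_order lt
  for lt :: "'v \<Rightarrow> 'v \<Rightarrow> bool" +
  fixes t :: weight_type and K :: "'v set set" and \<mu> :: "'v set \<Rightarrow> nat"
  assumes weighted: "weighted_complex t K \<mu>"
begin

lemma complex: "abs_simplicial_complex K" and weight: "is_weight t K \<mu>"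
  using weighted by (auto simp: weighted_complex_def)

abbreviation vweight :: "'v list \<Rightarrow> nat" where "vweight l \<equiv> \<mu> (set l)"

abbreviation normalize :: "('v list \<Rightarrow>\<^sub>0 int) \<Rightarrow> ('v list \<Rightarrow>\<^sub>0 int)" where
  "normalize \<equiv> frag_extend sort_alt"

abbreviation vbd :: "('v list \<Rightarrow>\<^sub>0 int) \<Rightarrow> ('v list \<Rightarrow>\<^sub>0 int)" where
  "vbd \<equiv> frag_extend (weighted_bd t vweight)"

text \<open>A basis of the oriented chain group: one chosen orientation for each simplex.\<close>

definition sorted_simplices :: "nat \<Rightarrow> 'v list set" where
  "sorted_simplices n = {l. sorted_wrt lt l \<and> length l = Suc n \<and> set l \<in> K}"

lemma sorted_simplices_ordered: "sorted_simplices n \<subseteq> ordered_simplices K n"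
  by (auto simp: sorted_simplices_def ordered_simplices_def sorted_imp_distinct)

lemma list_weight_vweight: "S \<in> K \<Longrightarrow> list_weight t vweight S"
  unfolding list_weight_def
proof (intro allI impI)
  fix m m' :: "'v list" assume "S \<in> K" "m \<noteq> []" "set m \<subseteq> set m'" "set m' \<subseteq> S"
  moreover from this have "m' \<noteq> []" by auto
  ultimately have "set m \<in> K" "set m' \<in> K"
    using abs_simplicial_complexD(2)[OF complex, of S "set m"] abs_simplicial_complexD(2)[OF complex, of S "set m'"] by auto
  then show "0 < vweight m \<and> weight_le t (vweight m) (vweight m')"
    using \<open>set m \<subseteq> set m'\<close> is_weightD[OF weight] by blast
qed

lemma ordered_weighted_boundary_eq:
  assumes "Poly_Mapping.keys c \<subseteq> {l. length l = Suc n}"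
  shows "ordered_weighted_boundary t \<mu> n c = vbd c"
  unfolding ordered_weighted_boundary_def
proof (rule frag_extend_eq)
  fix l assume "l \<in> Poly_Mapping.keys c"
  then have "length l = Suc n" using assms by auto
  then show "(\<Sum>j\<le>n. frag_cmul ((-1) ^ j * weight_coeff t \<mu> (set l) (set (list_face j l))) (frag_of (list_face j l)))
      = weighted_bd t vweight l"
    by (simp add: weighted_bd_def list_bd_sum weighted_sum weight_coeff_eq lessThan_Suc_atMost)
qed

lemma ordered_keys_length: "Poly_Mapping.keys c \<subseteq> ordered_simplices K n \<Longrightarrow> Poly_Mapping.keys c \<subseteq> {l. length l = Suc n}"
  by (auto simp: ordered_simplices_def)

lemma keys_normalize:
  assumes "Poly_Mapping.keys c \<subseteq> {l. length l = Suc n \<and> set l \<in> K}"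
  shows "Poly_Mapping.keys (normalize c) \<subseteq> sorted_simplices n"
  by (rule keys_frag_extend_subset[OF assms])
     (use keys_sort_alt in \<open>force simp: sorted_simplices_def\<close>)

lemma keys_normalize_ordered:
  assumes "Poly_Mapping.keys c \<subseteq> ordered_simplices K n"
  shows "Poly_Mapping.keys (normalize c) \<subseteq> sorted_simplices n"
  by (rule keys_normalize) (use assms in \<open>auto simp: ordered_simplices_def\<close>)

lemma normalize_sorted:
  assumes "Poly_Mapping.keys c \<subseteq> sorted_simplices n"
  shows "normalize c = c"
proof -
  have "normalize c = frag_extend frag_of c"
    by (rule frag_extend_eq) (use assms in \<open>auto simp: sorted_simplices_def sort_alt_sorted\<close>)
  then show ?thesis by (simp flip: frag_expansion)
qed

lemma distinct_list_face: "distinct l \<Longrightarrow> distinct (list_face j l)"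
proof (induction l arbitrary: j)
  case (Cons x l)
  then show ?case using set_list_face[of "j - 1" l] by (cases j) auto
qed (simp add: list_face_def)

lemma keys_vbd:
  assumes "Poly_Mapping.keys c \<subseteq> ordered_simplices K (Suc n)"
  shows "Poly_Mapping.keys (vbd c) \<subseteq> ordered_simplices K n"
proof (rule keys_frag_extend_subset[OF assms])
  fix l assume l: "l \<in> ordered_simplices K (Suc n)"
  show "Poly_Mapping.keys (weighted_bd t vweight l) \<subseteq> ordered_simplices K n"
    unfolding weighted_bd_def
  proof (rule keys_weighted)
    fix x assume x: "x \<in> Poly_Mapping.keys (list_bd l)"
    have "2 \<le> length l" using l by (auto simp: ordered_simplices_def)
    note x' = list_bd_keysD[OF x this]
    have "x \<in> (\<Union>j\<in>{..<length l}. {list_face j l})"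
    proof -
      have "Poly_Mapping.keys (list_bd l) \<subseteq> (\<Union>j\<in>{..<length l}. {list_face j l})"
        unfolding list_bd_sum
        by (rule order.trans[OF keys_sum]) (auto simp: keys_frag_of)
      with x show ?thesis by blast
    qed
    then have "distinct x" using l distinct_list_face by (auto simp: ordered_simplices_def)
    moreover have "set x \<in> K"
      using l x' abs_simplicial_complexD(2)[OF complex, of "set l" "set x"] by (auto simp: ordered_simplices_def)
    ultimately show "Poly_Mapping.keys (frag_of x) \<subseteq> ordered_simplices K n"
      using l x' by (auto simp: ordered_simplices_def keys_frag_of)
  qed
qed

lemma vbd_vbd:
  assumes "Poly_Mapping.keys c \<subseteq> ordered_simplices K (Suc (Suc n))"
  shows "vbd (vbd c) = 0"
  unfolding frag_extend_extend
proof (rule frag_extend_eq_0)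
  fix l assume "l \<in> Poly_Mapping.keys c"
  then have "length l = Suc (Suc (Suc n))" "set l \<in> K" using assms by (auto simp: ordered_simplices_def)
  then show "vbd (weighted_bd t vweight l) = 0"
    by (intro weighted_bd_bd list_weight_vweight) auto
qed

text \<open>Stated for an arbitrary list weight \<open>w\<close> and labelling \<open>f\<close> so that it also applies to lists of
  vertices that carry weights of their own.\<close>

lemma weighted_normalize_bd:
  assumes w: "list_weight t w (set l)" and K: "f ` set l \<in> K" and len: "2 \<le> length l"
    and le: "\<And>m. m \<noteq> [] \<Longrightarrow> set m \<subseteq> set l \<Longrightarrow> weight_le t (\<mu> (f ` set m)) (w m)"
  shows "frag_extend (\<lambda>m. weighted t vweight frag_of (w m) (sort_alt (map f m))) (weighted_bd t w l)
       = vbd (weighted t vweight frag_of (w l) (sort_alt (map f l)))"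
proof -
  have ne: "l \<noteq> []" using len by auto
  then have wl: "0 < w l" using list_weightD(1)[OF w] by auto
  have K': "f ` set m \<in> K" if "m \<noteq> []" "set m \<subseteq> set l" for m
    using abs_simplicial_complexD(2)[OF complex K, of "f ` set m"] that by auto
  have kk: "set y = f ` set m \<and> length y = length m" if "y \<in> Poly_Mapping.keys (sort_alt (map f m))" for y m
    using that keys_sort_alt[of "map f m"] by auto
  have "frag_extend (\<lambda>m. weighted t vweight frag_of (w m) (sort_alt (map f m))) (weighted_bd t w l)
      = weighted t vweight frag_of (w l) (frag_extend (\<lambda>m. sort_alt (map f m)) (list_bd l))"
    unfolding weighted_bd_def
  proof (rule frag_extend_weighted_weighted[OF wl])
    fix x assume x: "x \<in> Poly_Mapping.keys (list_bd l)"
    note x' = list_bd_keysD[OF x len]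
    show "0 < w x \<and> weight_le t (w x) (w l)"
      using list_weightD(1)[OF w, of x] list_weightD(2)[OF w, of x l] x' by auto
    fix y assume y: "y \<in> Poly_Mapping.keys (sort_alt (map f x))"
    show "0 < vweight y \<and> weight_le t (vweight y) (w x)"
      using kk[OF y] le[of x] x' K'[of x] is_weightD(1)[OF weight] by auto
  qed auto
  \<comment> \<open>Without weights, labelling and sorting commute with the boundary; the steps
    before and after lift this equation to the weighted operators.\<close>
  also have "frag_extend (\<lambda>m. sort_alt (map f m)) (list_bd l) = list_chain_bd (sort_alt (map f l))"
    by (simp add: list_chain_bd_sort_alt frag_extend_image flip: frag_image_map_list_bd)
  also have "weighted t vweight frag_of (w l) \<dots> = vbd (weighted t vweight frag_of (w l) (sort_alt (map f l)))"
  proof (rule frag_extend_weighted_weighted[OF wl, symmetric])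
    fix x assume x: "x \<in> Poly_Mapping.keys (sort_alt (map f l))"
    show "0 < vweight x \<and> weight_le t (vweight x) (w l)"
      using kk[OF x] le[of l] ne K'[of l] is_weightD(1)[OF weight] by auto
    show "vbd (frag_of x) = weighted t vweight frag_of (vweight x) (list_bd x)"
      by (simp add: weighted_bd_def)
    fix y assume y: "y \<in> Poly_Mapping.keys (list_bd x)"
    have xl: "length x = length l" "set x \<in> K" using kk[OF x] K by auto
    have "y \<noteq> []" "set y \<subseteq> set x" using list_bd_keysD[OF y] xl len by auto
    then show "0 < vweight y \<and> weight_le t (vweight y) (vweight x)"
      using list_weightD[OF list_weight_vweight[OF xl(2)], of y] list_weightD(2)[OF list_weight_vweight[OF xl(2)], of y x] by auto
  qed
  finally show ?thesis .
qed

lemma weighted_sort_alt: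
  "set l \<in> K \<Longrightarrow> weighted t vweight frag_of (vweight l) (sort_alt l) = sort_alt l"
  using keys_sort_alt[of l] is_weightD(1)[OF weight]
  by (subst weighted_same) (auto simp flip: frag_expansion)

text \<open>The case of the identity labelling in \<open>weighted_normalize_bd\<close>: sorting
  preserves the vertex set, so all weight ratios of a simplex to its sorted form are 1.\<close>

lemma normalize_vbd:
  assumes "Poly_Mapping.keys c \<subseteq> ordered_simplices K (Suc n)"
  shows "normalize (vbd c) = vbd (normalize c)"
  unfolding frag_extend_extend
proof (rule frag_extend_eq)
  fix l assume "l \<in> Poly_Mapping.keys c"
  then have l: "length l = Suc (Suc n)" "set l \<in> K" using assms by (auto simp: ordered_simplices_def)
  have "normalize (weighted_bd t vweight l)
     = frag_extend (\<lambda>m. weighted t vweight frag_of (vweight m) (sort_alt (map (\<lambda>x. x) m))) (weighted_bd t vweight l)"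
  proof (rule frag_extend_eq)
    fix m assume "m \<in> Poly_Mapping.keys (weighted_bd t vweight l)"
    then have "m \<in> {m. m \<noteq> [] \<and> set m \<subseteq> set l}"
      unfolding weighted_bd_def using list_bd_keysD[of _ l] l
      by (elim set_mp[OF keys_weighted, rotated]) (auto simp: keys_frag_of)
    then have "set m \<in> K" using l(2) abs_simplicial_complexD(2)[OF complex, of "set l" "set m"] by auto
    then show "sort_alt m = weighted t vweight frag_of (vweight m) (sort_alt (map (\<lambda>x. x) m))"
      by (simp add: weighted_sort_alt)
  qed
  also have "\<dots> = vbd (weighted t vweight frag_of (vweight l) (sort_alt (map (\<lambda>x. x) l)))"
    by (rule weighted_normalize_bd) (use l list_weight_vweight in auto)
  finally show "normalize (weighted_bd t vweight l) = vbd (sort_alt l)"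
    using l by (simp add: weighted_sort_alt)
qed

text \<open>The relations are exactly the kernel of \<open>normalize\<close>: generators are killed
  by \<open>sort_alt_permute\<close>, and conversely every chain differs from its normal form by a
  relation, which is checked on single lists.\<close>

lemma orientation_relations_eq:
  "orientation_relations K n = {c. Poly_Mapping.keys c \<subseteq> ordered_simplices K n \<and> normalize c = 0}"
proof -
  let ?G = "ordered_chain_group K n"
  let ?gen = "{frag_of (permute_list \<pi> vs) - frag_cmul (sign \<pi>) (frag_of vs) | \<pi> vs.
          \<pi> permutes {..<Suc n} \<and> vs \<in> ordered_simplices K n}"
  have G: "group ?G" by (simp add: ordered_chain_group_def)
  have perm: "permute_list \<pi> vs \<in> ordered_simplices K n"
    if "\<pi> permutes {..<Suc n}" "vs \<in> ordered_simplices K n" for \<pi> vs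
    using that by (auto simp: ordered_simplices_def)
  have genG: "?gen \<subseteq> carrier ?G"
    using perm by (auto simp: ordered_chain_group_def dest!: set_mp[OF keys_diff_cmul])
  let ?H = "{c. Poly_Mapping.keys c \<subseteq> ordered_simplices K n \<and> normalize c = 0}"
  have "subgroup ?H ?G"
  proof (rule group.subgroupI[OF G])
    show "?H \<noteq> {}" by (auto intro!: exI[of _ 0])
    show "inv\<^bsub>?G\<^esub> a \<in> ?H" if "a \<in> ?H" for a
      using that by (simp add: ordered_chain_group_def frag_extend_minus)
    show "a \<otimes>\<^bsub>?G\<^esub> b \<in> ?H" if "a \<in> ?H" "b \<in> ?H" for a b
      using that keys_add[of a b] by (auto simp: ordered_chain_group_def frag_extend_add)
  qed (auto simp: ordered_chain_group_def)
  moreover have "?gen \<subseteq> ?H"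
    using perm sort_alt_permute genG
    by (fastforce simp: frag_extend_diff frag_extend_cmul ordered_simplices_def ordered_chain_group_def)
  ultimately have sub: "orientation_relations K n \<subseteq> ?H"
    unfolding orientation_relations_def by (intro group.generate_subgroup_incl[OF G])
  have R: "subgroup (orientation_relations K n) ?G"
    unfolding orientation_relations_def by (rule group.generate_is_subgroup[OF G genG])
  have keysR: "Poly_Mapping.keys r \<subseteq> ordered_simplices K n" if "r \<in> orientation_relations K n" for r
    using sub that by blast
  have Rdiff: "a - b \<in> orientation_relations K n"
    if "a \<in> orientation_relations K n" "b \<in> orientation_relations K n" for a b
    using subgroup.m_closed[OF R that(1) subgroup.m_inv_closed[OF R that(2)]] keysR that
    by (simp add: ordered_chain_group_def)
  have "c - normalize c \<in> orientation_relations K n" if "Poly_Mapping.keys c \<subseteq> ordered_simplices K n" for c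
  proof (rule free_Abelian_group_induct[OF that, where P = "\<lambda>c. c - normalize c \<in> orientation_relations K n"])
    show "0 - normalize 0 \<in> orientation_relations K n"
      using subgroup.one_closed[OF R] by (simp add: ordered_chain_group_def)
    show "x - y - normalize (x - y) \<in> orientation_relations K n"
      if "x - normalize x \<in> orientation_relations K n" "y - normalize y \<in> orientation_relations K n" for x y
      using Rdiff[OF that] by (simp add: frag_extend_diff algebra_simps)
  next
    fix vs assume 3: "vs \<in> ordered_simplices K n"
    then have "distinct vs" and len: "length vs = Suc n" by (auto simp: ordered_simplices_def)
    then obtain \<pi> where \<pi>: "\<pi> permutes {..<Suc n}" "sort_alt vs = frag_cmul (sign \<pi>) (frag_of (permute_list \<pi> vs))"
      using ex_sorting_permutation[of vs] by metis
    let ?g = "frag_of (permute_list \<pi> vs) - frag_cmul (sign \<pi>) (frag_of vs)"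
    have g: "?g \<in> orientation_relations K n"
      unfolding orientation_relations_def by (rule generate.incl) (use \<pi> 3 in blast)
    \<comment> \<open>For sign 1 the difference is minus the generator \<open>?g\<close>, for sign
      -1 it is \<open>?g\<close> itself.\<close>
    have "sign \<pi> = 1 \<or> sign \<pi> = -1" by (auto simp: sign_def)
    then show "frag_of vs - normalize (frag_of vs) \<in> orientation_relations K n"
    proof
      assume s: "sign \<pi> = 1"
      then show ?thesis using Rdiff[OF subgroup.one_closed[OF R] g] \<pi>(2) by (simp add: ordered_chain_group_def)
    next
      assume s: "sign \<pi> = -1"
      then show ?thesis using g \<pi>(2) by (simp add: algebra_simps)
    qed
  qed
  then have "c \<in> orientation_relations K n" if "c \<in> ?H" for c
    using that diff_zero[of c] by (metis (mono_tags, lifting) mem_Collect_eq)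
  then have "?H \<subseteq> orientation_relations K n" by blast
  with sub show ?thesis by blast
qed

lemma subgroup_orientation_relations: "subgroup (orientation_relations K n) (ordered_chain_group K n)"
  unfolding orientation_relations_def
  by (rule group.generate_is_subgroup)
     (auto simp: ordered_chain_group_def ordered_simplices_def dest!: set_mp[OF keys_diff_cmul])

section \<open>Oriented chains as cosets, that is, as fibres of the normal form\<close>

abbreviation oclass :: "nat \<Rightarrow> ('v list \<Rightarrow>\<^sub>0 int) \<Rightarrow> ('v list \<Rightarrow>\<^sub>0 int) set" where
  "oclass n c \<equiv> orientation_relations K n #>\<^bsub>ordered_chain_group K n\<^esub> c"

lemma oclass_eq: 
  assumes "Poly_Mapping.keys c \<subseteq> ordered_simplices K n"
  shows "oclass n c = {x. Poly_Mapping.keys x \<subseteq> ordered_simplices K n \<and> normalize x = normalize c}"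
proof -
  have "x \<in> oclass n c" if "Poly_Mapping.keys x \<subseteq> ordered_simplices K n" "normalize x = normalize c" for x
    unfolding r_coset_def orientation_relations_eq ordered_chain_group_def
    using that assms keys_diff_subset[OF that(1) assms] by (auto simp: frag_extend_diff intro!: exI[of _ "x - c"])
  moreover have "oclass n c \<subseteq> {x. Poly_Mapping.keys x \<subseteq> ordered_simplices K n \<and> normalize x = normalize c}"
    unfolding r_coset_def orientation_relations_eq ordered_chain_group_def
    using assms keys_add[of _ c] by (fastforce simp: frag_extend_add)
  ultimately show ?thesis by blast
qed

lemma carrier_oriented: "carrier (oriented_chain_group K n) = oclass n ` {c. Poly_Mapping.keys c \<subseteq> ordered_simplices K n}"
  unfolding oriented_chain_group_def carrier_FactGroup by (auto simp: ordered_chain_group_def)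

lemma comm_group_ordered: "comm_group (ordered_chain_group K n)"
  by (simp add: ordered_chain_group_def abelian_free_Abelian_group)

lemma comm_group_oriented: "comm_group (oriented_chain_group K n)"
  unfolding oriented_chain_group_def
  by (rule comm_group.abelian_FactGroup[OF comm_group_ordered subgroup_orientation_relations])

lemma oclass_mult:
  assumes "Poly_Mapping.keys c \<subseteq> ordered_simplices K n" "Poly_Mapping.keys c' \<subseteq> ordered_simplices K n"
  shows "oclass n c \<otimes>\<^bsub>oriented_chain_group K n\<^esub> oclass n c' = oclass n (c + c')"
proof -
  have "orientation_relations K n \<lhd> ordered_chain_group K n"
    using comm_group.normal_iff_subgroup[OF comm_group_ordered] subgroup_orientation_relations by blast
  from normal.rcos_sum[OF this, of c c'] assms show ?thesis
    by (simp add: oriented_chain_group_def ordered_chain_group_def)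
qed

lemma one_oriented: "\<one>\<^bsub>oriented_chain_group K n\<^esub> = oclass n 0"
proof -
  have "oclass n 0 = orientation_relations K n"
    by (subst oclass_eq) (simp_all add: orientation_relations_eq)
  then show ?thesis by (simp add: oriented_chain_group_def)
qed

lemma oclass_eq_iff:
  assumes "Poly_Mapping.keys c \<subseteq> ordered_simplices K n" "Poly_Mapping.keys c' \<subseteq> ordered_simplices K n"
  shows "oclass n c = oclass n c' \<longleftrightarrow> normalize c = normalize c'"
proof
  assume "oclass n c = oclass n c'"
  moreover have "c \<in> oclass n c" using assms(1) by (simp add: oclass_eq)
  ultimately have "c \<in> oclass n c'" by simp
  then show "normalize c = normalize c'" using assms(2) by (simp add: oclass_eq)
next
  assume "normalize c = normalize c'"
  then show "oclass n c = oclass n c'" using assms by (simp add: oclass_eq)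
qed

text \<open>Evaluates a map given by \<open>the_elem\<close> on a coset as soon as its value depends
  only on the normal form.\<close>

lemma the_elem_oclass:
  assumes "Poly_Mapping.keys c \<subseteq> ordered_simplices K n"
    and "\<And>x. Poly_Mapping.keys x \<subseteq> ordered_simplices K n \<Longrightarrow> normalize x = normalize c \<Longrightarrow> f x = f c"
  shows "the_elem (f ` oclass n c) = f c"
proof -
  have "c \<in> oclass n c" using assms(1) by (simp add: oclass_eq)
  moreover have "f x = f c" if "x \<in> oclass n c" for x
    using that assms(2)[of x] by (simp add: oclass_eq[OF assms(1)])
  ultimately have "f ` oclass n c = {f c}" by blast
  then show ?thesis by simp
qed

lemma weighted_boundary_oclass:
  assumes "Poly_Mapping.keys c \<subseteq> ordered_simplices K (Suc n)"
  shows "weighted_boundary t K \<mu> (Suc n) (oclass (Suc n) c) = oclass n (vbd c)"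
proof -
  have eq: "ordered_weighted_boundary t \<mu> (Suc n) x = vbd x" if "Poly_Mapping.keys x \<subseteq> ordered_simplices K (Suc n)" for x
    using that by (intro ordered_weighted_boundary_eq ordered_keys_length)
  have "the_elem ((\<lambda>c. oclass n (ordered_weighted_boundary t \<mu> (Suc n) c)) ` oclass (Suc n) c)
      = oclass n (ordered_weighted_boundary t \<mu> (Suc n) c)"
  proof (rule the_elem_oclass[OF assms])
    fix x assume x: "Poly_Mapping.keys x \<subseteq> ordered_simplices K (Suc n)" "normalize x = normalize c"
    then show "oclass n (ordered_weighted_boundary t \<mu> (Suc n) x) = oclass n (ordered_weighted_boundary t \<mu> (Suc n) c)"
      using assms keys_vbd normalize_vbd by (simp add: eq oclass_eq_iff)
  qed
  then show ?thesis using assms by (simp add: weighted_boundary_def eq)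
qed

text \<open>Removes the quotient: normal forms identify oriented chains with chains on sorted
  simplices, so a comparison with another complex has to be supplied only there.\<close>

lemma oriented_homology_iso:
  assumes C': "\<And>n. comm_group (C' n)" and d': "\<And>n. d' (Suc n) \<in> hom (C' (Suc n)) (C' n)"
    and dd': "\<And>n c. c \<in> carrier (C' (Suc (Suc n))) \<Longrightarrow> d' (Suc n) (d' (Suc (Suc n)) c) = \<one>\<^bsub>C' n\<^esub>"
    and j: "\<And>n. j n \<in> hom (free_Abelian_group (sorted_simplices n)) (C' n)"
    and jd: "\<And>n c. Poly_Mapping.keys c \<subseteq> sorted_simplices (Suc n) \<Longrightarrow> j n (vbd c) = d' (Suc n) (j (Suc n) c)"
    and surj: "\<And>n z. z \<in> cycle_set C' d' n \<Longrightarrow>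
       \<exists>c w. Poly_Mapping.keys c \<subseteq> sorted_simplices n \<and> (0 < n \<longrightarrow> vbd c = 0) \<and> w \<in> carrier (C' (Suc n))
          \<and> z = d' (Suc n) w \<otimes>\<^bsub>C' n\<^esub> j n c"
    and inj: "\<And>n c. Poly_Mapping.keys c \<subseteq> sorted_simplices n \<Longrightarrow> j n c \<in> boundary_set C' d' n \<Longrightarrow>
       \<exists>e. Poly_Mapping.keys e \<subseteq> sorted_simplices (Suc n) \<and> c = vbd e"
  shows "weighted_simplicial_homology t K \<mu> n \<cong> complex_homology C' d' n"
proof -
  define h where "h n A = the_elem ((\<lambda>c. j n (normalize c)) ` A)" for n A
  have h: "h n (oclass n c) = j n (normalize c)" if "Poly_Mapping.keys c \<subseteq> ordered_simplices K n" for n c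
    unfolding h_def by (rule the_elem_oclass) (use that in auto)
  note so = sorted_simplices_ordered order.trans[OF _ sorted_simplices_ordered]
  \<comment> \<open>\<open>normalize\<close> commutes with the boundary and fixes \<open>c\<close>,
    so the boundary is its own normal form.\<close>
  have sorted_vbd: "Poly_Mapping.keys (vbd c) \<subseteq> sorted_simplices n" if "Poly_Mapping.keys c \<subseteq> sorted_simplices (Suc n)" for n c
    using keys_normalize_ordered[OF keys_vbd[OF so(2)[OF that]]] normalize_vbd[OF so(2)[OF that]] normalize_sorted[OF that] by simp
  have jcl: "j n c \<in> carrier (C' n)" if "Poly_Mapping.keys c \<subseteq> sorted_simplices n" for n c
    using hom_carrier[OF j[of n]] that by auto
  have add_keys: "Poly_Mapping.keys (a + b) \<subseteq> T" if "Poly_Mapping.keys a \<subseteq> T" "Poly_Mapping.keys b \<subseteq> T" for a b :: "'v list \<Rightarrow>\<^sub>0 int" and T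
    using keys_add[of a b] that by blast
  show ?thesis unfolding weighted_simplicial_homology_def
  proof (rule complex_homology_iso[where h = h])
    show "weighted_boundary t K \<mu> (Suc n) \<in> hom (oriented_chain_group K (Suc n)) (oriented_chain_group K n)" for n
    proof (rule homI)
      fix A B assume "A \<in> carrier (oriented_chain_group K (Suc n))" "B \<in> carrier (oriented_chain_group K (Suc n))"
      then obtain a b where a: "A = oclass (Suc n) a" "Poly_Mapping.keys a \<subseteq> ordered_simplices K (Suc n)"
        and b: "B = oclass (Suc n) b" "Poly_Mapping.keys b \<subseteq> ordered_simplices K (Suc n)"
        by (auto simp: carrier_oriented)
      show "weighted_boundary t K \<mu> (Suc n) A \<in> carrier (oriented_chain_group K n)"
        using a keys_vbd[OF a(2)] by (auto simp: weighted_boundary_oclass carrier_oriented)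
      show "weighted_boundary t K \<mu> (Suc n) (A \<otimes>\<^bsub>oriented_chain_group K (Suc n)\<^esub> B) =
        weighted_boundary t K \<mu> (Suc n) A \<otimes>\<^bsub>oriented_chain_group K n\<^esub> weighted_boundary t K \<mu> (Suc n) B"
        using a b add_keys[OF a(2) b(2)] keys_vbd[OF a(2)] keys_vbd[OF b(2)]
        by (simp add: weighted_boundary_oclass oclass_mult frag_extend_add)
    qed
    show "weighted_boundary t K \<mu> (Suc n) (weighted_boundary t K \<mu> (Suc (Suc n)) A) = \<one>\<^bsub>oriented_chain_group K n\<^esub>"
      if "A \<in> carrier (oriented_chain_group K (Suc (Suc n)))" for n A
      using that keys_vbd by (auto simp: carrier_oriented weighted_boundary_oclass one_oriented vbd_vbd)
    show "h n \<in> hom (oriented_chain_group K n) (C' n)" for n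
    proof (rule homI)
      fix A B assume "A \<in> carrier (oriented_chain_group K n)" "B \<in> carrier (oriented_chain_group K n)"
      then obtain a b where a: "A = oclass n a" "Poly_Mapping.keys a \<subseteq> ordered_simplices K n"
        and b: "B = oclass n b" "Poly_Mapping.keys b \<subseteq> ordered_simplices K n"
        by (auto simp: carrier_oriented)
      show "h n A \<in> carrier (C' n)"
        using a jcl keys_normalize_ordered by (auto simp: h)
      show "h n (A \<otimes>\<^bsub>oriented_chain_group K n\<^esub> B) = h n A \<otimes>\<^bsub>C' n\<^esub> h n B"
        using a b add_keys[OF a(2) b(2)] keys_normalize_ordered hom_mult[OF j[of n], of "normalize a" "normalize b"]
        by (simp add: oclass_mult h frag_extend_add)
    qed
    show "h n (weighted_boundary t K \<mu> (Suc n) A) = d' (Suc n) (h (Suc n) A)"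
      if "A \<in> carrier (oriented_chain_group K (Suc n))" for n A
      using that keys_vbd keys_normalize_ordered normalize_vbd jd
      by (auto simp: carrier_oriented weighted_boundary_oclass h)
    show "\<exists>c\<in>cycle_set (oriented_chain_group K) (weighted_boundary t K \<mu>) n. \<exists>w\<in>carrier (C' (Suc n)).
        z = d' (Suc n) w \<otimes>\<^bsub>C' n\<^esub> h n c" if z: "z \<in> cycle_set C' d' n" for n z
    proof -
      obtain c w where c: "Poly_Mapping.keys c \<subseteq> sorted_simplices n" "0 < n \<longrightarrow> vbd c = 0"
        and w: "w \<in> carrier (C' (Suc n))" "z = d' (Suc n) w \<otimes>\<^bsub>C' n\<^esub> j n c"
        using surj[OF z] by blast
      have "oclass n c \<in> cycle_set (oriented_chain_group K) (weighted_boundary t K \<mu>) n"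
        using so(2)[OF c(1)] c(2)
        by (cases n) (auto simp: cycle_set_def carrier_oriented kernel_def weighted_boundary_oclass one_oriented)
      moreover have "h n (oclass n c) = j n c" using so(2)[OF c(1)] by (simp add: h normalize_sorted[OF c(1)])
      ultimately show ?thesis using w by metis
    qed
    show "A \<in> boundary_set (oriented_chain_group K) (weighted_boundary t K \<mu>) n"
      if A: "A \<in> cycle_set (oriented_chain_group K) (weighted_boundary t K \<mu>) n" and hA: "h n A \<in> boundary_set C' d' n" for n A
    proof -
      have "A \<in> carrier (oriented_chain_group K n)" using A by (auto simp: cycle_set_def kernel_def split: if_splits)
      then obtain a where a: "A = oclass n a" "Poly_Mapping.keys a \<subseteq> ordered_simplices K n"
        by (auto simp: carrier_oriented)
      have na: "Poly_Mapping.keys (normalize a) \<subseteq> sorted_simplices n" using a keys_normalize_ordered by blast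
      obtain e where e: "Poly_Mapping.keys e \<subseteq> sorted_simplices (Suc n)" "normalize a = vbd e"
        using inj[OF na] hA a by (auto simp: h)
      have "A = oclass n (vbd e)"
        using a na so(2)[OF na] sorted_vbd[OF e(1)] so(2)[OF sorted_vbd[OF e(1)]] e(2)
        by (simp add: oclass_eq_iff normalize_sorted[of _ n])
      then show ?thesis
        using weighted_boundary_oclass[OF so(2)[OF e(1)]] so(2)[OF e(1)]
        by (auto simp: boundary_set_def carrier_oriented)
    qed
  qed (use comm_group_oriented C' d' dd' in auto)
qed

end

section \<open>Affine pieces of weighted singular simplices\<close>

text \<open>Attainment of every weight at a vertex already forces the divisibility chain: edges make
  the vertex weights pairwise comparable, and a finite set of comparable weights can be
  sorted.\<close>

lemma divisibly_weighted_iff: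
  "divisibly_weighted t K \<mu> \<longleftrightarrow> weighted_complex t K \<mu> \<and> (\<forall>\<sigma>\<in>K. \<exists>v\<in>\<sigma>. \<mu> \<sigma> = \<mu> {v})"
proof (intro iffI conjI ballI)
  assume div: "divisibly_weighted t K \<mu>"
  then show K: "weighted_complex t K \<mu>" by (simp add: divisibly_weighted_def)
  fix \<sigma> assume \<sigma>: "\<sigma> \<in> K"
  then obtain vs where vs: "set vs = \<sigma>" "\<mu> \<sigma> = (case t of Ascending \<Rightarrow> \<mu> {last vs} | Descending \<Rightarrow> \<mu> {hd vs})"
    using div unfolding divisibly_weighted_def by blast
  have "vs \<noteq> []" using K \<sigma> vs abs_simplicial_complexD(1) by (fastforce simp: weighted_complex_def)
  then have "last vs \<in> \<sigma>" "hd vs \<in> \<sigma>" using vs by auto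
  then show "\<exists>v\<in>\<sigma>. \<mu> \<sigma> = \<mu> {v}" using vs(2) by (cases t) auto
next
  assume asm: "weighted_complex t K \<mu> \<and> (\<forall>\<sigma>\<in>K. \<exists>v\<in>\<sigma>. \<mu> \<sigma> = \<mu> {v})"
  then have K: "abs_simplicial_complex K" and w: "is_weight t K \<mu>" by (auto simp: weighted_complex_def)
  show "divisibly_weighted t K \<mu>" unfolding divisibly_weighted_def
  proof (intro conjI ballI)
    fix \<sigma> assume \<sigma>: "\<sigma> \<in> K"
    then obtain v where v: "v \<in> \<sigma>" "\<mu> \<sigma> = \<mu> {v}" using asm by blast
    have fin: "finite \<sigma>" "\<sigma> \<noteq> {}" using abs_simplicial_complexD(1)[OF K \<sigma>] by auto
    have sub: "\<tau> \<in> K" if "\<tau> \<subseteq> \<sigma>" "\<tau> \<noteq> {}" for \<tau> using abs_simplicial_complexD(2)[OF K \<sigma>] that by blast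
    have pos: "0 < \<mu> {u}" if "u \<in> \<sigma>" for u using is_weightD(1)[OF w] sub[of "{u}"] that by auto
    have le: "weight_le t (\<mu> {u}) (\<mu> \<sigma>)" if "u \<in> \<sigma>" for u
      using is_weightD(2)[OF w \<sigma>] sub[of "{u}"] that by auto
    \<comment> \<open>On the edge \<open>{a, b}\<close> the weight equals that of one end and
      dominates both, so the two vertex weights are comparable.\<close>
    have comp: "\<mu> {a} dvd \<mu> {b}" if "a \<in> \<sigma>" "b \<in> \<sigma>" "\<mu> {a} \<le> \<mu> {b}" for a b
    proof -
      have K2: "{a, b} \<in> K" "{a} \<in> K" "{b} \<in> K" using that sub by auto
      have "weight_le t (\<mu> {a}) (\<mu> {a, b})" "weight_le t (\<mu> {b}) (\<mu> {a, b})"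
        using is_weightD(2)[OF w K2(1)] K2 by auto
      moreover have "\<mu> {a, b} = \<mu> {a} \<or> \<mu> {a, b} = \<mu> {b}" using asm K2(1) by blast
      ultimately have "\<mu> {a} dvd \<mu> {b} \<or> \<mu> {b} dvd \<mu> {a}" by (auto simp: weight_le_def split: weight_type.splits)
      then show ?thesis using that(3) pos[OF that(1)] dvd_imp_le[of "\<mu> {b}" "\<mu> {a}"] by auto
    qed
    obtain xs where xs: "set xs = \<sigma>" "distinct xs" using finite_distinct_list[OF fin(1)] by blast
    \<comment> \<open>For positive numbers comparable by divisibility the numerical order implies
      divisibility, so sorting by size suffices.\<close>
    let ?vs = "sort_key (\<lambda>v. \<mu> {v}) xs"
    have set: "set ?vs = \<sigma>" using xs by simp
    have ne: "?vs \<noteq> []" using set fin(2) by (metis list.set(1))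
    have "sorted_wrt (\<lambda>u v. \<mu> {u} \<le> \<mu> {v}) ?vs"
      using sorted_sort_key[of "\<lambda>v. \<mu> {v}" xs] by (simp add: sorted_map)
    then have srt: "sorted_wrt (\<lambda>u v. \<mu> {u} dvd \<mu> {v}) ?vs"
      by (rule sorted_wrt_mono_rel[rotated]) (use comp set in blast)
    have "\<mu> \<sigma> = (case t of Ascending \<Rightarrow> \<mu> {last ?vs} | Descending \<Rightarrow> \<mu> {hd ?vs})"
    proof (cases t)
      case Ascending
      have "sorted_wrt (\<lambda>u v. \<mu> {u} dvd \<mu> {v}) (butlast ?vs @ [last ?vs])" using srt ne by simp
      then have "\<forall>u\<in>set (butlast ?vs). \<mu> {u} dvd \<mu> {last ?vs}" by (simp only: sorted_wrt_append) simp
      moreover have "v \<in> set (butlast ?vs @ [last ?vs])" unfolding append_butlast_last_id[OF ne] set by (rule v(1))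
      ultimately have "\<mu> {v} dvd \<mu> {last ?vs}" by (auto simp del: append_butlast_last_id)
      then show ?thesis using le[of "last ?vs"] last_in_set[OF ne] v(2) Ascending set by (simp add: weight_le_def dvd_antisym)
    next
      case Descending
      have "?vs = hd ?vs # tl ?vs" using ne by simp
      then have "\<mu> {hd ?vs} dvd \<mu> {v}" using srt v(1) set
        by (metis (no_types, lifting) dvd_refl set_ConsD sorted_wrt.simps(2))
      then show ?thesis using le[of "hd ?vs"] hd_in_set[OF ne] v(2) Descending set by (simp add: weight_le_def dvd_antisym)
    qed
    with srt set xs show "\<exists>vs. distinct vs \<and> set vs = \<sigma> \<and> sorted_wrt (\<lambda>u v. \<mu> {u} dvd \<mu> {v}) vs \<and>
        \<mu> \<sigma> = (case t of Ascending \<Rightarrow> \<mu> {last vs} | Descending \<Rightarrow> \<mu> {hd vs})"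
      by (intro exI[of _ ?vs]) auto
  qed (use asm in auto)
qed

section \<open>Points, faces and affine maps of standard simplices\<close>

type_synonym point = "nat \<Rightarrow> real"

definition simplex_vertex :: "nat \<Rightarrow> point" where
  "simplex_vertex i = (\<lambda>j. if j = i then 1 else 0)"

definition simplex_vertices :: "nat \<Rightarrow> point list" where
  "simplex_vertices n = map simplex_vertex [0..<Suc n]"

definition affine_map :: "point list \<Rightarrow> point \<Rightarrow> point" where
  "affine_map l x = (\<lambda>k. \<Sum>i<length l. x i * (l ! i) k)"

text \<open>The barycentre of the face spanned by \<open>S\<close>: a canonical point with support
  exactly \<open>S\<close>, used to turn a weight on points back into a weight on faces.\<close>

definition uniform_point :: "nat set \<Rightarrow> point" where
  "uniform_point S = (\<lambda>i. if i \<in> S then 1 / real (card S) else 0)"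

definition barycentre :: "point list \<Rightarrow> point" where
  "barycentre l = affine_map l (uniform_point {..<length l})"

lemma standard_simplexD:
  "x \<in> standard_simplex n \<Longrightarrow> 0 \<le> x i" "x \<in> standard_simplex n \<Longrightarrow> x i \<le> 1"
  "x \<in> standard_simplex n \<Longrightarrow> n < i \<Longrightarrow> x i = 0" "x \<in> standard_simplex n \<Longrightarrow> (\<Sum>i\<le>n. x i) = 1"
  by (auto simp: standard_simplex_def)

lemma standard_simplexI:
  assumes "\<And>i. 0 \<le> x i" "\<And>i. n < i \<Longrightarrow> x i = 0" "(\<Sum>i\<le>n. x i) = 1"
  shows "x \<in> standard_simplex n"
proof -
  have "x i \<le> 1" for i
  proof (cases "i \<le> n")
    case True
    then have "x i \<le> (\<Sum>i\<le>n. x i)" using assms(1) by (intro member_le_sum) auto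
    then show ?thesis using assms(3) by simp
  qed (use assms in auto)
  then show ?thesis using assms by (simp add: standard_simplex_def)
qed

lemma uniform_point:
  assumes "S \<in> simplex_complex n"
  shows "uniform_point S \<in> standard_simplex n" "{i. uniform_point S i \<noteq> 0} = S"
proof -
  have S: "finite S" "S \<noteq> {}" "S \<subseteq> {..n}"
    using assms finite_subset[of S "{..n}"] by (auto simp: simplex_complex_def)
  have "(\<Sum>i\<le>n. uniform_point S i) = (\<Sum>i\<in>S. 1 / real (card S))"
    unfolding uniform_point_def using S(3) by (simp add: sum.If_cases Int_absorb1 Int_def[symmetric])
  also have "\<dots> = 1" using S by simp
  finally have sum: "(\<Sum>i\<le>n. uniform_point S i) = 1" .
  show "uniform_point S \<in> standard_simplex n"
  proof (rule standard_simplexI[OF _ _ sum])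
    show "uniform_point S i = 0" if "n < i" for i
      using S(3) that by (auto simp: uniform_point_def)
  qed (simp add: uniform_point_def)
  show "{i. uniform_point S i \<noteq> 0} = S" using S by (auto simp: uniform_point_def)
qed

lemma support_in_simplex_complex:
  assumes "x \<in> standard_simplex n"
  shows "{i. x i \<noteq> 0} \<in> simplex_complex n"
proof -
  have "i \<le> n" if "x i \<noteq> 0" for i using standard_simplexD(3)[OF assms, of i] that by linarith
  moreover have "{i. x i \<noteq> 0} \<noteq> {}"
  proof
    assume "{i. x i \<noteq> 0} = {}"
    then have "x i = 0" for i by blast
    then show False using standard_simplexD(4)[OF assms] by simp
  qed
  ultimately show ?thesis by (simp add: simplex_complex_def subset_iff)
qed

lemma lessThan_in_simplex_complex: "l \<noteq> [] \<Longrightarrow> {..<length l} \<in> simplex_complex (length l - 1)"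
  by (auto simp: simplex_complex_def)

lemma affine_map_vertex: "i < length l \<Longrightarrow> affine_map l (simplex_vertex i) = l ! i"
  by (simp add: affine_map_def simplex_vertex_def if_distrib[of "\<lambda>u. u * _"] sum.delta cong: if_cong)

lemma uniform_point_singleton: "uniform_point {i} = simplex_vertex i"
  by (auto simp: uniform_point_def simplex_vertex_def)

lemma affine_map_simplex_vertices:
  assumes "x \<in> standard_simplex n"
  shows "affine_map (simplex_vertices n) x = x"
proof
  fix k
  have "affine_map (simplex_vertices n) x k = (\<Sum>i<Suc n. x i * simplex_vertex i k)"
    unfolding affine_map_def simplex_vertices_def by (intro sum.cong) (auto simp del: upt_Suc)
  also have "\<dots> = x k"
    using standard_simplexD(3)[OF assms, of k]
    by (simp add: simplex_vertex_def if_distrib[of "\<lambda>u. _ * u"] sum.delta' not_less cong: if_cong del: sum.lessThan_Suc)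
  finally show "affine_map (simplex_vertices n) x k = x k" .
qed

lemma map_affine_map_vertices: "length l = Suc n \<Longrightarrow> map (affine_map l) (simplex_vertices n) = l"
  by (intro nth_equalityI) (auto simp: simplex_vertices_def affine_map_vertex simp del: upt_Suc)

lemma length_simplex_vertices [simp]: "length (simplex_vertices n) = Suc n"
  by (simp add: simplex_vertices_def)

lemma simplex_vertices_ne [simp]: "simplex_vertices n \<noteq> []"
  by (simp add: simplex_vertices_def)

lemma set_simplex_vertices: "set (simplex_vertices n) \<subseteq> standard_simplex n"
  by (auto simp: simplex_vertices_def simplex_vertex_def)

lemma affine_map_compose: "affine_map l (affine_map m x) = affine_map (map (affine_map l) m) x"
  unfolding affine_map_def
  by (rule ext) (simp add: sum_distrib_left sum_distrib_right mult.assoc sum.swap[of _ "{..<length l}"])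

lemma affine_map_barycentre: "affine_map l (barycentre m) = barycentre (map (affine_map l) m)"
  by (simp add: barycentre_def affine_map_compose)

lemma support_index:
  "x \<in> standard_simplex (length l - 1) \<Longrightarrow> l \<noteq> [] \<Longrightarrow> x i \<noteq> 0 \<Longrightarrow> i < length l"
  using standard_simplexD(3)[of x "length l - 1" i] by (cases "i < length l") (auto simp: neq_Nil_conv)

lemma sum_standard_simplex:
  assumes "x \<in> standard_simplex (length l - 1)" "l \<noteq> []"
  shows "(\<Sum>i<length l. x i) = 1"
proof -
  have "{..<length l} = {..length l - 1}" using assms(2) by (cases l) auto
  then show ?thesis using standard_simplexD(4)[OF assms(1)] by simp
qed

lemma affine_map_standard_simplex:
  assumes "l \<noteq> []" "set l \<subseteq> standard_simplex n" "x \<in> standard_simplex (length l - 1)"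
  shows "affine_map l x \<in> standard_simplex n"
proof (rule standard_simplexI)
  have l: "l ! i \<in> standard_simplex n" if "i < length l" for i using assms(2) that nth_mem by blast
  show "0 \<le> affine_map l x i" for i
    unfolding affine_map_def
    by (intro sum_nonneg mult_nonneg_nonneg standard_simplexD(1)[OF assms(3)] standard_simplexD(1)[OF l]) auto
  show "affine_map l x i = 0" if "n < i" for i
    unfolding affine_map_def using standard_simplexD(3)[OF l that] by simp
  have "(\<Sum>k\<le>n. affine_map l x k) = (\<Sum>i<length l. x i * (\<Sum>k\<le>n. (l ! i) k))"
    unfolding affine_map_def by (simp add: sum_distrib_left sum.swap[of _ "{..n}"])
  also have "\<dots> = (\<Sum>i<length l. x i)" using standard_simplexD(4)[OF l] by simp
  also have "\<dots> = 1" by (rule sum_standard_simplex[OF assms(3,1)])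
  finally show "(\<Sum>k\<le>n. affine_map l x k) = 1" .
qed

text \<open>No cancellation can occur, since all coefficients and coordinates are
  nonnegative.\<close>

lemma support_affine_map:
  assumes "l \<noteq> []" "set l \<subseteq> standard_simplex n" "x \<in> standard_simplex (length l - 1)"
  shows "{k. affine_map l x k \<noteq> 0} = (\<Union>i\<in>{i. x i \<noteq> 0}. {k. (l ! i) k \<noteq> 0})"
proof -
  have xl: "i < length l" if "x i \<noteq> 0" for i
    by (rule support_index[OF assms(3,1) that])
  have l: "l ! i \<in> standard_simplex n" if "i < length l" for i using assms(2) that nth_mem by blast
  have "affine_map l x k = 0 \<longleftrightarrow> (\<forall>i<length l. x i * (l ! i) k = 0)" for k
    unfolding affine_map_def using standard_simplexD(1)[OF assms(3)] standard_simplexD(1)[OF l]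
    by (subst sum_nonneg_eq_0_iff) auto
  then show ?thesis using xl by auto
qed

lemma barycentre_standard_simplex:
  "l \<noteq> [] \<Longrightarrow> set l \<subseteq> standard_simplex n \<Longrightarrow> barycentre l \<in> standard_simplex n"
  unfolding barycentre_def
  by (rule affine_map_standard_simplex[OF _ _ uniform_point(1)[OF lessThan_in_simplex_complex]])

lemma support_barycentre:
  assumes "l \<noteq> []" "set l \<subseteq> standard_simplex n"
  shows "{k. barycentre l k \<noteq> 0} = (\<Union>z\<in>set l. {k. z k \<noteq> 0})"
proof -
  note u = uniform_point[OF lessThan_in_simplex_complex[OF assms(1)]]
  have "{k. barycentre l k \<noteq> 0} = (\<Union>i\<in>{..<length l}. {k. (l ! i) k \<noteq> 0})"
    using support_affine_map[OF assms u(1)] unfolding u(2) barycentre_def .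
  also have "\<dots> = (\<Union>z\<in>set l. {k. z k \<noteq> 0})" by (auto simp: in_set_conv_nth) (metis nth_mem)
  finally show ?thesis .
qed

text \<open>The value of \<open>\<omega>\<close> at a point is the largest of its values at the vertices of the carrier. This
  is what makes the pullback of a divisible weight along any affine map divisible again.\<close>

definition weight_function :: "weight_type \<Rightarrow> point set \<Rightarrow> (point \<Rightarrow> nat) \<Rightarrow> bool" where
  "weight_function t D \<omega> \<longleftrightarrow> (\<forall>l x. l \<noteq> [] \<longrightarrow> set l \<subseteq> D \<longrightarrow> x \<in> standard_simplex (length l - 1) \<longrightarrow>
     affine_map l x \<in> D \<and> 0 < \<omega> (affine_map l x) \<and>
     (\<forall>i. x i \<noteq> 0 \<longrightarrow> weight_le t (\<omega> (l ! i)) (\<omega> (affine_map l x))) \<and>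
     (\<exists>i. x i \<noteq> 0 \<and> \<omega> (affine_map l x) = \<omega> (l ! i)))"

lemma weight_functionD:
  assumes "weight_function t D \<omega>" "l \<noteq> []" "set l \<subseteq> D" "x \<in> standard_simplex (length l - 1)"
  shows "affine_map l x \<in> D" "0 < \<omega> (affine_map l x)"
    "x i \<noteq> 0 \<Longrightarrow> weight_le t (\<omega> (l ! i)) (\<omega> (affine_map l x))"
    "\<exists>i. x i \<noteq> 0 \<and> \<omega> (affine_map l x) = \<omega> (l ! i)"
  using assms unfolding weight_function_def by blast+

text \<open>The weight at the image of \<open>x\<close> is attained at an entry in the support of
  \<open>x\<close>, which is also in the support of \<open>y\<close>. Hence only the support
  matters.\<close>

lemma weight_function_mono:
  assumes "weight_function t D \<omega>" "l \<noteq> []" "set l \<subseteq> D" "x \<in> standard_simplex (length l - 1)"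
    "y \<in> standard_simplex (length l - 1)" "{i. x i \<noteq> 0} \<subseteq> {i. y i \<noteq> 0}"
  shows "weight_le t (\<omega> (affine_map l x)) (\<omega> (affine_map l y))"
proof -
  obtain i where "x i \<noteq> 0" "\<omega> (affine_map l x) = \<omega> (l ! i)" using weight_functionD(4)[OF assms(1-4)] by blast
  moreover from this have "y i \<noteq> 0" using assms(6) by blast
  ultimately show ?thesis using weight_functionD(3)[OF assms(1-3,5)] by metis
qed

lemma weight_function_eq:
  assumes "weight_function t D \<omega>" "l \<noteq> []" "set l \<subseteq> D" "x \<in> standard_simplex (length l - 1)"
    "y \<in> standard_simplex (length l - 1)" "{i. x i \<noteq> 0} = {i. y i \<noteq> 0}"
  shows "\<omega> (affine_map l x) = \<omega> (affine_map l y)"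
  using weight_function_mono[OF assms(1-4,5)] weight_function_mono[OF assms(1-3,5,4)] assms(6)
  by (simp add: weight_le_antisym)

text \<open>Each of the two weights is attained at an entry of the support and is dominated there by
  the other one; antisymmetry gives equality.\<close>

lemma weight_function_unique:
  assumes "weight_function t D \<omega>" "weight_function t D \<omega>'" "l \<noteq> []" "set l \<subseteq> D" "x \<in> standard_simplex (length l - 1)"
    and "\<And>z. z \<in> set l \<Longrightarrow> \<omega> z = \<omega>' z"
  shows "\<omega> (affine_map l x) = \<omega>' (affine_map l x)"
proof -
  have in_l: "l ! i \<in> set l" if "x i \<noteq> 0" for i
    using support_index[OF assms(5,3) that] by simp
  obtain i where i: "x i \<noteq> 0" "\<omega> (affine_map l x) = \<omega> (l ! i)" using weight_functionD(4)[OF assms(1,3-5)] by blast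
  obtain j where j: "x j \<noteq> 0" "\<omega>' (affine_map l x) = \<omega>' (l ! j)" using weight_functionD(4)[OF assms(2-5)] by blast
  have "weight_le t (\<omega>' (l ! i)) (\<omega>' (affine_map l x))" by (rule weight_functionD(3)[OF assms(2-5) i(1)])
  moreover have "weight_le t (\<omega> (l ! j)) (\<omega> (affine_map l x))" by (rule weight_functionD(3)[OF assms(1,3-5) j(1)])
  ultimately show ?thesis
    using i(2) j(2) assms(6)[OF in_l[OF i(1)]] assms(6)[OF in_l[OF j(1)]] by (simp add: weight_le_antisym)
qed

lemma weight_function_pos:
  assumes "weight_function t D \<omega>" "z \<in> D" shows "0 < \<omega> z"
proof -
  have "affine_map [z] (simplex_vertex 0) = z" using affine_map_vertex[of 0 "[z]"] by simp
  then show ?thesis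
    using weight_functionD(2)[OF assms(1), of "[z]" "simplex_vertex 0"] assms(2) by (simp add: simplex_vertex_def)
qed

lemma barycentre_in:
  assumes "weight_function t D \<omega>" "l \<noteq> []" "set l \<subseteq> D" shows "barycentre l \<in> D"
  unfolding barycentre_def
  by (rule weight_functionD(1)[OF assms uniform_point(1)[OF lessThan_in_simplex_complex]]) fact

text \<open>All coefficients of the barycentre are nonzero, so its weight dominates the weights of
  all entries and is attained at one of them: it is the weight of the simplex spanned by the
  list.\<close>

lemma list_weight_barycentre:
  assumes "weight_function t D \<omega>"
  shows "list_weight t (\<lambda>l. \<omega> (barycentre l)) D"
  unfolding list_weight_def
proof (intro allI impI conjI)
  fix m m' :: "point list" assume m: "m \<noteq> []" "set m \<subseteq> set m'" "set m' \<subseteq> D"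
  then have m': "m' \<noteq> []" "set m \<subseteq> D" by auto
  note um = uniform_point[OF lessThan_in_simplex_complex[OF m(1)]]
  note um' = uniform_point[OF lessThan_in_simplex_complex[OF m'(1)]]
  show "0 < \<omega> (barycentre m)" by (rule weight_function_pos[OF assms barycentre_in[OF assms m(1) m'(2)]])
  obtain i where i: "uniform_point {..<length m} i \<noteq> 0" "\<omega> (barycentre m) = \<omega> (m ! i)"
    unfolding barycentre_def using weight_functionD(4)[OF assms m(1) m'(2) um(1)] by blast
  then have "i < length m" using um(2) by auto
  then have "m ! i \<in> set m'" using m(2) nth_mem by blast
  then obtain k where k: "k < length m'" "m ! i = m' ! k" by (metis in_set_conv_nth)
  then have "weight_le t (\<omega> (m' ! k)) (\<omega> (barycentre m'))"
    unfolding barycentre_def using um'(2) by (intro weight_functionD(3)[OF assms m'(1) m(3) um'(1)]) blast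
  with i k show "weight_le t (\<omega> (barycentre m)) (\<omega> (barycentre m'))" by simp
qed

text \<open>Here divisibility enters. The weight of the carrier of the image is that of one of its
  vertices \<open>v\<close>; \<open>v\<close> lies in the carrier of some entry \<open>l ! i\<close>
  with \<open>x i\<close> nonzero, and the weight of that entry is squeezed between the weights of
  \<open>v\<close> and of the whole carrier.\<close>

lemma weight_function_simplex_weight:
  assumes "divisibly_weighted t (simplex_complex n) \<xi>"
  shows "weight_function t (standard_simplex n) (simplex_weight \<xi>)"
  unfolding weight_function_def
proof (intro allI impI conjI)
  have w: "is_weight t (simplex_complex n) \<xi>" and att: "\<And>S. S \<in> simplex_complex n \<Longrightarrow> \<exists>v\<in>S. \<xi> S = \<xi> {v}"
    using assms by (auto simp: divisibly_weighted_iff weighted_complex_def)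
  fix l :: "point list" and x assume l: "l \<noteq> []" "set l \<subseteq> standard_simplex n" and x: "x \<in> standard_simplex (length l - 1)"
  show mem: "affine_map l x \<in> standard_simplex n" by (rule affine_map_standard_simplex[OF l x])
  let ?S = "{k. affine_map l x k \<noteq> 0}"
  have S: "?S \<in> simplex_complex n" by (rule support_in_simplex_complex[OF mem])
  show "0 < simplex_weight \<xi> (affine_map l x)"
    unfolding simplex_weight_def by (rule is_weightD(1)[OF w S])
  have li: "l ! i \<in> standard_simplex n" if "x i \<noteq> 0" for i
  proof -
    have "i < length l" by (rule support_index[OF x l(1) that])
    then show ?thesis using l(2) nth_mem by blast
  qed
  have Si: "{k. (l ! i) k \<noteq> 0} \<in> simplex_complex n" "{k. (l ! i) k \<noteq> 0} \<subseteq> ?S" if "x i \<noteq> 0" for i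
    using support_in_simplex_complex[OF li[OF that]] that unfolding support_affine_map[OF l x] by auto
  show le: "weight_le t (simplex_weight \<xi> (l ! i)) (simplex_weight \<xi> (affine_map l x))" if "x i \<noteq> 0" for i
    unfolding simplex_weight_def using is_weightD(2)[OF w S] Si[OF that] by blast
  obtain v where v: "v \<in> ?S" "\<xi> ?S = \<xi> {v}" using att[OF S] by blast
  then obtain i where i: "x i \<noteq> 0" "(l ! i) v \<noteq> 0" unfolding support_affine_map[OF l x] by blast
  have "{v} \<in> simplex_complex n" using S v(1) by (auto simp: simplex_complex_def)
  then have "weight_le t (\<xi> {v}) (simplex_weight \<xi> (l ! i))"
    unfolding simplex_weight_def using is_weightD(2)[OF w Si(1)[OF i(1)]] i by auto
  then have "simplex_weight \<xi> (affine_map l x) = simplex_weight \<xi> (l ! i)"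
    using le[OF i(1)] v(2) unfolding simplex_weight_def by (simp add: weight_le_antisym)
  with i show "\<exists>i. x i \<noteq> 0 \<and> simplex_weight \<xi> (affine_map l x) = simplex_weight \<xi> (l ! i)" by blast
qed

text \<open>The singular simplex \<open>g\<close> composed with the affine map to \<open>l\<close>,
  with the pulled-back weight; a face is weighted by the value of \<omega> at the image of its
  barycentre.\<close>

definition affine_piece :: "(point \<Rightarrow> 'b) \<Rightarrow> (point \<Rightarrow> nat) \<Rightarrow> point list \<Rightarrow> 'b wsimplex" where
  "affine_piece g \<omega> l =
     (restrict (\<lambda>S. \<omega> (affine_map l (uniform_point S))) (simplex_complex (length l - 1)),
      restrict (\<lambda>x. g (affine_map l x)) (standard_simplex (length l - 1)))"

lemma affine_piece_weight:
  assumes "weight_function t D \<omega>" "l \<noteq> []" "set l \<subseteq> D" "x \<in> standard_simplex (length l - 1)"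
  shows "simplex_weight (fst (affine_piece g \<omega> l)) x = \<omega> (affine_map l x)"
proof -
  note S = support_in_simplex_complex[OF assms(4)]
  show ?thesis
    using S weight_function_eq[OF assms(1-3) uniform_point(1)[OF S] assms(4) uniform_point(2)[OF S]]
    by (simp add: simplex_weight_def affine_piece_def)
qed

lemma continuous_affine_map:
  "continuous_map (subtopology (powertop_real UNIV) S) (powertop_real UNIV) (affine_map l)"
  unfolding continuous_map_componentwise_UNIV affine_map_def
  by (intro allI continuous_map_sum continuous_map_real_mult continuous_map_from_subtopology
      continuous_map_product_projection) (auto intro: continuous_intros)

text \<open>Continuity and W-continuity pass to the composite; that the pulled-back weight is
  divisible is the attainment clause of \<open>weight_function\<close>.\<close>

lemma affine_piece_singular:
  assumes \<omega>: "weight_function t D \<omega>" and l: "l \<noteq> []" "set l \<subseteq> D"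
    and g: "continuous_map (subtopology (powertop_real UNIV) D) X g"
    and le: "\<And>z. z \<in> D \<Longrightarrow> weight_le t (wX (g z)) (\<omega> z)"
  shows "affine_piece g \<omega> l \<in> weighted_singular_simplices t X wX (length l - 1)"
proof -
  let ?n = "length l - 1"
  let ?\<xi> = "fst (affine_piece g \<omega> l)" and ?\<theta> = "snd (affine_piece g \<omega> l)"
  have \<xi>: "?\<xi> S = \<omega> (affine_map l (uniform_point S))" if "S \<in> simplex_complex ?n" for S
    using that by (simp add: affine_piece_def)
  have "divisibly_weighted t (simplex_complex ?n) ?\<xi>"
    unfolding divisibly_weighted_iff weighted_complex_def
  proof (intro conjI ballI)
    show "abs_simplicial_complex (simplex_complex ?n)"
      by (auto simp: abs_simplicial_complex_def simplex_complex_def intro: finite_subset)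
    have "0 < ?\<xi> S" if "S \<in> simplex_complex ?n" for S
      using weight_functionD(2)[OF \<omega> l uniform_point(1)[OF that]] \<xi>[OF that] by simp
    moreover have "weight_le t (?\<xi> T) (?\<xi> S)" if "S \<in> simplex_complex ?n" "T \<in> simplex_complex ?n" "T \<subseteq> S" for S T
      using weight_function_mono[OF \<omega> l uniform_point(1)[OF that(2)] uniform_point(1)[OF that(1)]] \<xi> that uniform_point(2)
      by simp
    ultimately show "is_weight t (simplex_complex ?n) ?\<xi>"
      unfolding is_weight_def weight_le_def by blast
    fix S assume S: "S \<in> simplex_complex ?n"
    obtain i where i: "uniform_point S i \<noteq> 0" "?\<xi> S = \<omega> (l ! i)"
      using weight_functionD(4)[OF \<omega> l uniform_point(1)[OF S]] \<xi>[OF S] by auto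
    then have iS: "i \<in> S" using uniform_point(2)[OF S] by blast
    then have "{i} \<in> simplex_complex ?n" "i < length l" using S l(1) by (auto simp: simplex_complex_def neq_Nil_conv)
    then have "?\<xi> {i} = \<omega> (l ! i)" using \<xi> by (simp add: uniform_point_singleton affine_map_vertex)
    with i iS show "\<exists>v\<in>S. ?\<xi> S = ?\<xi> {v}" by metis
  qed
  moreover have "continuous_map (subtopology (powertop_real UNIV) (standard_simplex ?n)) X ?\<theta>"
  proof -
    have "continuous_map (subtopology (powertop_real UNIV) (standard_simplex ?n)) (subtopology (powertop_real UNIV) D) (affine_map l)"
      using weight_functionD(1)[OF \<omega> l] by (auto simp: continuous_map_in_subtopology continuous_affine_map)
    then have "continuous_map (subtopology (powertop_real UNIV) (standard_simplex ?n)) X (g \<circ> affine_map l)"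
      using g by (rule continuous_map_compose)
    then show ?thesis
      by (rule continuous_map_eq) (auto simp: affine_piece_def)
  qed
  moreover have "weight_le t (wX (?\<theta> x)) (simplex_weight ?\<xi> x)" if "x \<in> standard_simplex ?n" for x
  proof -
    have "?\<theta> x = g (affine_map l x)" using that by (simp add: affine_piece_def)
    then show ?thesis using le[OF weight_functionD(1)[OF \<omega> l that]] affine_piece_weight[OF \<omega> l that, of g] by simp
  qed
  ultimately show ?thesis
    by (cases t) (auto simp: weighted_singular_simplices_def W_continuous_def weight_le_def affine_piece_def case_prod_beta)
qed

lemma affine_map_face:
  assumes "length l = Suc n" "j \<le> n"
  shows "affine_map l (simplical_face j x) = affine_map (list_face j l) x"
proof
  fix k
  have "(\<Sum>i<Suc n. simplical_face j x i * (l ! i) k) = (\<Sum>i\<in>{..<Suc n} - {j}. simplical_face j x i * (l ! i) k)"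
    using assms by (intro sum.mono_neutral_right) (auto simp: simplical_face_def)
  also have "\<dots> = (\<Sum>i<n. x i * (list_face j l ! i) k)"
    by (rule sum.reindex_bij_witness[of _ "\<lambda>i. if i < j then i else Suc i" "\<lambda>i. if i < j then i else i - 1"])
       (use assms in \<open>auto simp: simplical_face_def list_face_def nth_append min_def\<close>)
  finally show "affine_map l (simplical_face j x) k = affine_map (list_face j l) x k"
    using assms length_list_face[of j l] by (simp add: affine_map_def del: sum.lessThan_Suc)
qed

lemma skip_vertex_image: "j \<le> n \<Longrightarrow> skip_vertex j ` {..<n} = {..n} - {j}"
proof (intro equalityI subsetI)
  fix i assume "j \<le> n" "i \<in> {..n} - {j}"
  then show "i \<in> skip_vertex j ` {..<n}"
    by (cases "i < j") (auto simp: skip_vertex_def intro: image_eqI[of _ _ i] image_eqI[of _ _ "i - 1"])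
qed (auto simp: skip_vertex_def split: if_splits)

lemma uniform_point_skip: "uniform_point (skip_vertex j ` S) = simplical_face j (uniform_point S)"
proof -
  have inj: "inj_on (skip_vertex j) S" by (auto simp: inj_on_def skip_vertex_def split: if_splits)
  show ?thesis
  proof
    fix i
    consider "i < j" | "i = j" | "j < i" by linarith
    then show "uniform_point (skip_vertex j ` S) i = simplical_face j (uniform_point S) i"
    proof cases
      case 1
      then have "i \<in> skip_vertex j ` S \<longleftrightarrow> i \<in> S"
        by (auto simp: skip_vertex_def image_iff split: if_splits intro!: bexI[of _ i])
      with 1 show ?thesis by (simp add: uniform_point_def simplical_face_def card_image[OF inj])
    next
      case 2
      then have "i \<notin> skip_vertex j ` S"
        by (auto simp: skip_vertex_def image_iff split: if_splits)
      with 2 show ?thesis by (simp add: uniform_point_def simplical_face_def)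
    next
      case 3
      then have "i \<in> skip_vertex j ` S \<longleftrightarrow> i - 1 \<in> S"
        by (auto simp: skip_vertex_def image_iff split: if_splits intro!: bexI[of _ "i - 1"])
      with 3 show ?thesis by (simp add: uniform_point_def simplical_face_def card_image[OF inj])
    qed
  qed
qed

lemma weighted_singular_face_affine_piece:
  assumes "length l = Suc n" "0 < n" "j \<le> n"
  shows "weighted_singular_face n j (affine_piece g \<omega> l) = affine_piece g \<omega> (list_face j l)"
proof -
  have len: "length (list_face j l) = n" using assms length_list_face[of j l] by simp
  have "skip_vertex j ` S \<in> simplex_complex n" if "S \<in> simplex_complex (n - 1)" for S
    using that assms by (fastforce simp: simplex_complex_def skip_vertex_def)
  moreover have "simplical_face j x \<in> standard_simplex n" if "x \<in> standard_simplex (n - Suc 0)" for x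
    using simplical_face_in_standard_simplex[of n j x] that assms by simp
  ultimately show ?thesis
    using assms len
    by (auto simp: weighted_singular_face_def affine_piece_def singular_face_def uniform_point_skip affine_map_face fun_eq_iff restrict_def)
qed

lemma affine_piece_top_weight:
  assumes "l \<noteq> []"
  shows "fst (affine_piece g \<omega> l) {..length l - 1} = \<omega> (barycentre l)"
proof -
  have "{..length l - 1} = {..<length l}" using assms by (auto simp: neq_Nil_conv)
  with lessThan_in_simplex_complex[OF assms] show ?thesis by (simp add: affine_piece_def barycentre_def)
qed

abbreviation piece_chain :: "weight_type \<Rightarrow> (point \<Rightarrow> 'b) \<Rightarrow> (point \<Rightarrow> nat) \<Rightarrow> nat \<Rightarrow> (point list \<Rightarrow>\<^sub>0 int) \<Rightarrow> ('b wsimplex \<Rightarrow>\<^sub>0 int)" where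
  "piece_chain t g \<omega> \<equiv> weighted t (\<lambda>l. \<omega> (barycentre l)) (\<lambda>l. frag_of (affine_piece g \<omega> l))"

text \<open>Faces of an affine piece are the affine pieces of the list faces, with weights read at
  their barycentres, so the singular boundary becomes the list boundary. Positive degree excludes
  the augmentation term.\<close>

lemma boundary_affine_piece:
  assumes "length l = Suc n" "0 < n"
  shows "weighted_singular_boundary t n (frag_of (affine_piece g \<omega> l)) = piece_chain t g \<omega> (\<omega> (barycentre l)) (list_bd l)"
proof -
  let ?\<xi> = "fst (affine_piece g \<omega> l)"
  have ne: "l \<noteq> []" using assms by auto
  have top: "?\<xi> {..n} = \<omega> (barycentre l)" using affine_piece_top_weight[OF ne, of g \<omega>] assms by simp
  have face: "?\<xi> ({..n} - {j}) = \<omega> (barycentre (list_face j l))" if "j \<le> n" for j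
  proof -
    have len: "length (list_face j l) = n" using assms that length_list_face[of j l] by simp
    have skip: "{..n} - {j} = skip_vertex j ` {..<n}" by (rule skip_vertex_image[OF that, symmetric])
    have "{..n} - {j} \<noteq> {}" unfolding skip using assms(2) by (auto simp: lessThan_empty_iff)
    then have "{..n} - {j} \<in> simplex_complex n" by (auto simp: simplex_complex_def)
    then show ?thesis
      using assms len that skip by (simp add: affine_piece_def barycentre_def uniform_point_skip affine_map_face)
  qed
  have "weighted_singular_boundary t n (frag_of (affine_piece g \<omega> l)) =
    (\<Sum>j\<le>n. frag_cmul ((-1) ^ j * weight_ratio t (?\<xi> {..n}) (?\<xi> ({..n} - {j}))) (frag_of (weighted_singular_face n j (affine_piece g \<omega> l))))"
    by (simp add: weighted_singular_boundary_def case_prod_beta weight_coeff_eq)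
  also have "\<dots> = (\<Sum>j\<le>n. frag_cmul ((-1) ^ j) (frag_cmul (weight_ratio t (\<omega> (barycentre l)) (\<omega> (barycentre (list_face j l))))
      (frag_of (affine_piece g \<omega> (list_face j l)))))"
    by (intro sum.cong) (use assms in \<open>auto simp: top face weighted_singular_face_affine_piece\<close>)
  also have "\<dots> = piece_chain t g \<omega> (\<omega> (barycentre l)) (list_bd l)"
    using assms by (simp add: list_bd_sum weighted_sum lessThan_Suc_atMost)
  finally show ?thesis .
qed

lemma boundary_piece_chain:
  assumes \<omega>: "weight_function t D \<omega>" and c: "Poly_Mapping.keys c \<subseteq> {l. length l = Suc n \<and> set l \<subseteq> D}" and n: "0 < n"
    and a: "0 < a" "\<And>l. l \<in> Poly_Mapping.keys c \<Longrightarrow> weight_le t (\<omega> (barycentre l)) a"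
  shows "weighted_singular_boundary t n (piece_chain t g \<omega> a c) = piece_chain t g \<omega> a (list_chain_bd c)"
  unfolding weighted_singular_boundary_def
proof (rule frag_extend_weighted_weighted[OF a(1)])
  note lw = list_weight_barycentre[OF \<omega>]
  fix l assume l: "l \<in> Poly_Mapping.keys c"
  then have len: "length l = Suc n" and D: "set l \<subseteq> D" using c by auto
  then have ne: "l \<noteq> []" by auto
  show "0 < \<omega> (barycentre l) \<and> weight_le t (\<omega> (barycentre l)) a"
    using list_weightD(1)[OF lw ne D] a(2)[OF l] by simp
  show "frag_extend (\<lambda>(\<xi>, \<theta>). \<Sum>j\<le>n. frag_cmul ((- 1) ^ j * weight_coeff t \<xi> {..n} ({..n} - {j}))
      (frag_of (weighted_singular_face n j (\<xi>, \<theta>)))) (frag_of (affine_piece g \<omega> l))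
     = piece_chain t g \<omega> (\<omega> (barycentre l)) (list_bd l)"
    using boundary_affine_piece[OF len n, of t g \<omega>] unfolding weighted_singular_boundary_def .
  fix m assume m: "m \<in> Poly_Mapping.keys (list_bd l)"
  have "m \<noteq> []" "set m \<subseteq> set l" using list_bd_keysD[OF m] len n by auto
  then show "0 < \<omega> (barycentre m) \<and> weight_le t (\<omega> (barycentre m)) (\<omega> (barycentre l))"
    using list_weightD(1)[OF lw, of m] list_weightD(2)[OF lw, of m l] D by auto
qed

text \<open>The fourth clause exhibits a weighted singular simplex as an affine piece of itself
  along the standard vertices; through it operators on lists act on all singular simplices.\<close>

lemma weighted_singular_simplexD:
  assumes "(\<xi>, \<theta>) \<in> weighted_singular_simplices t X wX n"
  shows "weight_function t (standard_simplex n) (simplex_weight \<xi>)"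
    "continuous_map (subtopology (powertop_real UNIV) (standard_simplex n)) X \<theta>"
    "z \<in> standard_simplex n \<Longrightarrow> weight_le t (wX (\<theta> z)) (simplex_weight \<xi> z)"
    "affine_piece \<theta> (simplex_weight \<xi>) (simplex_vertices n) = (\<xi>, \<theta>)"
    "simplex_weight \<xi> (barycentre (simplex_vertices n)) = \<xi> {..n}"
proof -
  have ext: "\<xi> \<in> extensional (simplex_complex n)" "\<theta> \<in> extensional (standard_simplex n)"
    and W: "W_continuous t (subtopology (powertop_real UNIV) (standard_simplex n)) (simplex_weight \<xi>) X wX \<theta>"
    and div: "divisibly_weighted t (simplex_complex n) \<xi>"
    using assms by (auto simp: weighted_singular_simplices_def)
  show "weight_function t (standard_simplex n) (simplex_weight \<xi>)"
    by (rule weight_function_simplex_weight[OF div])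
  show "continuous_map (subtopology (powertop_real UNIV) (standard_simplex n)) X \<theta>"
    using W by (simp add: W_continuous_def)
  show "z \<in> standard_simplex n \<Longrightarrow> weight_le t (wX (\<theta> z)) (simplex_weight \<xi> z)"
    using W by (cases t) (auto simp: W_continuous_def weight_le_def)
  have "simplex_weight \<xi> (affine_map (simplex_vertices n) (uniform_point S)) = \<xi> S" if "S \<in> simplex_complex n" for S
    using uniform_point[OF that] by (simp add: affine_map_simplex_vertices simplex_weight_def)
  then show eq: "affine_piece \<theta> (simplex_weight \<xi>) (simplex_vertices n) = (\<xi>, \<theta>)"
    using ext by (auto simp: affine_piece_def fun_eq_iff restrict_def extensional_def affine_map_simplex_vertices)
  then show "simplex_weight \<xi> (barycentre (simplex_vertices n)) = \<xi> {..n}"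
    using affine_piece_top_weight[of "simplex_vertices n" \<theta> "simplex_weight \<xi>"] by simp
qed

section \<open>The weighted singular complex\<close>

lemma affine_piece_compose:
  assumes "weight_function t D \<omega>" "l \<noteq> []" "set l \<subseteq> D" "m \<noteq> []" "set m \<subseteq> standard_simplex (length l - 1)"
  shows "affine_piece (snd (affine_piece g \<omega> l)) (simplex_weight (fst (affine_piece g \<omega> l))) m
       = affine_piece g \<omega> (map (affine_map l) m)"
proof -
  have mem: "affine_map m x \<in> standard_simplex (length l - 1)" if "x \<in> standard_simplex (length m - 1)" for x
    by (rule affine_map_standard_simplex[OF assms(4,5) that])
  have "simplex_weight (fst (affine_piece g \<omega> l)) (affine_map m (uniform_point S)) = \<omega> (affine_map (map (affine_map l) m) (uniform_point S))"
    if "S \<in> simplex_complex (length m - 1)" for S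
    using affine_piece_weight[OF assms(1-3) mem[OF uniform_point(1)[OF that]]] by (simp add: affine_map_compose)
  moreover have "snd (affine_piece g \<omega> l) (affine_map m x) = g (affine_map (map (affine_map l) m) x)"
    if "x \<in> standard_simplex (length m - 1)" for x
    using mem[OF that] by (simp add: affine_piece_def affine_map_compose)
  ultimately show ?thesis
    unfolding affine_piece_def[of _ _ m] affine_piece_def[of g \<omega> "map _ m"] by (auto intro!: restrict_ext)
qed

lemma weight_le_affine_piece:
  assumes "weight_function t D \<omega>" "l \<noteq> []" "set l \<subseteq> D" "m \<noteq> []" "set m \<subseteq> standard_simplex (length l - 1)"
  shows "0 < \<omega> (barycentre (map (affine_map l) m))"
    "weight_le t (\<omega> (barycentre (map (affine_map l) m))) (\<omega> (barycentre l))"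
proof -
  note b = barycentre_standard_simplex[OF assms(4,5)]
  note u = uniform_point[OF lessThan_in_simplex_complex[OF assms(2)]]
  show "0 < \<omega> (barycentre (map (affine_map l) m))"
    using weight_functionD(2)[OF assms(1-3) b] by (simp add: affine_map_barycentre)
  have "{i. barycentre m i \<noteq> 0} \<subseteq> {..length l - 1}"
    using support_in_simplex_complex[OF b] by (simp add: simplex_complex_def)
  then have "{i. barycentre m i \<noteq> 0} \<subseteq> {i. uniform_point {..<length l} i \<noteq> 0}"
    unfolding u(2) using assms(2) by (cases l) auto
  from weight_function_mono[OF assms(1-3) b u(1) this]
  show "weight_le t (\<omega> (barycentre (map (affine_map l) m))) (\<omega> (barycentre l))"
    unfolding affine_map_barycentre[symmetric] barycentre_def[of l] .
qed

lemma map_affine_map_simplex_vertices: "set m \<subseteq> standard_simplex n \<Longrightarrow> map (affine_map (simplex_vertices n)) m = m"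
  by (rule map_idI) (use affine_map_simplex_vertices in blast)

lemma weight_le_simplex:
  assumes "weight_function t (standard_simplex n) \<omega>" "m \<noteq> []" "set m \<subseteq> standard_simplex n"
  shows "0 < \<omega> (barycentre m)" "weight_le t (\<omega> (barycentre m)) (\<omega> (barycentre (simplex_vertices n)))"
  using weight_le_affine_piece[OF assms(1) simplex_vertices_ne set_simplex_vertices assms(2)] assms(3)
  by (simp_all add: map_affine_map_simplex_vertices)

text \<open>\<open>k\<close> is the degree: 0 for chain maps, 1 for homotopies. Naturality makes the
  induced singular operator compatible with faces, and the support clause keeps its terms in every
  domain of a weight function, as such domains are closed under barycentres.\<close>

definition natural_operator :: "nat \<Rightarrow> (point list \<Rightarrow> (point list \<Rightarrow>\<^sub>0 int)) \<Rightarrow> bool" where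
  "natural_operator k F \<longleftrightarrow>
     (\<forall>l m. frag_image (map (affine_map l)) (F m) = F (map (affine_map l) m)) \<and>
     (\<forall>D l. (\<forall>m. m \<noteq> [] \<longrightarrow> set m \<subseteq> D \<longrightarrow> barycentre m \<in> D) \<longrightarrow> set l \<subseteq> D \<longrightarrow>
        Poly_Mapping.keys (F l) \<subseteq> {m. length m = length l + k \<and> set m \<subseteq> D})"

lemma natural_operatorD:
  assumes "natural_operator k F"
  shows "frag_image (map (affine_map l)) (F m) = F (map (affine_map l) m)"
    "(\<And>m. m \<noteq> [] \<Longrightarrow> set m \<subseteq> D \<Longrightarrow> barycentre m \<in> D) \<Longrightarrow> set l \<subseteq> D \<Longrightarrow>
        Poly_Mapping.keys (F l) \<subseteq> {m. length m = length l + k \<and> set m \<subseteq> D}"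
  using assms unfolding natural_operator_def by blast+

abbreviation "subdivide \<equiv> subdiv barycentre"
abbreviation "subdivide_htpy \<equiv> cone_htpy barycentre (subdiv barycentre)"

lemma natural_subdivide: "natural_operator 0 subdivide"
  unfolding natural_operator_def
proof (intro conjI allI impI)
  show "frag_image (map (affine_map l)) (subdivide m) = subdivide (map (affine_map l) m)" for l m
    by (rule subdiv_natural) (rule affine_map_barycentre)
  show "Poly_Mapping.keys (subdivide l) \<subseteq> {m. length m = length l + 0 \<and> set m \<subseteq> D}"
    if "\<forall>m. m \<noteq> [] \<longrightarrow> set m \<subseteq> D \<longrightarrow> barycentre m \<in> D" "set l \<subseteq> D" for D l
    using keys_subdiv[OF that(2), of barycentre] that(1) by simp
qed

lemma natural_subdivide_htpy: "natural_operator 1 subdivide_htpy"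
  unfolding natural_operator_def
proof (intro conjI allI impI)
  show "frag_image (map (affine_map l)) (subdivide_htpy m) = subdivide_htpy (map (affine_map l) m)" for l m
    by (rule cone_htpy_natural) (simp_all add: affine_map_barycentre natural_operatorD(1)[OF natural_subdivide])
  show "Poly_Mapping.keys (subdivide_htpy l) \<subseteq> {m. length m = length l + 1 \<and> set m \<subseteq> D}"
    if D: "\<forall>m. m \<noteq> [] \<longrightarrow> set m \<subseteq> D \<longrightarrow> barycentre m \<in> D" and l: "set l \<subseteq> D" for D l
  proof -
    have "Poly_Mapping.keys (subdivide_htpy l) \<subseteq> {m. length m = Suc (length l) \<and> set m \<subseteq> D}"
      by (rule keys_cone_htpy[OF l]) (use D keys_subdiv[of _ D barycentre] in auto)
    then show ?thesis by simp
  qed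
qed

text \<open>Computes on the vertex list of the standard simplex and transports the result along the
  simplex, each term multiplied by the ratio of the top weight to its own.\<close>

definition singular_operator ::
  "weight_type \<Rightarrow> nat \<Rightarrow> (point list \<Rightarrow> (point list \<Rightarrow>\<^sub>0 int)) \<Rightarrow> 'b wsimplex \<Rightarrow> ('b wsimplex \<Rightarrow>\<^sub>0 int)" where
  "singular_operator t n F \<sigma> =
     piece_chain t (snd \<sigma>) (simplex_weight (fst \<sigma>)) (fst \<sigma> {..n}) (F (simplex_vertices n))"

lemma natural_operator_simplex_keys:
  assumes "natural_operator k F"
  shows "Poly_Mapping.keys (F (simplex_vertices n)) \<subseteq> {m. length m = Suc n + k \<and> set m \<subseteq> standard_simplex n}"
proof -
  from natural_operatorD(2)[OF assms barycentre_standard_simplex set_simplex_vertices] show ?thesis by simp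
qed

text \<open>A piece of a piece is a piece of the composite affine map, so naturality of
  \<open>F\<close> moves the computation from the standard simplex to \<open>l\<close>.\<close>

lemma singular_operator_affine_piece:
  assumes F: "natural_operator k F" and \<omega>: "weight_function t D \<omega>" and l: "length l = Suc n" "set l \<subseteq> D"
  shows "singular_operator t n F (affine_piece g \<omega> l) = piece_chain t g \<omega> (\<omega> (barycentre l)) (F l)"
proof -
  let ?\<sigma> = "affine_piece g \<omega> l"
  have ne: "l \<noteq> []" using l by auto
  have top: "fst ?\<sigma> {..n} = \<omega> (barycentre l)" using affine_piece_top_weight[OF ne, of g \<omega>] l by simp
  have *: "piece_chain t (snd ?\<sigma>) (simplex_weight (fst ?\<sigma>)) a (F (simplex_vertices n))
      = weighted t (\<lambda>m. \<omega> (barycentre (map (affine_map l) m))) (\<lambda>m. frag_of (affine_piece g \<omega> (map (affine_map l) m))) a (F (simplex_vertices n))" for a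
  proof (rule weighted_cong)
    fix m assume "m \<in> Poly_Mapping.keys (F (simplex_vertices n))"
    then have m: "m \<noteq> []" "set m \<subseteq> standard_simplex (length l - 1)"
      using natural_operator_simplex_keys[OF F, of n] l by auto
    note b = barycentre_standard_simplex[OF m]
    show "simplex_weight (fst ?\<sigma>) (barycentre m) = \<omega> (barycentre (map (affine_map l) m)) \<and>
      frag_of (affine_piece (snd ?\<sigma>) (simplex_weight (fst ?\<sigma>)) m) = frag_of (affine_piece g \<omega> (map (affine_map l) m))"
      using affine_piece_weight[OF \<omega> ne l(2) b, of g] affine_piece_compose[OF \<omega> ne l(2) m, of g]
      by (simp add: affine_map_barycentre)
  qed
  have "frag_image (map (affine_map l)) (F (simplex_vertices n)) = F l"
    using natural_operatorD(1)[OF F] map_affine_map_vertices[OF l(1)] by simp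
  then show ?thesis
    unfolding singular_operator_def top *
    using weighted_image[of t "\<lambda>l. \<omega> (barycentre l)" "\<lambda>l. frag_of (affine_piece g \<omega> l)"
        "\<omega> (barycentre l)" "map (affine_map l)" "F (simplex_vertices n)"]
    by simp
qed

lemma singular_operator_piece_chain:
  assumes F: "natural_operator k F" and \<omega>: "weight_function t D \<omega>"
    and c: "Poly_Mapping.keys c \<subseteq> {l. length l = Suc n \<and> set l \<subseteq> D}"
    and a: "0 < a" "\<And>l. l \<in> Poly_Mapping.keys c \<Longrightarrow> weight_le t (\<omega> (barycentre l)) a"
  shows "frag_extend (singular_operator t n F) (piece_chain t g \<omega> a c) = piece_chain t g \<omega> a (frag_extend F c)"
proof (rule frag_extend_weighted_weighted[OF a(1)])
  fix l assume l: "l \<in> Poly_Mapping.keys c"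
  then have len: "length l = Suc n" and D: "set l \<subseteq> D" using c by auto
  then have ne: "l \<noteq> []" by auto
  show "0 < \<omega> (barycentre l) \<and> weight_le t (\<omega> (barycentre l)) a"
    using weight_function_pos[OF \<omega> barycentre_in[OF \<omega> ne D]] a(2)[OF l] by simp
  show "frag_extend (singular_operator t n F) (frag_of (affine_piece g \<omega> l)) = piece_chain t g \<omega> (\<omega> (barycentre l)) (F l)"
    using singular_operator_affine_piece[OF F \<omega> len D] by simp
  fix m assume "m \<in> Poly_Mapping.keys (F l)"
  then have "m \<in> Poly_Mapping.keys (frag_image (map (affine_map l)) (F (simplex_vertices n)))"
    using natural_operatorD(1)[OF F] map_affine_map_vertices[OF len] by simp
  then obtain m' where m': "m = map (affine_map l) m'" "m' \<in> Poly_Mapping.keys (F (simplex_vertices n))"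
    by (elim keys_frag_imageE) blast
  then have "m' \<noteq> []" "set m' \<subseteq> standard_simplex (length l - 1)"
    using natural_operator_simplex_keys[OF F, of n] len by auto
  from weight_le_affine_piece[OF \<omega> ne D this]
  show "0 < \<omega> (barycentre m) \<and> weight_le t (\<omega> (barycentre m)) (\<omega> (barycentre l))"
    using m' by simp
qed

lemma keys_iterated_subdivide_gen:
  assumes "\<And>m. m \<noteq> [] \<Longrightarrow> set m \<subseteq> D \<Longrightarrow> barycentre m \<in> D" "set l \<subseteq> D"
  shows "Poly_Mapping.keys ((frag_extend subdivide ^^ m) (frag_of l)) \<subseteq> {q. length q = length l \<and> set q \<subseteq> D}"
proof (induction m)
  case 0
  then show ?case using assms by (simp add: keys_frag_of)
next
  case (Suc m)
  show ?case unfolding funpow.simps o_apply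
  proof (rule keys_frag_extend_subset[OF Suc])
    fix q assume "q \<in> {q. length q = length l \<and> set q \<subseteq> D}"
    then show "Poly_Mapping.keys (subdivide q) \<subseteq> {q. length q = length l \<and> set q \<subseteq> D}"
      using keys_subdiv[of q D barycentre] assms(1) by auto
  qed
qed

lemma keys_iterated_subdivide:
  "Poly_Mapping.keys ((frag_extend subdivide ^^ m) (frag_of (simplex_vertices n))) \<subseteq> {l. length l = Suc n \<and> set l \<subseteq> standard_simplex n}"
  using keys_iterated_subdivide_gen[OF barycentre_standard_simplex set_simplex_vertices] by simp

lemma iterated_frag_extend:
  fixes F :: "'a \<Rightarrow> ('a \<Rightarrow>\<^sub>0 int)"
  shows "(frag_extend F ^^ m) c = frag_extend (\<lambda>l. (frag_extend F ^^ m) (frag_of l)) c"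
proof (induction m)
  case (Suc m)
  have "(frag_extend F ^^ Suc m) c = frag_extend F ((frag_extend F ^^ m) c)" by simp
  also have "\<dots> = frag_extend F (frag_extend (\<lambda>l. (frag_extend F ^^ m) (frag_of l)) c)"
    by (rule arg_cong[OF Suc])
  finally show ?case by (simp add: frag_extend_extend)
qed (simp flip: frag_expansion)

lemma list_chain_bd_iterated_subdivide:
  "list_chain_bd ((frag_extend subdivide ^^ m) c) = (frag_extend subdivide ^^ m) (list_chain_bd c)"
proof (induction m)
  case (Suc m)
  have "list_chain_bd (frag_extend subdivide d) = frag_extend subdivide (list_chain_bd d)" for d
    by (simp add: frag_extend_extend list_chain_bd_subdiv)
  with Suc show ?case by simp
qed simp

section \<open>Subdivision in the weighted singular complex\<close>

context
  fixes t :: weight_type and X :: "'b topology" and wX :: "'b \<Rightarrow> nat"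
begin

abbreviation "wsing \<equiv> weighted_singular_simplices t X wX"
abbreviation "wbd \<equiv> weighted_singular_boundary t"

text \<open>Presents a generator as a piece chain with coefficient 1, so that generators and
  operators obey the same boundary formula.\<close>

lemma frag_of_wsing:
  assumes "\<sigma> \<in> wsing n"
  shows "frag_of \<sigma> = piece_chain t (snd \<sigma>) (simplex_weight (fst \<sigma>)) (fst \<sigma> {..n}) (frag_of (simplex_vertices n))"
    "0 < fst \<sigma> {..n}"
proof -
  obtain \<xi> \<theta> where \<sigma>: "\<sigma> = (\<xi>, \<theta>)" by (cases \<sigma>)
  note D = weighted_singular_simplexD[OF assms[unfolded \<sigma>]]
  show "0 < fst \<sigma> {..n}"
    using weight_le_simplex(1)[OF D(1) simplex_vertices_ne set_simplex_vertices] D(5) \<sigma> by simp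
  then show "frag_of \<sigma> = piece_chain t (snd \<sigma>) (simplex_weight (fst \<sigma>)) (fst \<sigma> {..n}) (frag_of (simplex_vertices n))"
    using D(4,5) \<sigma> by simp
qed

lemma keys_piece_chain:
  assumes "weight_function t D \<omega>" "continuous_map (subtopology (powertop_real UNIV) D) X g"
    "\<And>z. z \<in> D \<Longrightarrow> weight_le t (wX (g z)) (\<omega> z)"
    "Poly_Mapping.keys c \<subseteq> {l. length l = Suc n \<and> set l \<subseteq> D}"
  shows "Poly_Mapping.keys (piece_chain t g \<omega> a c) \<subseteq> wsing n"
proof (rule keys_weighted)
  fix l assume "l \<in> Poly_Mapping.keys c"
  then have l: "length l = Suc n" "set l \<subseteq> D" using assms(4) by auto
  moreover from l have "l \<noteq> []" by auto
  ultimately show "Poly_Mapping.keys (frag_of (affine_piece g \<omega> l)) \<subseteq> wsing n"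
    using affine_piece_singular[OF assms(1) _ _ assms(2,3), of l] by (simp add: keys_frag_of)
qed

lemma keys_singular_operator:
  assumes "\<sigma> \<in> wsing n" "natural_operator k F"
  shows "Poly_Mapping.keys (singular_operator t n F \<sigma>) \<subseteq> wsing (n + k)"
proof -
  obtain \<xi> \<theta> where \<sigma>: "\<sigma> = (\<xi>, \<theta>)" by (cases \<sigma>)
  note D = weighted_singular_simplexD[OF assms(1)[unfolded \<sigma>]]
  show ?thesis unfolding singular_operator_def \<sigma>
    by (rule keys_piece_chain[of "standard_simplex n"])
       (use D natural_operator_simplex_keys[OF assms(2), of n] in simp_all)
qed

lemma wbd_singular_operator:
  assumes \<sigma>: "\<sigma> \<in> wsing n" and F: "natural_operator k F" and nk: "0 < n + k"
  shows "wbd (n + k) (singular_operator t n F \<sigma>)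
    = piece_chain t (snd \<sigma>) (simplex_weight (fst \<sigma>)) (fst \<sigma> {..n}) (list_chain_bd (F (simplex_vertices n)))"
proof -
  obtain \<xi> \<theta> where \<sigma>': "\<sigma> = (\<xi>, \<theta>)" by (cases \<sigma>)
  note D = weighted_singular_simplexD[OF \<sigma>[unfolded \<sigma>']]
  show ?thesis unfolding singular_operator_def
  proof (rule boundary_piece_chain[of t "standard_simplex n"])
    show "weight_function t (standard_simplex n) (simplex_weight (fst \<sigma>))" using D \<sigma>' by simp
    show "Poly_Mapping.keys (F (simplex_vertices n)) \<subseteq> {l. length l = Suc (n + k) \<and> set l \<subseteq> standard_simplex n}"
      using natural_operator_simplex_keys[OF F, of n] by simp
    show "weight_le t (simplex_weight (fst \<sigma>) (barycentre m)) (fst \<sigma> {..n})" if "m \<in> Poly_Mapping.keys (F (simplex_vertices n))" for m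
    proof -
      have "m \<noteq> []" "set m \<subseteq> standard_simplex n" using that natural_operator_simplex_keys[OF F, of n] by auto
      from weight_le_simplex(2)[OF D(1) this] show ?thesis using D(5) \<sigma>' by simp
    qed
  qed (use nk frag_of_wsing(2)[OF \<sigma>] in auto)
qed

lemma natural_id: "natural_operator 0 frag_of"
  by (auto simp: natural_operator_def keys_frag_of)

lemma singular_operator_frag_of: "\<sigma> \<in> wsing n \<Longrightarrow> singular_operator t n frag_of \<sigma> = frag_of \<sigma>"
  using frag_of_wsing(1) unfolding singular_operator_def by metis

lemma wbd_frag_of:
  assumes "\<sigma> \<in> wsing n" "0 < n"
  shows "wbd n (frag_of \<sigma>) = piece_chain t (snd \<sigma>) (simplex_weight (fst \<sigma>)) (fst \<sigma> {..n}) (list_bd (simplex_vertices n))"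
  using wbd_singular_operator[OF assms(1) natural_id] assms singular_operator_frag_of[OF assms(1)] by simp

lemma simplex_vertices_bd_keys:
  "Poly_Mapping.keys (list_bd (simplex_vertices n)) \<subseteq> {l. length l = n \<and> set l \<subseteq> standard_simplex n}"
  using keys_list_bd[of "simplex_vertices n"] set_simplex_vertices[of n] by auto

lemma piece_chain_bd_conditions:
  assumes "\<sigma> \<in> wsing (Suc n)"
  shows "weight_function t (standard_simplex (Suc n)) (simplex_weight (fst \<sigma>))"
    "Poly_Mapping.keys (list_bd (simplex_vertices (Suc n))) \<subseteq> {l. length l = Suc n \<and> set l \<subseteq> standard_simplex (Suc n)}"
    "0 < fst \<sigma> {..Suc n}"
    "l \<in> Poly_Mapping.keys (list_bd (simplex_vertices (Suc n))) \<Longrightarrow>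
      weight_le t (simplex_weight (fst \<sigma>) (barycentre l)) (fst \<sigma> {..Suc n})"
proof -
  obtain \<xi> \<theta> where \<sigma>': "\<sigma> = (\<xi>, \<theta>)" by (cases \<sigma>)
  note D = weighted_singular_simplexD[OF assms[unfolded \<sigma>']]
  show "weight_function t (standard_simplex (Suc n)) (simplex_weight (fst \<sigma>))" using D(1) \<sigma>' by simp
  show k: "Poly_Mapping.keys (list_bd (simplex_vertices (Suc n))) \<subseteq> {l. length l = Suc n \<and> set l \<subseteq> standard_simplex (Suc n)}"
    by (rule simplex_vertices_bd_keys)
  show "0 < fst \<sigma> {..Suc n}" by (rule frag_of_wsing(2)[OF assms])
  show "weight_le t (simplex_weight (fst \<sigma>) (barycentre l)) (fst \<sigma> {..Suc n})"
    if "l \<in> Poly_Mapping.keys (list_bd (simplex_vertices (Suc n)))"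
  proof -
    have "l \<noteq> []" "set l \<subseteq> standard_simplex (Suc n)" using that k by auto
    from weight_le_simplex(2)[OF D(1) this] show ?thesis using D(5) \<sigma>' by simp
  qed
qed

lemma keys_wbd:
  assumes "Poly_Mapping.keys c \<subseteq> wsing (Suc n)"
  shows "Poly_Mapping.keys (wbd (Suc n) c) \<subseteq> wsing n"
proof -
  have "Poly_Mapping.keys (wbd (Suc n) (frag_of \<sigma>)) \<subseteq> wsing n" if "\<sigma> \<in> wsing (Suc n)" for \<sigma>
  proof -
    obtain \<xi> \<theta> where \<sigma>': "\<sigma> = (\<xi>, \<theta>)" by (cases \<sigma>)
    note D = weighted_singular_simplexD[OF that[unfolded \<sigma>']]
    show ?thesis
      unfolding wbd_frag_of[OF that zero_less_Suc] unfolding \<sigma>'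
      by (rule keys_piece_chain[of "standard_simplex (Suc n)"]) (use D simplex_vertices_bd_keys in simp_all)
  qed
  then show ?thesis
    unfolding weighted_singular_boundary_def by (intro keys_frag_extend_subset[OF assms]) simp
qed

lemma wbd_diff: "wbd n (a - b) = wbd n a - wbd n b"
  and wbd_add: "wbd n (a + b) = wbd n a + wbd n b"
  and wbd_0 [simp]: "wbd n 0 = 0"
  by (simp_all add: weighted_singular_boundary_def frag_extend_diff frag_extend_add)

lemma wbd_extend:
  "wbd n (frag_extend f c) = frag_extend (\<lambda>x. wbd n (f x)) c"
  by (simp add: weighted_singular_boundary_def frag_extend_extend)

lemma wbd_eq: "wbd n c = frag_extend (\<lambda>x. wbd n (frag_of x)) c"
  using wbd_extend[of n frag_of c] by (simp flip: frag_expansion)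

lemma wbd_wbd:
  assumes "Poly_Mapping.keys c \<subseteq> wsing (Suc (Suc n))"
  shows "wbd (Suc n) (wbd (Suc (Suc n)) c) = 0"
proof -
  have "wbd (Suc n) (wbd (Suc (Suc n)) (frag_of \<sigma>)) = 0" if "\<sigma> \<in> wsing (Suc (Suc n))" for \<sigma>
    unfolding wbd_frag_of[OF that zero_less_Suc]
    by (subst boundary_piece_chain[OF piece_chain_bd_conditions(1,2)[OF that] _ piece_chain_bd_conditions(3,4)[OF that]])
       (simp_all add: list_bd_bd)
  then show ?thesis
    unfolding wbd_eq[of "Suc (Suc n)" c] wbd_extend by (intro frag_extend_eq_0) (use assms in auto)
qed

definition "sd n = frag_extend (singular_operator t n subdivide)"
definition "sd_htpy n = frag_extend (singular_operator t n subdivide_htpy)"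

lemma keys_sd: "Poly_Mapping.keys c \<subseteq> wsing n \<Longrightarrow> Poly_Mapping.keys (sd n c) \<subseteq> wsing n"
  unfolding sd_def using keys_singular_operator[OF _ natural_subdivide] by (intro keys_frag_extend_subset) simp_all

lemma keys_sd_htpy: "Poly_Mapping.keys c \<subseteq> wsing n \<Longrightarrow> Poly_Mapping.keys (sd_htpy n c) \<subseteq> wsing (Suc n)"
  unfolding sd_htpy_def using keys_singular_operator[OF _ natural_subdivide_htpy] by (intro keys_frag_extend_subset) simp_all

lemma wbd_sd:
  assumes "Poly_Mapping.keys c \<subseteq> wsing (Suc n)"
  shows "wbd (Suc n) (sd (Suc n) c) = sd n (wbd (Suc n) c)"
proof -
  have "wbd (Suc n) (singular_operator t (Suc n) subdivide \<sigma>) = sd n (wbd (Suc n) (frag_of \<sigma>))" if "\<sigma> \<in> wsing (Suc n)" for \<sigma>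
  proof -
    have "wbd (Suc n) (singular_operator t (Suc n) subdivide \<sigma>)
       = piece_chain t (snd \<sigma>) (simplex_weight (fst \<sigma>)) (fst \<sigma> {..Suc n}) (frag_extend subdivide (list_bd (simplex_vertices (Suc n))))"
      using wbd_singular_operator[OF that natural_subdivide] by (simp add: list_chain_bd_subdiv)
    also have "\<dots> = sd n (wbd (Suc n) (frag_of \<sigma>))"
      unfolding wbd_frag_of[OF that zero_less_Suc] sd_def
      by (rule singular_operator_piece_chain[OF natural_subdivide piece_chain_bd_conditions[OF that], symmetric])
    finally show ?thesis .
  qed
  then show ?thesis
    unfolding sd_def[of "Suc n"] wbd_extend unfolding wbd_eq[of _ c] sd_def frag_extend_extend
    by (intro frag_extend_eq) (use assms in \<open>auto simp: sd_def\<close>)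
qed

lemma wbd_sd_htpy:
  assumes "Poly_Mapping.keys c \<subseteq> wsing n"
  shows "wbd (Suc n) (sd_htpy n c) = c - sd n c - (if n = 0 then 0 else sd_htpy (n - 1) (wbd n c))"
proof -
  have *: "wbd (Suc n) (singular_operator t n subdivide_htpy \<sigma>) = frag_of \<sigma> - sd n (frag_of \<sigma>) -
      (if n = 0 then 0 else sd_htpy (n - 1) (wbd n (frag_of \<sigma>)))" if "\<sigma> \<in> wsing n" for \<sigma>
  proof -
    let ?P = "piece_chain t (snd \<sigma>) (simplex_weight (fst \<sigma>)) (fst \<sigma> {..n})"
    have "wbd (Suc n) (singular_operator t n subdivide_htpy \<sigma>)
       = ?P (frag_of (simplex_vertices n) - subdivide (simplex_vertices n) - frag_extend subdivide_htpy (list_bd (simplex_vertices n)))"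
      using wbd_singular_operator[OF that natural_subdivide_htpy]
      by (simp add: list_chain_bd_cone_htpy[OF list_chain_bd_subdiv])
    also have "\<dots> = ?P (frag_of (simplex_vertices n)) - ?P (subdivide (simplex_vertices n)) - ?P (frag_extend subdivide_htpy (list_bd (simplex_vertices n)))"
      by (simp only: weighted_simps)
    also have "?P (frag_of (simplex_vertices n)) = frag_of \<sigma>" using frag_of_wsing(1)[OF that] by simp
    also have "?P (subdivide (simplex_vertices n)) = sd n (frag_of \<sigma>)" by (simp add: sd_def singular_operator_def)
    also have "?P (frag_extend subdivide_htpy (list_bd (simplex_vertices n))) = (if n = 0 then 0 else sd_htpy (n - 1) (wbd n (frag_of \<sigma>)))"
    proof (cases n)
      case 0
      \<comment> \<open>The augmented boundary of a vertex is the empty list, where the homotopy is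
        0.\<close>
      then show ?thesis by (simp add: simplex_vertices_def)
    next
      case (Suc k)
      have "?P (frag_extend subdivide_htpy (list_bd (simplex_vertices n))) = sd_htpy k (wbd (Suc k) (frag_of \<sigma>))"
        unfolding Suc wbd_frag_of[OF that[unfolded Suc] zero_less_Suc] sd_htpy_def
        by (rule singular_operator_piece_chain[OF natural_subdivide_htpy piece_chain_bd_conditions[OF that[unfolded Suc]], symmetric])
      then show ?thesis using Suc by simp
    qed
    finally show ?thesis .
  qed
  have "wbd (Suc n) (sd_htpy n c) = frag_extend (\<lambda>\<sigma>. frag_of \<sigma> - sd n (frag_of \<sigma>) - (if n = 0 then 0 else sd_htpy (n - 1) (wbd n (frag_of \<sigma>)))) c"
    unfolding sd_htpy_def[of n] wbd_extend by (intro frag_extend_eq *) (use assms in auto)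
  also have "\<dots> = c - sd n c - (if n = 0 then 0 else sd_htpy (n - 1) (wbd n c))"
    unfolding frag_extend_fun_diff wbd_eq[of n c]
    by (auto simp: sd_def sd_htpy_def frag_extend_extend frag_extend_eq_0 simp flip: frag_expansion)
  finally show ?thesis .
qed

abbreviation "wcycle n z \<equiv> Poly_Mapping.keys z \<subseteq> wsing n \<and> (0 < n \<longrightarrow> wbd n z = 0)"

text \<open>On a cycle the homotopy formula reduces to the identity minus \<open>sd\<close>; the
  bounding chains of successive subdivisions add up.\<close>

lemma iterated_sd:
  assumes "wcycle n z"
  shows "wcycle n ((sd n ^^ m) z) \<and> (\<exists>w. Poly_Mapping.keys w \<subseteq> wsing (Suc n) \<and> z = wbd (Suc n) w + (sd n ^^ m) z)"
proof (induction m)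
  case 0
  then show ?case using assms by (auto intro: exI[of _ 0])
next
  case (Suc m)
  let ?y = "(sd n ^^ m) z"
  have y: "Poly_Mapping.keys ?y \<subseteq> wsing n" "0 < n \<longrightarrow> wbd n ?y = 0" using Suc by auto
  obtain w where w: "Poly_Mapping.keys w \<subseteq> wsing (Suc n)" "z = wbd (Suc n) w + ?y" using Suc by blast
  have "wbd (Suc n) (sd_htpy n ?y) = ?y - sd n ?y"
    using wbd_sd_htpy[OF y(1)] y(2) by (simp add: sd_htpy_def)
  then have "z = wbd (Suc n) (w + sd_htpy n ?y) + sd n ?y" using w(2) by (simp add: wbd_add)
  moreover have "Poly_Mapping.keys (w + sd_htpy n ?y) \<subseteq> wsing (Suc n)"
    using w(1) keys_sd_htpy[OF y(1)] keys_add[of w "sd_htpy n ?y"] by blast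
  moreover have "wbd n (sd n ?y) = 0" if "0 < n"
    using wbd_sd[of ?y "n - 1"] y that by (simp add: sd_def)
  ultimately show ?case using keys_sd[OF y(1)] by auto
qed

lemma keys_iterated_sd: "Poly_Mapping.keys c \<subseteq> wsing n \<Longrightarrow> Poly_Mapping.keys ((sd n ^^ m) c) \<subseteq> wsing n"
  by (induction m) (auto intro: keys_sd[THEN subsetD])

lemma wbd_iterated_sd:
  "Poly_Mapping.keys c \<subseteq> wsing (Suc n) \<Longrightarrow> wbd (Suc n) ((sd (Suc n) ^^ m) c) = (sd n ^^ m) (wbd (Suc n) c)"
  by (induction m) (auto simp: wbd_sd keys_iterated_sd)

text \<open>Reduces iterated subdivision of singular simplices to that of one list of points, where
  diameters can be measured.\<close>

lemma iterated_sd_frag_of: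
  assumes "\<sigma> \<in> wsing n"
  shows "(sd n ^^ m) (frag_of \<sigma>) = piece_chain t (snd \<sigma>) (simplex_weight (fst \<sigma>)) (fst \<sigma> {..n})
     ((frag_extend subdivide ^^ m) (frag_of (simplex_vertices n)))"
proof (induction m)
  case 0
  then show ?case using frag_of_wsing(1)[OF assms] by simp
next
  case (Suc m)
  obtain \<xi> \<theta> where \<sigma>': "\<sigma> = (\<xi>, \<theta>)" by (cases \<sigma>)
  note D = weighted_singular_simplexD[OF assms[unfolded \<sigma>']]
  show ?case
    unfolding funpow.simps o_apply Suc unfolding sd_def
  proof (rule singular_operator_piece_chain[OF natural_subdivide _ keys_iterated_subdivide frag_of_wsing(2)[OF assms]])
    show "weight_function t (standard_simplex n) (simplex_weight (fst \<sigma>))" using D(1) \<sigma>' by simp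
    fix l assume "l \<in> Poly_Mapping.keys ((frag_extend subdivide ^^ m) (frag_of (simplex_vertices n)))"
    then have "l \<noteq> []" "set l \<subseteq> standard_simplex n" using keys_iterated_subdivide by fastforce+
    from weight_le_simplex(2)[OF D(1) this]
    show "weight_le t (simplex_weight (fst \<sigma>) (barycentre l)) (fst \<sigma> {..n})" using D(5) \<sigma>' by simp
  qed
qed

end

subsection \<open>Small simplices\<close>

definition diameter_le :: "real \<Rightarrow> point list \<Rightarrow> bool" where
  "diameter_le d l \<longleftrightarrow> (\<forall>x\<in>set l. \<forall>y\<in>set l. \<forall>k. \<bar>x k - y k\<bar> \<le> d)"

lemma affine_map_close:
  assumes "x \<in> standard_simplex (length l - 1)" "l \<noteq> []" "\<And>y. y \<in> set l \<Longrightarrow> \<bar>y k - c\<bar> \<le> d"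
  shows "\<bar>affine_map l x k - c\<bar> \<le> d"
proof -
  note 1 = sum_standard_simplex[OF assms(1,2)]
  then have "affine_map l x k - c = (\<Sum>i<length l. x i * ((l ! i) k - c))"
    by (simp add: affine_map_def algebra_simps sum_subtractf flip: sum_distrib_left)
  also have "\<bar>\<dots>\<bar> \<le> (\<Sum>i<length l. x i * d)"
    by (rule order.trans[OF sum_abs sum_mono])
       (use standard_simplexD(1)[OF assms(1)] assms(3) in \<open>auto simp: abs_mult intro!: mult_left_mono\<close>)
  also have "\<dots> = d" using 1 by (simp flip: sum_distrib_right)
  finally show ?thesis .
qed

lemma barycentre_close:
  assumes "l \<noteq> []" "\<And>y. y \<in> set l \<Longrightarrow> \<bar>y k - c\<bar> \<le> d"
  shows "\<bar>barycentre l k - c\<bar> \<le> d"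
  unfolding barycentre_def
  by (rule affine_map_close[OF uniform_point(1)[OF lessThan_in_simplex_complex[OF assms(1)]] assms])

text \<open>The entry \<open>v\<close> itself contributes nothing to the average of the differences,
  which saves one part in \<open>length l\<close> of the diameter.\<close>

lemma barycentre_vertex_close:
  assumes "diameter_le d l" "v \<in> set l" "0 \<le> d" "length l \<le> Suc n"
  shows "\<bar>barycentre l k - v k\<bar> \<le> real n / real (Suc n) * d"
proof -
  let ?N = "length l"
  have N: "0 < ?N" using assms(2) by (cases l) auto
  obtain j where j: "j < ?N" "v = l ! j" using assms(2) by (metis in_set_conv_nth)
  have "barycentre l k = (\<Sum>i<?N. (l ! i) k / ?N)"
    unfolding barycentre_def affine_map_def uniform_point_def by (intro sum.cong) auto
  also have "\<dots> - v k = (\<Sum>i<?N. ((l ! i) k - v k) / ?N)"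
    using N by (simp add: diff_divide_distrib sum_subtractf)
  also have "\<dots> = (\<Sum>i\<in>{..<?N} - {j}. ((l ! i) k - v k) / ?N)"
    using j by (intro sum.mono_neutral_right) auto
  also have "\<bar>\<dots>\<bar> \<le> (\<Sum>i\<in>{..<?N} - {j}. d / ?N)"
  proof (rule order.trans[OF sum_abs sum_mono])
    fix i assume "i \<in> {..<?N} - {j}"
    then have "\<bar>(l ! i) k - v k\<bar> \<le> d" using assms(1,2) by (auto simp: diameter_le_def)
    then show "\<bar>((l ! i) k - v k) / ?N\<bar> \<le> d / ?N" using N by (simp add: divide_right_mono)
  qed
  also have "\<dots> = real (?N - 1) / real ?N * d" using j by simp
  also have "\<dots> \<le> real n / real (Suc n) * d"
  proof (rule mult_right_mono[OF _ assms(3)])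
    obtain q where q: "?N = Suc q" using N by (cases ?N) auto
    then have "real q \<le> real n" using assms(4) by simp
    then show "real (?N - 1) / real ?N \<le> real n / real (Suc n)" by (simp add: q field_simps)
  qed
  finally show ?thesis .
qed

text \<open>A simplex of the subdivision is the barycentre followed by a simplex from a face. The
  latter is small by induction, and it stays in a sup-norm ball about the barycentre containing the
  entries of \<open>l\<close>, since such balls are closed under barycentres. Keeping
  \<open>n\<close> fixed gives one factor for all faces.\<close>

lemma subdiv_diameter:
  assumes "m \<in> Poly_Mapping.keys (subdivide l)" "diameter_le d l" "0 \<le> d" "length l \<le> Suc n"
  shows "diameter_le (real n / real (Suc n) * d) m"
  using assms(1,2,4)
proof (induction l arbitrary: m rule: list_bd_induct)
  case Nil
  then show ?case by (simp add: keys_frag_of diameter_le_def)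
next
  case (step l)
  let ?r = "real n / real (Suc n) * d"
  let ?D = "{y. \<forall>k. \<bar>y k - barycentre l k\<bar> \<le> ?r}"
  obtain m' where m': "m = barycentre l # m'" "m' \<in> Poly_Mapping.keys (frag_extend subdivide (list_bd l))"
    using step.prems(1) unfolding subdiv_step[OF step(1)] by (elim keys_frag_imageE) blast
  then obtain f where f: "f \<in> Poly_Mapping.keys (list_bd l)" "m' \<in> Poly_Mapping.keys (subdivide f)"
    by (elim keys_frag_extendE) blast
  have f': "length l = Suc (length f)" "set f \<subseteq> set l" using f(1) keys_list_bd[of l] by auto
  have "diameter_le d f" using step.prems(2) f'(2) by (auto simp: diameter_le_def)
  then have m'_small: "diameter_le ?r m'" using step(2)[OF f' f(2)] f'(1) step.prems(3) by simp
  have "set l \<subseteq> ?D"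
    using barycentre_vertex_close[OF step.prems(2) _ assms(3) step.prems(3)] by (auto simp: abs_minus_commute)
  then have "set f \<subseteq> ?D" using f' by blast
  moreover have "barycentre q \<in> ?D" if "q \<noteq> []" "set q \<subseteq> ?D" for q
    using barycentre_close[OF that(1)] that(2) by blast
  ultimately have "set m' \<subseteq> ?D" using keys_subdiv[of f ?D barycentre] f(2) by blast
  then have "\<bar>y k - barycentre l k\<bar> \<le> ?r \<and> \<bar>barycentre l k - y k\<bar> \<le> ?r" if "y \<in> set m'" for y k
    using that by (auto simp: abs_minus_commute)
  moreover have "0 \<le> ?r" using assms(3) by simp
  ultimately show ?case using m'_small unfolding m'(1) diameter_le_def by auto
qed

lemma iterated_subdivide_diameter:
  assumes "l \<in> Poly_Mapping.keys ((frag_extend subdivide ^^ m) (frag_of (simplex_vertices n)))"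
  shows "diameter_le ((real n / real (Suc n)) ^ m) l"
  using assms
proof (induction m arbitrary: l)
  case 0
  then show ?case by (auto simp: keys_frag_of diameter_le_def simplex_vertices_def simplex_vertex_def)
next
  case (Suc m)
  then obtain q where q: "q \<in> Poly_Mapping.keys ((frag_extend subdivide ^^ m) (frag_of (simplex_vertices n)))" "l \<in> Poly_Mapping.keys (subdivide q)"
    unfolding funpow.simps o_apply by (elim keys_frag_extendE) blast
  moreover have "length q = Suc n" using q keys_iterated_subdivide by blast
  ultimately show ?case using subdiv_diameter[OF q(2) Suc.IH[OF q(1)], of n] by simp
qed

text \<open>The bound holds from \<open>m0\<close> on, so that for a chain the maximum over its
  finitely many simplices can be taken.\<close>

lemma sd_small_simplex:
  assumes \<sigma>: "\<sigma> \<in> weighted_singular_simplices t X wX n"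
    and C: "\<And>V. V \<in> \<C> \<Longrightarrow> openin X V" "topspace X \<subseteq> \<Union>\<C>"
  shows "\<exists>m0. \<forall>m\<ge>m0. \<forall>\<tau>\<in>Poly_Mapping.keys ((sd t n ^^ m) (frag_of \<sigma>)). \<exists>V\<in>\<C>. snd \<tau> ` standard_simplex n \<subseteq> V"
proof -
  obtain \<xi> \<theta> where \<sigma>': "\<sigma> = (\<xi>, \<theta>)" by (cases \<sigma>)
  note D = weighted_singular_simplexD[OF \<sigma>[unfolded \<sigma>']]
  have "\<exists>T. openin (powertop_real UNIV) T \<and> {x \<in> standard_simplex n. \<theta> x \<in> V} = T \<inter> standard_simplex n" if "V \<in> \<C>" for V
  proof -
    have "openin (subtopology (powertop_real UNIV) (standard_simplex n)) {x \<in> standard_simplex n. \<theta> x \<in> V}"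
      using openin_continuous_map_preimage[OF D(2) C(1)[OF that]] by simp
    then show ?thesis by (simp add: openin_subtopology)
  qed
  then have "\<forall>V\<in>\<C>. \<exists>T. openin (powertop_real UNIV) T \<and> {x \<in> standard_simplex n. \<theta> x \<in> V} = T \<inter> standard_simplex n" by blast
  from bchoice[OF this] obtain T where T: "\<And>V. V \<in> \<C> \<Longrightarrow> openin (powertop_real UNIV) (T V)"
    "\<And>V. V \<in> \<C> \<Longrightarrow> {x \<in> standard_simplex n. \<theta> x \<in> V} = T V \<inter> standard_simplex n" by blast
  \<comment> \<open>\<open>d\<close> is a Lebesgue number for the cover of the standard simplex by
    preimages, extended to open sets \<open>T V\<close> of the ambient product.\<close>
  obtain d where d: "0 < d" "\<And>S. \<lbrakk>S \<subseteq> standard_simplex n; \<And>x y i. \<lbrakk>i \<le> n; x \<in> S; y \<in> S\<rbrakk> \<Longrightarrow> \<bar>x i - y i\<bar> \<le> d\<rbrakk>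
                       \<Longrightarrow> \<exists>U. U \<in> T ` \<C> \<and> S \<subseteq> U"
  proof (rule llemma[of n "T ` \<C>"])
    show "standard_simplex n \<subseteq> \<Union> (T ` \<C>)"
    proof
      fix x assume x: "x \<in> standard_simplex n"
      then have "\<theta> x \<in> topspace X" using continuous_map_image_subset_topspace[OF D(2)] by auto
      then obtain V where "V \<in> \<C>" "\<theta> x \<in> V" using C(2) by blast
      then show "x \<in> \<Union> (T ` \<C>)" using T(2)[of V] x by blast
    qed
  qed (use T(1) in auto)
  have "real n / real (Suc n) < 1" by simp
  then obtain m0 where m0: "(real n / real (Suc n)) ^ m0 < d" using real_arch_pow_inv[OF d(1)] by blast
  have "\<exists>V\<in>\<C>. snd \<tau> ` standard_simplex n \<subseteq> V" if m: "m0 \<le> m" and \<tau>: "\<tau> \<in> Poly_Mapping.keys ((sd t n ^^ m) (frag_of \<sigma>))" for m \<tau>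
  proof -
    let ?c = "(frag_extend subdivide ^^ m) (frag_of (simplex_vertices n))"
    have "Poly_Mapping.keys ((sd t n ^^ m) (frag_of \<sigma>)) \<subseteq> affine_piece \<theta> (simplex_weight \<xi>) ` Poly_Mapping.keys ?c"
      unfolding iterated_sd_frag_of[OF \<sigma>] unfolding \<sigma>' by (rule keys_weighted) (auto simp: keys_frag_of)
    then obtain l where l: "\<tau> = affine_piece \<theta> (simplex_weight \<xi>) l" "l \<in> Poly_Mapping.keys ?c" using \<tau> by blast
    have l': "length l = Suc n" "set l \<subseteq> standard_simplex n" using l(2) keys_iterated_subdivide by blast+
    then have ne: "l \<noteq> []" by auto
    have "(real n / real (Suc n)) ^ m \<le> (real n / real (Suc n)) ^ m0" by (intro power_decreasing m) auto
    then have "(real n / real (Suc n)) ^ m \<le> d" using m0 by linarith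
    then have small: "\<bar>x k - y k\<bar> \<le> d" if "x \<in> set l" "y \<in> set l" for x y k
      using iterated_subdivide_diameter[OF l(2)] that unfolding diameter_le_def by (blast intro: order.trans)
    let ?S = "affine_map l ` standard_simplex n"
    have "\<exists>U. U \<in> T ` \<C> \<and> ?S \<subseteq> U"
    proof (rule d(2))
      show "?S \<subseteq> standard_simplex n" using affine_map_standard_simplex[OF ne l'(2)] l'(1) by auto
      fix x y i assume "x \<in> ?S" "y \<in> ?S"
      then obtain a b where ab: "x = affine_map l a" "y = affine_map l b" "a \<in> standard_simplex n" "b \<in> standard_simplex n" by blast
      have "\<bar>affine_map l b i - v i\<bar> \<le> d" if "v \<in> set l" for v
        by (rule affine_map_close) (use ab l' ne small that in auto)
      then have "\<bar>affine_map l a i - affine_map l b i\<bar> \<le> d"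
        by (intro affine_map_close) (use ab l' ne in \<open>auto simp: abs_minus_commute\<close>)
      then show "\<bar>x i - y i\<bar> \<le> d" using ab by simp
    qed
    then obtain V where V: "V \<in> \<C>" "?S \<subseteq> T V" by blast
    have "snd \<tau> x \<in> V" if "x \<in> standard_simplex n" for x
    proof -
      have "affine_map l x \<in> standard_simplex n" using affine_map_standard_simplex[OF ne l'(2)] l'(1) that by auto
      then have "\<theta> (affine_map l x) \<in> V" using T(2)[OF V(1)] V(2) that by blast
      then show ?thesis using that l' l(1) by (simp add: affine_piece_def)
    qed
    then show ?thesis using V(1) by blast
  qed
  then show ?thesis by blast
qed

lemma sd_small:
  assumes c: "Poly_Mapping.keys c \<subseteq> weighted_singular_simplices t X wX n"
    and C: "\<And>V. V \<in> \<C> \<Longrightarrow> openin X V" "topspace X \<subseteq> \<Union>\<C>"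
  shows "\<exists>m. \<forall>\<tau>\<in>Poly_Mapping.keys ((sd t n ^^ m) c). \<exists>V\<in>\<C>. snd \<tau> ` standard_simplex n \<subseteq> V"
proof -
  have "\<forall>\<sigma>\<in>Poly_Mapping.keys c. \<exists>m0. \<forall>m\<ge>m0. \<forall>\<tau>\<in>Poly_Mapping.keys ((sd t n ^^ m) (frag_of \<sigma>)). \<exists>V\<in>\<C>. snd \<tau> ` standard_simplex n \<subseteq> V"
    using sd_small_simplex[OF _ C] c by blast
  then obtain M where M: "\<And>\<sigma> m. \<sigma> \<in> Poly_Mapping.keys c \<Longrightarrow> M \<sigma> \<le> m \<Longrightarrow>
     \<forall>\<tau>\<in>Poly_Mapping.keys ((sd t n ^^ m) (frag_of \<sigma>)). \<exists>V\<in>\<C>. snd \<tau> ` standard_simplex n \<subseteq> V" by metis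
  define m where "m = Max (insert 0 (M ` Poly_Mapping.keys c))"
  have Mm: "M \<sigma> \<le> m" if "\<sigma> \<in> Poly_Mapping.keys c" for \<sigma> using that by (simp add: m_def)
  have "(sd t n ^^ m) c = frag_extend (\<lambda>\<sigma>. (sd t n ^^ m) (frag_of \<sigma>)) c" for m
  proof (induction m)
    case (Suc m)
    then show ?case by (simp add: sd_def frag_extend_extend)
  qed (simp flip: frag_expansion)
  then have "Poly_Mapping.keys ((sd t n ^^ m) c) \<subseteq> (\<Union>\<sigma>\<in>Poly_Mapping.keys c. Poly_Mapping.keys ((sd t n ^^ m) (frag_of \<sigma>)))"
    using keys_frag_extend by metis
  then show ?thesis using M Mm by blast
qed

section \<open>Barycentric coordinates of a polyhedron\<close>

locale geometric_complex =
  fixes K :: "'v set set" and p :: "'v \<Rightarrow> 'a::euclidean_space"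
  assumes abs_complex: "abs_simplicial_complex K" and realization: "geometric_realization K p"
begin

lemma simplexD: "\<sigma> \<in> K \<Longrightarrow> finite \<sigma>" "\<sigma> \<in> K \<Longrightarrow> \<sigma> \<noteq> {}" "\<sigma> \<in> K \<Longrightarrow> \<tau> \<subseteq> \<sigma> \<Longrightarrow> \<tau> \<noteq> {} \<Longrightarrow> \<tau> \<in> K"
  using abs_complex abs_simplicial_complexD by blast+

lemma realizationD:
  "\<sigma> \<in> K \<Longrightarrow> inj_on p \<sigma>" "\<sigma> \<in> K \<Longrightarrow> \<not> affine_dependent (p ` \<sigma>)"
  "\<sigma> \<in> K \<Longrightarrow> \<tau> \<in> K \<Longrightarrow> realized_simplex p \<sigma> \<inter> realized_simplex p \<tau> = realized_simplex p (\<sigma> \<inter> \<tau>)"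
  "x \<in> polyhedron_of K p \<Longrightarrow> \<exists>U. open U \<and> x \<in> U \<and> finite {\<sigma>\<in>K. realized_simplex p \<sigma> \<inter> U \<noteq> {}}"
  using realization unfolding geometric_realization_def by (blast intro: inj_on_subset)+

abbreviation "P \<equiv> polyhedron_of K p"

text \<open>A barycentric coordinate is the restriction of an affine function on the ambient space,
  because the differences of the other vertices from \<open>p v\<close> are independent. This yields
  both uniqueness and continuity of coordinates.\<close>

lemma coordinate_functional:
  assumes \<sigma>: "\<sigma> \<in> K" and v: "v \<in> \<sigma>"
  obtains h :: "'a \<Rightarrow> real" where "continuous_on UNIV h"
    "\<And>c. sum c \<sigma> = 1 \<Longrightarrow> h (\<Sum>w\<in>\<sigma>. c w *\<^sub>R p w) = c v"
proof -
  note inj = realizationD(1)[OF \<sigma>] and fin = simplexD(1)[OF \<sigma>]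
  have ins: "p ` \<sigma> = insert (p v) (p ` (\<sigma> - {v}))" using v by auto
  have "p v \<notin> p ` (\<sigma> - {v})" using inj v by (auto simp: inj_on_def)
  then have "independent ((\<lambda>x. x - p v) ` p ` (\<sigma> - {v}))"
    using realizationD(2)[OF \<sigma>] affine_dependent_iff_dependent[of "p v" "p ` (\<sigma> - {v})"]
    unfolding ins by (simp add: uminus_add_conv_diff)
  \<comment> \<open>With the value -1 on all these differences, 1 + g(x - p v) is 1 at
    \<open>p v\<close> and 0 at the other vertices.\<close>
  then obtain g :: "'a \<Rightarrow> real" where g: "linear g" "\<forall>x\<in>(\<lambda>x. x - p v) ` p ` (\<sigma> - {v}). g x = -1"
    using linear_independent_extend[of _ "\<lambda>_. -1"] by blast
  show ?thesis
  proof
    show "continuous_on UNIV (\<lambda>x. 1 + g (x - p v))"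
      by (intro continuous_intros linear_continuous_on_compose[OF _ g(1)])
    fix c :: "'v \<Rightarrow> real" assume c: "sum c \<sigma> = 1"
    have "(\<Sum>w\<in>\<sigma>. c w *\<^sub>R p w) - p v = (\<Sum>w\<in>\<sigma>. c w *\<^sub>R p w) - (\<Sum>w\<in>\<sigma>. c w) *\<^sub>R p v"
      by (simp add: c)
    also have "\<dots> = (\<Sum>w\<in>\<sigma>. c w *\<^sub>R (p w - p v))"
      by (simp add: scaleR_diff_right sum_subtractf scaleR_sum_left)
    finally have "g ((\<Sum>w\<in>\<sigma>. c w *\<^sub>R p w) - p v) = (\<Sum>w\<in>\<sigma>. c w * g (p w - p v))"
      using g(1) by (simp add: linear_sum linear_scale)
    also have "\<dots> = (\<Sum>w\<in>\<sigma> - {v}. c w * g (p w - p v))"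
      using fin g(1) by (intro sum.mono_neutral_right) (auto simp: linear_0)
    also have "\<dots> = (\<Sum>w\<in>\<sigma> - {v}. - c w)"
      using g(2) by (intro sum.cong) auto
    also have "\<dots> = - (1 - c v)"
      using c fin v by (simp add: sum_negf sum_diff1)
    finally show "1 + g ((\<Sum>w\<in>\<sigma>. c w *\<^sub>R p w) - p v) = c v" by simp
  qed
qed

definition coordinates_in :: "'v set \<Rightarrow> ('v \<Rightarrow> real) \<Rightarrow> 'a \<Rightarrow> bool" where
  "coordinates_in \<sigma> c x \<longleftrightarrow> (\<forall>v. 0 \<le> c v) \<and> (\<forall>v. v \<notin> \<sigma> \<longrightarrow> c v = 0) \<and> sum c \<sigma> = 1 \<and> (\<Sum>v\<in>\<sigma>. c v *\<^sub>R p v) = x"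

lemma coordinates_in_unique:
  assumes "\<sigma> \<in> K" "coordinates_in \<sigma> c x" "coordinates_in \<sigma> d x"
  shows "c = d"
proof
  fix v
  show "c v = d v"
  proof (cases "v \<in> \<sigma>")
    case True
    then show ?thesis using coordinate_functional[OF assms(1) True] assms(2,3) by (metis coordinates_in_def)
  qed (use assms in \<open>auto simp: coordinates_in_def\<close>)
qed

lemma coordinates_in_mono:
  assumes "coordinates_in \<tau> c x" "\<tau> \<subseteq> \<sigma>" "finite \<sigma>"
  shows "coordinates_in \<sigma> c x"
proof -
  have "c v = 0" if "v \<notin> \<tau>" for v using assms(1) that by (simp add: coordinates_in_def)
  then have "sum c \<sigma> = sum c \<tau>" "(\<Sum>v\<in>\<sigma>. c v *\<^sub>R p v) = (\<Sum>v\<in>\<tau>. c v *\<^sub>R p v)"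
    using assms(2,3) by (simp_all add: sum.mono_neutral_right)
  with assms show ?thesis by (auto simp: coordinates_in_def)
qed

lemma coordinates_in_support:
  assumes "coordinates_in \<sigma> c x" "finite \<sigma>"
  shows "coordinates_in {v. c v \<noteq> 0} c x" "{v. c v \<noteq> 0} \<subseteq> \<sigma>" "{v. c v \<noteq> 0} \<noteq> {}"
proof -
  show sub: "{v. c v \<noteq> 0} \<subseteq> \<sigma>" using assms by (auto simp: coordinates_in_def)
  have "sum c \<sigma> = sum c {v. c v \<noteq> 0}" "(\<Sum>v\<in>\<sigma>. c v *\<^sub>R p v) = (\<Sum>v\<in>{v. c v \<noteq> 0}. c v *\<^sub>R p v)"
    using assms sub by (auto intro!: sum.mono_neutral_right)
  with assms show "coordinates_in {v. c v \<noteq> 0} c x" by (auto simp: coordinates_in_def)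
  then show "{v. c v \<noteq> 0} \<noteq> {}" unfolding coordinates_in_def by (metis sum.empty zero_neq_one)
qed

lemma ex_coordinates_in:
  assumes "finite \<sigma>" "inj_on p \<sigma>" "x \<in> realized_simplex p \<sigma>"
  shows "\<exists>c. coordinates_in \<sigma> c x"
proof -
  obtain u where u: "\<forall>y\<in>p ` \<sigma>. 0 \<le> u y" "sum u (p ` \<sigma>) = 1" "(\<Sum>y\<in>p ` \<sigma>. u y *\<^sub>R y) = x"
    using assms(3) convex_hull_finite[of "p ` \<sigma>"] assms(1) by (auto simp: realized_simplex_def)
  have "coordinates_in \<sigma> (\<lambda>v. if v \<in> \<sigma> then u (p v) else 0) x"
    using u assms(2) by (auto simp: coordinates_in_def sum.reindex if_distrib[of "\<lambda>a. a *\<^sub>R _"] cong: if_cong)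
  then show ?thesis by blast
qed

lemma coordinates_in_realized:
  assumes "coordinates_in \<sigma> c x" "finite \<sigma>"
  shows "x \<in> realized_simplex p \<sigma>"
proof -
  have "(\<Sum>v\<in>\<sigma>. c v *\<^sub>R p v) \<in> convex hull (p ` \<sigma>)"
    using assms by (intro convex_sum) (auto simp: coordinates_in_def hull_inc)
  then show ?thesis using assms by (simp add: coordinates_in_def realized_simplex_def)
qed

text \<open>Barycentric coordinates as one function on all vertices, zero off the carrier. The
  choice is harmless on the polyhedron by \<open>coordinates_in_unique'\<close>.\<close>

definition coord :: "'a \<Rightarrow> 'v \<Rightarrow> real" where
  "coord x = (SOME c. \<exists>\<sigma>\<in>K. coordinates_in \<sigma> c x)"

text \<open>Two realized simplices meet exactly in their common face; coordinates of
  \<open>x\<close> in that face agree with both given ones.\<close>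

lemma coordinates_in_unique':
  assumes "\<sigma> \<in> K" "\<tau> \<in> K" "coordinates_in \<sigma> c x" "coordinates_in \<tau> d x"
  shows "c = d"
proof -
  have "x \<in> realized_simplex p (\<sigma> \<inter> \<tau>)"
    using realizationD(3)[OF assms(1,2)] coordinates_in_realized assms simplexD(1) by blast
  moreover have "finite (\<sigma> \<inter> \<tau>)" "inj_on p (\<sigma> \<inter> \<tau>)"
    using assms(1) simplexD(1) realizationD(1) by (auto intro: inj_on_subset)
  ultimately obtain e where e: "coordinates_in (\<sigma> \<inter> \<tau>) e x" using ex_coordinates_in by blast
  have "coordinates_in \<sigma> e x" "coordinates_in \<tau> e x"
    using coordinates_in_mono[OF e] assms(1,2) simplexD(1) by auto
  then show ?thesis using coordinates_in_unique assms by metis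
qed

lemma coord_eq: "\<sigma> \<in> K \<Longrightarrow> coordinates_in \<sigma> c x \<Longrightarrow> coord x = c"
  unfolding coord_def by (rule some_equality) (use coordinates_in_unique' in blast)+

abbreviation "car x \<equiv> {v. coord x v \<noteq> 0}"

lemma coord:
  assumes "x \<in> P"
  shows "car x \<in> K" "coordinates_in (car x) (coord x) x" "0 \<le> coord x v"
proof -
  obtain \<sigma> where \<sigma>: "\<sigma> \<in> K" "x \<in> realized_simplex p \<sigma>" using assms by (auto simp: polyhedron_of_def)
  then obtain c where c: "coordinates_in \<sigma> c x" using ex_coordinates_in simplexD(1) realizationD(1) by blast
  then have "coord x = c" using coord_eq \<sigma>(1) by blast
  with coordinates_in_support[OF c simplexD(1)[OF \<sigma>(1)]] simplexD(3)[OF \<sigma>(1)]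
  show "car x \<in> K" "coordinates_in (car x) (coord x) x" by auto
  then show "0 \<le> coord x v" by (simp add: coordinates_in_def)
qed

lemma coord_sum:
  assumes "x \<in> P" "finite S" "car x \<subseteq> S"
  shows "sum (coord x) S = 1" "(\<Sum>v\<in>S. coord x v *\<^sub>R p v) = x"
  using coordinates_in_mono[OF coord(2)[OF assms(1)] assms(3,2)] by (simp_all add: coordinates_in_def)

lemma coordinates_in_P: "\<sigma> \<in> K \<Longrightarrow> coordinates_in \<sigma> c x \<Longrightarrow> x \<in> P"
  using coordinates_in_realized[of \<sigma> c x] simplexD(1)[of \<sigma>] by (auto simp: polyhedron_of_def)

text \<open>By affine independence a point is in the relative interior of a simplex iff all its
  coordinates there are positive, that is, iff its support is the whole simplex.\<close>

lemma carrier_simplex_eq: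
  assumes "x \<in> P" shows "carrier_simplex K p x = car x"
proof -
  have *: "x \<in> rel_interior (realized_simplex p \<sigma>) \<longleftrightarrow> \<sigma> = car x" if \<sigma>: "\<sigma> \<in> K" for \<sigma>
  proof -
    note inj = realizationD(1)[OF \<sigma>]
    have "x \<in> rel_interior (realized_simplex p \<sigma>) \<longleftrightarrow>
       (\<exists>u. (\<forall>y\<in>p ` \<sigma>. 0 < u y) \<and> sum u (p ` \<sigma>) = 1 \<and> (\<Sum>y\<in>p ` \<sigma>. u y *\<^sub>R y) = x)"
      unfolding realized_simplex_def rel_interior_convex_hull_explicit[OF realizationD(2)[OF \<sigma>]] by simp
    also have "\<dots> \<longleftrightarrow> \<sigma> = car x"
    proof
      assume "\<exists>u. (\<forall>y\<in>p ` \<sigma>. 0 < u y) \<and> sum u (p ` \<sigma>) = 1 \<and> (\<Sum>y\<in>p ` \<sigma>. u y *\<^sub>R y) = x"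
      then obtain u where u: "\<forall>y\<in>p ` \<sigma>. 0 < u y" "sum u (p ` \<sigma>) = 1" "(\<Sum>y\<in>p ` \<sigma>. u y *\<^sub>R y) = x" by blast
      let ?c = "\<lambda>v. if v \<in> \<sigma> then u (p v) else 0"
      have "coordinates_in \<sigma> ?c x"
        using u inj by (auto simp: coordinates_in_def sum.reindex less_imp_le if_distrib[of "\<lambda>a. a *\<^sub>R _"] cong: if_cong)
      then have "coord x = ?c" by (rule coord_eq[OF \<sigma>])
      then show "\<sigma> = car x" using u(1) by (auto split: if_splits)
    next
      assume s: "\<sigma> = car x"
      let ?u = "\<lambda>y. coord x (the_inv_into \<sigma> p y)"
      have inv: "the_inv_into \<sigma> p (p v) = v" if "v \<in> \<sigma>" for v using the_inv_into_f_f[OF inj that] .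
      have "sum ?u (p ` \<sigma>) = sum (coord x) \<sigma>" "(\<Sum>y\<in>p ` \<sigma>. ?u y *\<^sub>R y) = (\<Sum>v\<in>\<sigma>. coord x v *\<^sub>R p v)"
        using inv by (simp_all add: sum.reindex[OF inj] o_def)
      moreover have "0 < ?u y" if "y \<in> p ` \<sigma>" for y
        using that inv s coord(3)[OF assms] by (auto simp: less_le)
      ultimately show "\<exists>u. (\<forall>y\<in>p ` \<sigma>. 0 < u y) \<and> sum u (p ` \<sigma>) = 1 \<and> (\<Sum>y\<in>p ` \<sigma>. u y *\<^sub>R y) = x"
        using coord(2)[OF assms] s by (intro exI[of _ ?u]) (auto simp: coordinates_in_def)
    qed
    finally show ?thesis .
  qed
  show ?thesis unfolding carrier_simplex_def
    by (rule the_equality) (use * coord(1)[OF assms] in auto)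
qed

text \<open>On each closed simplex the coordinate is an affine function of the ambient space or 0.
  Local finiteness leaves finitely many closed simplices near a point, and continuous functions
  paste along a finite closed cover.\<close>

lemma continuous_coord: "continuous_on P (\<lambda>x. coord x v)"
proof -
  have onK: "continuous_on (realized_simplex p \<sigma>) (\<lambda>x. coord x v)" if \<sigma>: "\<sigma> \<in> K" for \<sigma>
  proof -
    have c: "coordinates_in \<sigma> (coord x) x" if "x \<in> realized_simplex p \<sigma>" for x
      using ex_coordinates_in[OF simplexD(1)[OF \<sigma>] realizationD(1)[OF \<sigma>] that] coord_eq[OF \<sigma>] by blast
    show ?thesis
    proof (cases "v \<in> \<sigma>")
      case True
      obtain h :: "'a \<Rightarrow> real" where h: "continuous_on UNIV h" "\<And>c. sum c \<sigma> = 1 \<Longrightarrow> h (\<Sum>w\<in>\<sigma>. c w *\<^sub>R p w) = c v"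
        using coordinate_functional[OF \<sigma> True] by blast
      have "continuous_on (realized_simplex p \<sigma>) h" using h(1) continuous_on_subset by blast
      then show ?thesis
        by (rule continuous_on_eq) (use h(2) c in \<open>metis coordinates_in_def\<close>)
    next
      case False
      have "continuous_on (realized_simplex p \<sigma>) (\<lambda>_. 0::real)" by simp
      then show ?thesis by (rule continuous_on_eq) (use c False in \<open>simp add: coordinates_in_def\<close>)
    qed
  qed
  show ?thesis
    unfolding continuous_on_eq_continuous_within
  proof
    fix x assume x: "x \<in> P"
    then obtain U where U: "open U" "x \<in> U" "finite {\<sigma>\<in>K. realized_simplex p \<sigma> \<inter> U \<noteq> {}}"
      using realizationD(4) by blast
    let ?F = "{\<sigma>\<in>K. realized_simplex p \<sigma> \<inter> U \<noteq> {}}"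
    have "closed (realized_simplex p \<sigma>)" if "\<sigma> \<in> K" for \<sigma>
      unfolding realized_simplex_def
      by (intro compact_imp_closed finite_imp_compact_convex_hull finite_imageI simplexD(1)[OF that])
    then have "continuous_on (\<Union>\<sigma>\<in>?F. realized_simplex p \<sigma>) (\<lambda>x. coord x v)"
      using U(3) onK by (intro continuous_on_closed_Union) auto
    moreover have "P \<inter> U \<subseteq> (\<Union>\<sigma>\<in>?F. realized_simplex p \<sigma>)" by (auto simp: polyhedron_of_def)
    ultimately have "continuous_on (P \<inter> U) (\<lambda>x. coord x v)" by (rule continuous_on_subset)
    then have "continuous (at x within (P \<inter> U)) (\<lambda>x. coord x v)"
      using x U(2) by (simp add: continuous_on_eq_continuous_within)
    moreover have "at x within (P \<inter> U) = at x within P"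
      by (rule at_within_nhd[OF U(2,1)]) auto
    ultimately show "continuous (at x within P) (\<lambda>x. coord x v)" by simp
  qed
qed

section \<open>The dominant vertex and neighbourhoods that control it\<close>

definition top_vertex :: "'a \<Rightarrow> 'v" where
  "top_vertex x = (SOME v. \<forall>w. coord x w \<le> coord x v)"

lemma top_vertex:
  assumes "x \<in> P"
  shows "coord x w \<le> coord x (top_vertex x)" "top_vertex x \<in> car x"
proof -
  have fin: "finite (car x)" "car x \<noteq> {}" by (rule simplexD(1,2)[OF coord(1)[OF assms]])+
  have "Max (coord x ` car x) \<in> coord x ` car x" using fin by (intro Max_in) auto
  then obtain v where v: "v \<in> car x" "coord x v = Max (coord x ` car x)" by force
  have "coord x w \<le> coord x v" for w
  proof (cases "w \<in> car x")
    case True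
    then show ?thesis using fin v(2) by auto
  qed (use coord(3)[OF assms, of v] in auto)
  then have "\<exists>v. \<forall>w. coord x w \<le> coord x v" by blast
  from someI_ex[OF this] have max: "coord x w \<le> coord x (top_vertex x)" for w
    unfolding top_vertex_def by blast
  then show "coord x w \<le> coord x (top_vertex x)" .
  have "0 < coord x v" using v(1) coord(3)[OF assms, of v] by (auto simp: less_le)
  then show "top_vertex x \<in> car x" using max[of v] by auto
qed

text \<open>The cover by these sets plays the role of the cover by open stars in the classical
  simplicial approximation theorem.\<close>

definition small_nbhd :: "'a \<Rightarrow> 'a set" where
  "small_nbhd x = {y \<in> P. \<forall>v\<in>car x. \<bar>coord y v - coord x v\<bar> < Min (coord x ` car x) / (card (car x) + 1)}"

text \<open>Let \<open>k\<close> be the number of vertices of the carrier of \<open>x\<close>, m its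
  least coordinate there and e = m / (k + 1). For \<open>y\<close> in the set, the coordinates over
  this carrier sum to more than 1 - k e, so any other coordinate is below k e, while those over the
  carrier exceed m - e = k e. Hence the top vertex of \<open>y\<close> lies in the carrier of
  \<open>x\<close>, where all coordinates of \<open>y'\<close> are positive. The denominator
  \<open>k + 1\<close> makes the two bounds meet.\<close>

lemma small_nbhd:
  assumes x: "x \<in> P"
  shows "openin (top_of_set P) (small_nbhd x)" "x \<in> small_nbhd x"
    "y \<in> small_nbhd x \<Longrightarrow> y' \<in> small_nbhd x \<Longrightarrow> top_vertex y \<in> car y'"
proof -
  let ?S = "car x"
  define k where "k = card ?S"
  define e where "e = Min (coord x ` ?S) / (k + 1)"
  have fin: "finite ?S" "?S \<noteq> {}" by (rule simplexD(1,2)[OF coord(1)[OF x]])+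
  have pos: "0 < coord x v" if "v \<in> ?S" for v using that coord(3)[OF x, of v] by (auto simp: less_le)
  have "0 < Min (coord x ` ?S)" using fin pos by (subst Min_gr_iff) auto
  then have e: "0 < e" by (simp add: e_def)
  have ke: "(k + 1) * e \<le> coord x v" if "v \<in> ?S" for v
    using fin that by (simp add: e_def)
  have nb: "small_nbhd x = {y \<in> P. \<forall>v\<in>?S. \<bar>coord y v - coord x v\<bar> < e}"
    by (simp add: small_nbhd_def e_def k_def)
  show "x \<in> small_nbhd x" using e x by (simp add: nb)
  have "openin (top_of_set P) {y \<in> P. \<bar>coord y v - coord x v\<bar> < e}" for v
  proof -
    have "continuous_on P (\<lambda>y. \<bar>coord y v - coord x v\<bar>)" by (intro continuous_intros continuous_coord)
    then have "openin (top_of_set P) (P \<inter> (\<lambda>y. \<bar>coord y v - coord x v\<bar>) -` {..<e})"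
      by (rule continuous_openin_preimage_gen) simp
    moreover have "P \<inter> (\<lambda>y. \<bar>coord y v - coord x v\<bar>) -` {..<e} = {y \<in> P. \<bar>coord y v - coord x v\<bar> < e}" by auto
    ultimately show ?thesis by simp
  qed
  then have "openin (top_of_set P) (\<Inter>v\<in>?S. {y \<in> P. \<bar>coord y v - coord x v\<bar> < e})"
    using fin by (intro openin_INT2) auto
  also have "(\<Inter>v\<in>?S. {y \<in> P. \<bar>coord y v - coord x v\<bar> < e}) = small_nbhd x" using fin(2) by (auto simp: nb)
  finally show "openin (top_of_set P) (small_nbhd x)" .
  assume y: "y \<in> small_nbhd x" and y': "y' \<in> small_nbhd x"
  then have yP: "y \<in> P" "y' \<in> P" by (auto simp: nb)
  have cl: "coord x v - e < coord y v" "coord x v - e < coord y' v" if "v \<in> ?S" for v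
  proof -
    have "\<bar>coord y v - coord x v\<bar> < e" "\<bar>coord y' v - coord x v\<bar> < e" using y y' that by (auto simp: nb)
    then show "coord x v - e < coord y v" "coord x v - e < coord y' v" by linarith+
  qed
  let ?v = "top_vertex y"
  have "?v \<in> ?S"
  proof (rule ccontr)
    assume v: "?v \<notin> ?S"
    have "1 - k * e = (\<Sum>w\<in>?S. coord x w - e)"
      using coord_sum(1)[OF x fin(1)] by (simp add: sum_subtractf k_def)
    also have "\<dots> < (\<Sum>w\<in>?S. coord y w)" using fin cl by (intro sum_strict_mono) auto
    also have "coord y ?v + (\<Sum>w\<in>?S. coord y w) = (\<Sum>w\<in>insert ?v ?S. coord y w)" using fin v by simp
    also have "\<dots> \<le> (\<Sum>w\<in>insert ?v ?S \<union> car y. coord y w)"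
      using fin simplexD(1)[OF coord(1)[OF yP(1)]] coord(3)[OF yP(1)] by (intro sum_mono2) auto
    also have "\<dots> = 1" using fin simplexD(1)[OF coord(1)[OF yP(1)]] by (intro coord_sum(1)[OF yP(1)]) auto
    finally have "coord y ?v < k * e" by simp
    obtain w where w: "w \<in> ?S" using fin(2) by blast
    have "k * e \<le> coord x w - e" using ke[OF w] by (simp add: algebra_simps)
    also have "\<dots> < coord y w" by (rule cl(1)[OF w])
    also have "\<dots> \<le> coord y ?v" by (rule top_vertex(1)[OF yP(1)])
    finally show False using \<open>coord y ?v < k * e\<close> by simp
  qed
  then have "coord x ?v - e < coord y' ?v" "(k + 1) * e \<le> coord x ?v" using cl ke by auto
  moreover have "e \<le> (k + 1) * e" using e by (simp add: algebra_simps)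
  ultimately have "0 < coord y' ?v" by linarith
  then show "?v \<in> car y'" by simp
qed

lemma topspace_small_nbhd: "P \<subseteq> \<Union>(small_nbhd ` P)"
  using small_nbhd(2) by blast

definition linear_simplex :: "'v list \<Rightarrow> point \<Rightarrow> 'a" where
  "linear_simplex vs x = (\<Sum>i<length vs. x i *\<^sub>R p (vs ! i))"

text \<open>\<open>vs\<close> may repeat vertices, as labellings do, so the coordinate at a vertex
  collects all positions that carry it; being sums of nonnegative numbers these do not
  cancel.\<close>

lemma linear_simplex_coord:
  assumes "set vs \<in> K" "x \<in> standard_simplex (length vs - 1)"
  shows "linear_simplex vs x \<in> P" "car (linear_simplex vs x) = (!) vs ` {i. x i \<noteq> 0}"
proof -
  have ne: "vs \<noteq> []" using simplexD(2)[OF assms(1)] by auto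
  let ?c = "\<lambda>v. \<Sum>i | i < length vs \<and> vs ! i = v. x i"
  note sum1 = sum_standard_simplex[OF assms(2) ne]
  have group: "(\<Sum>v\<in>set vs. \<Sum>i | i < length vs \<and> vs ! i = v. f i) = (\<Sum>i<length vs. f i)" for f :: "nat \<Rightarrow> 'c::comm_monoid_add"
    using sum.group[of "{..<length vs}" "set vs" "(!) vs" f] by (simp add: image_subset_iff)
  have "coordinates_in (set vs) ?c (linear_simplex vs x)"
    unfolding coordinates_in_def
  proof (intro conjI allI impI)
    show "0 \<le> ?c v" for v using standard_simplexD(1)[OF assms(2)] by (simp add: sum_nonneg)
    show "?c v = 0" if "v \<notin> set vs" for v
      using that by (intro sum.neutral) auto
    show "sum ?c (set vs) = 1" using group[of x] sum1 by simp
    have "(\<Sum>v\<in>set vs. ?c v *\<^sub>R p v) = (\<Sum>v\<in>set vs. \<Sum>i | i < length vs \<and> vs ! i = v. x i *\<^sub>R p (vs ! i))"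
      by (simp add: scaleR_sum_left)
    then show "(\<Sum>v\<in>set vs. ?c v *\<^sub>R p v) = linear_simplex vs x"
      using group[of "\<lambda>i. x i *\<^sub>R p (vs ! i)"] by (simp add: linear_simplex_def)
  qed
  then have "linear_simplex vs x \<in> P" "coord (linear_simplex vs x) = ?c"
    using coordinates_in_P[OF assms(1)] coord_eq[OF assms(1)] by blast+
  then show "linear_simplex vs x \<in> P" by simp
  have "?c v \<noteq> 0 \<longleftrightarrow> (\<exists>i<length vs. vs ! i = v \<and> x i \<noteq> 0)" for v
    using standard_simplexD(1)[OF assms(2)] by (subst sum_nonneg_eq_0_iff) auto
  moreover have "i < length vs" if "x i \<noteq> 0" for i
    by (rule support_index[OF assms(2) ne that])
  ultimately show "car (linear_simplex vs x) = (!) vs ` {i. x i \<noteq> 0}"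
    using \<open>coord (linear_simplex vs x) = ?c\<close> by auto
qed

text \<open>Both ends lie in the closed simplex on the carrier of \<open>y\<close>, and coordinates
  there are affine along the segment. This keeps the straight-line homotopy inside carriers.\<close>

lemma segment_coord:
  assumes y: "y \<in> P" "z \<in> P" "car z \<subseteq> car y" and s: "0 \<le> s" "s \<le> 1"
  shows "(1 - s) *\<^sub>R y + s *\<^sub>R z \<in> P" "car ((1 - s) *\<^sub>R y + s *\<^sub>R z) \<subseteq> car y"
    "car ((1 - s) *\<^sub>R y + s *\<^sub>R z) \<noteq> {}"
proof -
  let ?c = "\<lambda>v. (1 - s) * coord y v + s * coord z v"
  have fin: "finite (car y)" using simplexD(1) coord(1)[OF y(1)] by blast
  have "coordinates_in (car y) ?c ((1 - s) *\<^sub>R y + s *\<^sub>R z)"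
    unfolding coordinates_in_def
  proof (intro conjI allI impI)
    show "0 \<le> ?c v" for v using s coord(3) y by simp
    show "?c v = 0" if "v \<notin> car y" for v using that y(3) by auto
    show "sum ?c (car y) = 1"
      using coord_sum(1)[OF y(1) fin] coord_sum(1)[OF y(2) fin y(3)] by (simp add: sum.distrib flip: sum_distrib_left)
    show "(\<Sum>v\<in>car y. ?c v *\<^sub>R p v) = (1 - s) *\<^sub>R y + s *\<^sub>R z"
      using coord_sum(2)[OF y(1) fin] coord_sum(2)[OF y(2) fin y(3)]
      by (simp add: scaleR_add_left sum.distrib flip: scaleR_scaleR scaleR_sum_right)
  qed
  then have "(1 - s) *\<^sub>R y + s *\<^sub>R z \<in> P" "coord ((1 - s) *\<^sub>R y + s *\<^sub>R z) = ?c" "{v. ?c v \<noteq> 0} \<subseteq> car y"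
    using coordinates_in_P[OF coord(1)[OF y(1)]] coord_eq[OF coord(1)[OF y(1)]] coordinates_in_support(2)[OF _ fin] by blast+
  moreover from this have "car ((1 - s) *\<^sub>R y + s *\<^sub>R z) \<noteq> {}" using coord(1) simplexD(2) by blast
  ultimately show "(1 - s) *\<^sub>R y + s *\<^sub>R z \<in> P" "car ((1 - s) *\<^sub>R y + s *\<^sub>R z) \<subseteq> car y"
    "car ((1 - s) *\<^sub>R y + s *\<^sub>R z) \<noteq> {}" by simp_all
qed

end

section \<open>Lists of weighted vertices\<close>

definition chain_weights :: "weight_type \<Rightarrow> nat set \<Rightarrow> bool" where
  "chain_weights t M \<longleftrightarrow> finite M \<and> (\<forall>a\<in>M. 0 < a) \<and> (\<forall>a\<in>M. \<forall>b\<in>M. weight_le t a b \<or> weight_le t b a)"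

text \<open>For pairwise comparable positive weights the numerical extremum is the largest one with
  respect to \<open>weight_le\<close>.\<close>

definition max_weight :: "weight_type \<Rightarrow> nat set \<Rightarrow> nat" where
  "max_weight t M = (case t of Ascending \<Rightarrow> Max M | Descending \<Rightarrow> Min M)"

lemma chain_weights_subset: "chain_weights t M \<Longrightarrow> N \<subseteq> M \<Longrightarrow> chain_weights t N"
  unfolding chain_weights_def by (meson finite_subset subsetD)

lemma max_weight:
  assumes "chain_weights t M" "M \<noteq> {}"
  shows "max_weight t M \<in> M" "a \<in> M \<Longrightarrow> weight_le t a (max_weight t M)"
proof -
  have fin: "finite M" using assms by (simp add: chain_weights_def)
  show in': "max_weight t M \<in> M"
    using fin assms(2) by (simp add: max_weight_def split: weight_type.split)
  assume a: "a \<in> M"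
  then have comp: "weight_le t a (max_weight t M) \<or> weight_le t (max_weight t M) a"
    and pos: "0 < a" "0 < max_weight t M"
    using assms(1) in' unfolding chain_weights_def by blast+
  show "weight_le t a (max_weight t M)"
  proof (cases t)
    case Ascending
    then have "a \<le> max_weight t M" using fin a by (simp add: max_weight_def)
    then show ?thesis using comp pos Ascending dvd_imp_le[of "max_weight t M" a] by (auto simp: weight_le_def)
  next
    case Descending
    then have "max_weight t M \<le> a" using fin a by (simp add: max_weight_def)
    then show ?thesis using comp pos Descending dvd_imp_le[of a "max_weight t M"] by (auto simp: weight_le_def)
  qed
qed

lemma max_weight_eq:
  assumes "chain_weights t M" "b \<in> M" "\<And>a. a \<in> M \<Longrightarrow> weight_le t a b"
  shows "max_weight t M = b"
  using max_weight[OF assms(1)] assms(2,3) by (metis empty_iff weight_le_antisym)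

lemma max_weight_mono:
  "chain_weights t M \<Longrightarrow> N \<subseteq> M \<Longrightarrow> N \<noteq> {} \<Longrightarrow> weight_le t (max_weight t N) (max_weight t M)"
  using max_weight(1)[of t N] max_weight(2)[of t M "max_weight t N"] chain_weights_subset by blast

lemma max_weight_barycentre:
  assumes "weight_function t D \<omega>" "l \<noteq> []" "set l \<subseteq> D" "chain_weights t (\<omega> ` set l)"
  shows "max_weight t (\<omega> ` set l) = \<omega> (barycentre l)"
proof -
  note u = uniform_point[OF lessThan_in_simplex_complex[OF assms(2)]]
  show ?thesis
  proof (rule max_weight_eq[OF assms(4)])
    obtain i where "uniform_point {..<length l} i \<noteq> 0" "\<omega> (barycentre l) = \<omega> (l ! i)"
      using weight_functionD(4)[OF assms(1-3) u(1)] unfolding barycentre_def by blast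
    moreover from this have "i < length l" using u(2) by auto
    ultimately show "\<omega> (barycentre l) \<in> \<omega> ` set l" by simp
    fix a assume "a \<in> \<omega> ` set l"
    then obtain i where "i < length l" "a = \<omega> (l ! i)" by (auto simp: in_set_conv_nth)
    then show "weight_le t a (\<omega> (barycentre l))"
      unfolding barycentre_def using weight_functionD(3)[OF assms(1-3) u(1), of i] u(2) by auto
  qed
qed

text \<open>For two points, the weight at their midpoint equals one of their weights and dominates
  both, so any two weights are comparable.\<close>

lemma chain_weights_weight_function:
  assumes "weight_function t D \<omega>" "finite S" "S \<subseteq> D"
  shows "chain_weights t (\<omega> ` S)"
  unfolding chain_weights_def
proof (intro conjI ballI)
  show "finite (\<omega> ` S)" using assms by simp
  show "0 < a" if "a \<in> \<omega> ` S" for a using that assms weight_function_pos by blast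
  fix a b assume "a \<in> \<omega> ` S" "b \<in> \<omega> ` S"
  then obtain x y where xy: "x \<in> D" "y \<in> D" "a = \<omega> x" "b = \<omega> y" using assms by blast
  let ?l = "[x, y]"
  have l: "?l \<noteq> []" "set ?l \<subseteq> D" using xy by auto
  note u = uniform_point[OF lessThan_in_simplex_complex[OF l(1)]]
  obtain i where i: "uniform_point {..<length ?l} i \<noteq> 0" "\<omega> (affine_map ?l (uniform_point {..<length ?l})) = \<omega> (?l ! i)"
    using weight_functionD(4)[OF assms(1) l u(1)] by blast
  have le: "weight_le t (\<omega> (?l ! k)) (\<omega> (?l ! i))" if "k < 2" for k
  proof -
    have "k \<in> {i. uniform_point {..<length ?l} i \<noteq> 0}" unfolding u(2) using that by simp
    then show ?thesis using weight_functionD(3)[OF assms(1) l u(1), of k] unfolding i(2) by blast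
  qed
  have "i \<in> {i. uniform_point {..<length ?l} i \<noteq> 0}" using i(1) by blast
  then have "i < 2" unfolding u(2) by simp
  then have "i = 0 \<or> i = 1" by auto
  then show "weight_le t a b \<or> weight_le t b a" using le[of 0] le[of 1] xy by auto
qed

locale triangulated = ordered_weighted_complex lt t K \<mu> + geometric_complex K p
  for lt :: "'v \<Rightarrow> 'v \<Rightarrow> bool" and t :: weight_type and K :: "'v set set" and \<mu> :: "'v set \<Rightarrow> nat"
    and p :: "'v \<Rightarrow> 'a::euclidean_space" +
  assumes divisible: "\<sigma> \<in> K \<Longrightarrow> \<exists>v\<in>\<sigma>. \<mu> \<sigma> = \<mu> {v}"
begin

abbreviation "wP \<equiv> polyhedron_weight K \<mu> p"
abbreviation "WS \<equiv> weighted_singular_simplices t (top_of_set P) wP"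

lemma wP: "x \<in> P \<Longrightarrow> wP x = \<mu> (car x)"
  by (simp add: polyhedron_weight_def carrier_simplex_eq)

lemma weight_mono: "\<sigma> \<in> K \<Longrightarrow> \<tau> \<subseteq> \<sigma> \<Longrightarrow> \<tau> \<noteq> {} \<Longrightarrow> weight_le t (\<mu> \<tau>) (\<mu> \<sigma>)"
  using is_weightD(2)[OF weight] simplexD(3) by blast

lemma vertex_chain: "\<sigma> \<in> K \<Longrightarrow> chain_weights t ((\<lambda>v. \<mu> {v}) ` \<sigma>)"
  unfolding chain_weights_def
proof (intro conjI ballI)
  assume \<sigma>: "\<sigma> \<in> K"
  show "finite ((\<lambda>v. \<mu> {v}) ` \<sigma>)" using simplexD(1)[OF \<sigma>] by simp
  show "0 < a" if a: "a \<in> (\<lambda>v. \<mu> {v}) ` \<sigma>" for a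
  proof -
    obtain v where "v \<in> \<sigma>" "a = \<mu> {v}" using a by blast
    then show ?thesis using is_weightD(1)[OF weight simplexD(3)[OF \<sigma>, of "{v}"]] by simp
  qed
  fix a b assume "a \<in> (\<lambda>v. \<mu> {v}) ` \<sigma>" "b \<in> (\<lambda>v. \<mu> {v}) ` \<sigma>"
  then obtain u v where uv: "u \<in> \<sigma>" "v \<in> \<sigma>" "a = \<mu> {u}" "b = \<mu> {v}" by blast
  have K2: "{u, v} \<in> K" using simplexD(3)[OF \<sigma>, of "{u, v}"] uv by simp
  have "weight_le t a (\<mu> {u, v})" "weight_le t b (\<mu> {u, v})"
    using weight_mono[OF K2, of "{u}"] weight_mono[OF K2, of "{v}"] uv by auto
  moreover have "\<mu> {u, v} = a \<or> \<mu> {u, v} = b" using divisible[OF K2] uv by blast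
  ultimately show "weight_le t a b \<or> weight_le t b a" by auto
qed

lemma max_weight_vertices:
  assumes "\<sigma> \<in> K" shows "max_weight t ((\<lambda>v. \<mu> {v}) ` \<sigma>) = \<mu> \<sigma>"
proof (rule max_weight_eq[OF vertex_chain[OF assms]])
  show "\<mu> \<sigma> \<in> (\<lambda>v. \<mu> {v}) ` \<sigma>" using divisible[OF assms] by blast
  show "weight_le t a (\<mu> \<sigma>)" if "a \<in> (\<lambda>v. \<mu> {v}) ` \<sigma>" for a
    using that weight_mono[OF assms] by auto
qed

text \<open>The pairs are vertices of \<open>K\<close> with the weight inherited from a corner of a
  singular simplex, which dominates \<open>\<mu> {v}\<close> but need not equal it. Requiring a
  single chain of both kinds of weights lets lists that mix inherited and own weights carry
  divisible weights.\<close>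

definition admissible :: "('v \<times> nat) set \<Rightarrow> bool" where
  "admissible S \<longleftrightarrow> fst ` S \<in> K \<and> chain_weights t (snd ` S \<union> (\<lambda>v. \<mu> {v}) ` fst ` S) \<and>
     (\<forall>x\<in>S. weight_le t (\<mu> {fst x}) (snd x))"

abbreviation "lift v \<equiv> (v, \<mu> {v})"

definition pair_weight :: "('v \<times> nat) list \<Rightarrow> nat" where
  "pair_weight l = max_weight t (snd ` set l)"

lemma admissible_chain: "admissible S \<Longrightarrow> chain_weights t (snd ` S)"
  unfolding admissible_def by (blast intro: chain_weights_subset)

lemma admissible_subset:
  assumes "admissible S" "T \<subseteq> S" "T \<noteq> {}"
  shows "admissible T"
proof -
  have "snd ` T \<union> (\<lambda>v. \<mu> {v}) ` fst ` T \<subseteq> snd ` S \<union> (\<lambda>v. \<mu> {v}) ` fst ` S" using assms(2) by blast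
  moreover have "fst ` T \<in> K"
    using simplexD(3)[of "fst ` S" "fst ` T"] assms by (auto simp: admissible_def)
  ultimately show ?thesis
    using assms chain_weights_subset unfolding admissible_def by blast
qed

text \<open>Lifts bring in only vertex weights, which are already part of the required
  chain.\<close>

lemma admissible_lift:
  assumes "admissible S" shows "admissible (S \<union> lift ` fst ` S)"
proof -
  have "snd ` (S \<union> lift ` fst ` S) \<union> (\<lambda>v. \<mu> {v}) ` fst ` (S \<union> lift ` fst ` S) = snd ` S \<union> (\<lambda>v. \<mu> {v}) ` fst ` S"
    "fst ` (S \<union> lift ` fst ` S) = fst ` S"
    by force+
  then show ?thesis using assms unfolding admissible_def by auto
qed

lemma list_weight_pair: "admissible S \<Longrightarrow> list_weight t pair_weight S"
  unfolding list_weight_def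
proof (intro allI impI)
  fix m m' :: "('v \<times> nat) list"
  assume S: "admissible S" and m: "m \<noteq> []" "set m \<subseteq> set m'" "set m' \<subseteq> S"
  have ch: "chain_weights t (snd ` set m')"
    by (rule chain_weights_subset[OF admissible_chain[OF S]]) (use m in auto)
  then have ch': "chain_weights t (snd ` set m)" by (rule chain_weights_subset) (use m in auto)
  have "pair_weight m \<in> snd ` set m" unfolding pair_weight_def by (rule max_weight(1)[OF ch']) (use m in simp)
  then have "0 < pair_weight m" using ch' by (auto simp: chain_weights_def)
  moreover have "weight_le t (pair_weight m) (pair_weight m')"
    unfolding pair_weight_def by (rule max_weight_mono[OF ch]) (use m in auto)
  ultimately show "0 < pair_weight m \<and> weight_le t (pair_weight m) (pair_weight m')" ..
qed

text \<open>The weight of the simplex is attained at one of its vertices, and each pair carries at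
  least the weight of its vertex.\<close>

lemma vertex_le_pair_weight:
  assumes "admissible (set l)" "l \<noteq> []"
  shows "weight_le t (\<mu> (fst ` set l)) (pair_weight l)"
proof -
  obtain v where v: "v \<in> fst ` set l" "\<mu> (fst ` set l) = \<mu> {v}"
    using divisible[of "fst ` set l"] assms(1) unfolding admissible_def by blast
  then obtain x where x: "x \<in> set l" "v = fst x" by blast
  have "chain_weights t (snd ` set l)" by (rule admissible_chain[OF assms(1)])
  then have "weight_le t (snd x) (pair_weight l)" unfolding pair_weight_def using x by (intro max_weight(2)) auto
  moreover have "weight_le t (\<mu> {v}) (snd x)" using assms(1) x by (auto simp: admissible_def)
  ultimately show ?thesis unfolding v(2) by (rule weight_le_trans[rotated])
qed

lemma pair_weight_lift: "set vs \<in> K \<Longrightarrow> pair_weight (map lift vs) = vweight vs"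
  unfolding pair_weight_def using max_weight_vertices[of "set vs"] by (simp add: image_image)

lemma admissible_lift_simplex: "\<sigma> \<in> K \<Longrightarrow> admissible (lift ` \<sigma>)"
  using vertex_chain by (auto simp: admissible_def image_image)

subsection \<open>Linear weighted singular simplices\<close>

definition pair_face_weight :: "('v \<times> nat) list \<Rightarrow> nat set \<Rightarrow> nat" where
  "pair_face_weight l T = max_weight t ((\<lambda>i. snd (l ! i)) ` T)"

definition pair_simplex :: "('v \<times> nat) list \<Rightarrow> 'a wsimplex" where
  "pair_simplex l = (restrict (pair_face_weight l) (simplex_complex (length l - 1)),
     restrict (linear_simplex (map fst l)) (standard_simplex (length l - 1)))"

lemma pair_face_chain:
  assumes "admissible (set l)" "T \<subseteq> {..<length l}"
  shows "chain_weights t ((\<lambda>i. snd (l ! i)) ` T)"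
  by (rule chain_weights_subset[of _ "snd ` set l \<union> (\<lambda>v. \<mu> {v}) ` fst ` set l"])
     (use assms in \<open>auto simp: admissible_def intro!: UnI1\<close>)

lemma weight_function_pair:
  assumes "admissible (set l)" "length l = Suc n"
  shows "weight_function t (standard_simplex n) (simplex_weight (pair_face_weight l))"
proof (rule weight_function_simplex_weight)
  have ch: "chain_weights t ((\<lambda>i. snd (l ! i)) ` T)" if "T \<in> simplex_complex n" for T
    using that pair_face_chain[OF assms(1), of T] assms(2) by (auto simp: simplex_complex_def lessThan_Suc_atMost)
  have att: "\<exists>i\<in>T. pair_face_weight l T = pair_face_weight l {i}" if T: "T \<in> simplex_complex n" for T
  proof -
    have "T \<noteq> {}" using T by (simp add: simplex_complex_def)
    then have "pair_face_weight l T \<in> (\<lambda>i. snd (l ! i)) ` T"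
      unfolding pair_face_weight_def by (intro max_weight(1)[OF ch[OF T]]) simp
    then obtain i where i: "i \<in> T" "pair_face_weight l T = snd (l ! i)" by blast
    have "pair_face_weight l {i} = snd (l ! i)"
      by (simp add: pair_face_weight_def max_weight_def split: weight_type.split)
    then show ?thesis using i by (intro bexI[of _ i]) simp_all
  qed
  have "0 < pair_face_weight l T" if "T \<in> simplex_complex n" for T
    using max_weight(1)[OF ch[OF that]] ch[OF that] that unfolding pair_face_weight_def chain_weights_def simplex_complex_def by blast
  moreover have "weight_le t (pair_face_weight l T') (pair_face_weight l T)"
    if "T \<in> simplex_complex n" "T' \<in> simplex_complex n" "T' \<subseteq> T" for T T'
    unfolding pair_face_weight_def by (rule max_weight_mono[OF ch[OF that(1)]]) (use that in \<open>auto simp: simplex_complex_def\<close>)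
  ultimately have "is_weight t (simplex_complex n) (pair_face_weight l)"
    unfolding is_weight_def weight_le_def by blast
  moreover have "abs_simplicial_complex (simplex_complex n)"
    by (auto simp: abs_simplicial_complex_def simplex_complex_def intro: finite_subset)
  ultimately show "divisibly_weighted t (simplex_complex n) (pair_face_weight l)"
    using att by (simp add: divisibly_weighted_iff weighted_complex_def)
qed

lemma linear_simplex_affine_map:
  assumes "set is \<subseteq> {..<length vs}"
  shows "linear_simplex vs (affine_map (map simplex_vertex is) x) = linear_simplex (map ((!) vs) is) x"
proof -
  have "linear_simplex vs (affine_map (map simplex_vertex is) x)
      = (\<Sum>k<length vs. \<Sum>i<length is. (x i * simplex_vertex (is ! i) k) *\<^sub>R p (vs ! k))"
    by (simp add: linear_simplex_def affine_map_def scaleR_sum_left)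
  also have "\<dots> = (\<Sum>i<length is. \<Sum>k<length vs. (x i * simplex_vertex (is ! i) k) *\<^sub>R p (vs ! k))"
    by (rule sum.swap)
  also have "\<dots> = (\<Sum>i<length is. x i *\<^sub>R p (vs ! (is ! i)))"
  proof (rule sum.cong[OF refl])
    fix i assume "i \<in> {..<length is}"
    then have "is ! i < length vs" using assms nth_mem by blast
    then show "(\<Sum>k<length vs. (x i * simplex_vertex (is ! i) k) *\<^sub>R p (vs ! k)) = x i *\<^sub>R p (vs ! (is ! i))"
      by (simp add: simplex_vertex_def if_distrib[of "\<lambda>a. _ * a"] if_distrib[of "\<lambda>a. a *\<^sub>R _"] sum.delta cong: if_cong)
  qed
  finally show ?thesis by (simp add: linear_simplex_def)
qed

lemma support_affine_map_vertices:
  assumes "is \<noteq> []" "x \<in> standard_simplex (length is - 1)"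
  shows "{k. affine_map (map simplex_vertex is) x k \<noteq> 0} = (!) is ` {i. x i \<noteq> 0}"
proof -
  obtain n where n: "set is \<subseteq> {..n}" using finite_nat_set_iff_bounded_le[of "set is"] by auto
  have "set (map simplex_vertex is) \<subseteq> standard_simplex n"
    using n by (auto simp: simplex_vertex_def)
  from support_affine_map[OF _ this] assms
  have "{k. affine_map (map simplex_vertex is) x k \<noteq> 0} = (\<Union>i\<in>{i. x i \<noteq> 0}. {k. (map simplex_vertex is ! i) k \<noteq> 0})" by simp
  also have "\<dots> = (\<Union>i\<in>{i. x i \<noteq> 0}. {is ! i})"
  proof (rule SUP_cong[OF refl])
    fix i assume "i \<in> {i. x i \<noteq> 0}"
    then have "i < length is" using support_index[OF assms(2,1)] by simp
    then show "{k. (map simplex_vertex is ! i) k \<noteq> 0} = {is ! i}" by (auto simp: simplex_vertex_def)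
  qed
  finally show ?thesis by auto
qed

text \<open>Faces of a linear simplex are handled through lists of indices, so that
  \<open>list_bd\<close> of \<open>[0..<Suc n]\<close> serves for all of them.\<close>

lemma affine_piece_pair:
  assumes "is \<noteq> []" "set is \<subseteq> {..<length l}"
  shows "affine_piece (linear_simplex (map fst l)) (simplex_weight (pair_face_weight l)) (map simplex_vertex is)
       = pair_simplex (map ((!) l) is)"
proof -
  have "simplex_weight (pair_face_weight l) (affine_map (map simplex_vertex is) (uniform_point T)) = pair_face_weight (map ((!) l) is) T"
    if T: "T \<in> simplex_complex (length is - 1)" for T
  proof -
    have "T \<subseteq> {..<length is}" using T assms(1) by (cases "is") (auto simp: simplex_complex_def)
    then have "(\<lambda>i. snd (l ! i)) ` (!) is ` T = (\<lambda>i. snd (map ((!) l) is ! i)) ` T" by force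
    then show ?thesis
      using support_affine_map_vertices[OF assms(1) uniform_point(1)[OF T]] uniform_point(2)[OF T]
      by (simp add: simplex_weight_def pair_face_weight_def)
  qed
  moreover have "linear_simplex (map fst l) (affine_map (map simplex_vertex is) x) = linear_simplex (map fst (map ((!) l) is)) x" for x
  proof -
    have "map ((!) (map fst l)) is = map fst (map ((!) l) is)" using assms(2) by (auto simp: subset_iff)
    then show ?thesis using linear_simplex_affine_map[of "is" "map fst l" x] assms(2) by (simp del: map_map)
  qed
  ultimately show ?thesis
    unfolding affine_piece_def pair_simplex_def by (auto intro!: restrict_ext)
qed

lemma simplex_vertices_map: "simplex_vertices n = map simplex_vertex [0..<Suc n]"
  by (simp add: simplex_vertices_def)

lemma map_nth_upt: "length l = Suc n \<Longrightarrow> map ((!) l) [0..<Suc n] = l"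
  by (metis map_nth)

lemma pair_simplex_eq:
  assumes "length l = Suc n"
  shows "pair_simplex l = affine_piece (linear_simplex (map fst l)) (simplex_weight (pair_face_weight l)) (simplex_vertices n)"
proof -
  have "set [0..<Suc n] \<subseteq> {..<length l}" using assms by auto
  from affine_piece_pair[OF _ this] show ?thesis
    unfolding simplex_vertices_map map_nth_upt[OF assms] by simp
qed

lemma continuous_linear_simplex: "continuous_on D (linear_simplex vs)"
  unfolding linear_simplex_def
  by (intro continuous_intros continuous_on_product_coordinates continuous_on_subset[OF _ subset_UNIV])

lemma simplex_topology: "subtopology (powertop_real UNIV) D = top_of_set D"
  by (simp add: euclidean_product_topology)

lemma continuous_linear_simplex_P:
  assumes "set vs \<in> K" "length vs = Suc n"
  shows "continuous_map (subtopology (powertop_real UNIV) (standard_simplex n)) (top_of_set P) (linear_simplex vs)"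
  unfolding simplex_topology continuous_map_subtopology_eu image_subset_iff_funcset[symmetric]
  using continuous_linear_simplex linear_simplex_coord(1)[OF assms(1)] assms(2) by auto

lemma pair_simplex_singular:
  assumes "admissible (set l)" "length l = Suc n"
  shows "pair_simplex l \<in> WS n"
proof -
  have K: "set (map fst l) \<in> K" using assms by (simp add: admissible_def)
  have "affine_piece (linear_simplex (map fst l)) (simplex_weight (pair_face_weight l)) (simplex_vertices n) \<in> WS (length (simplex_vertices n) - 1)"
  proof (rule affine_piece_singular[OF weight_function_pair[OF assms] _ set_simplex_vertices])
    show "continuous_map (subtopology (powertop_real UNIV) (standard_simplex n)) (top_of_set P) (linear_simplex (map fst l))"
      using continuous_linear_simplex_P[OF K] assms(2) by simp
    fix z assume z: "z \<in> standard_simplex n"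
    let ?T = "{i. z i \<noteq> 0}"
    have T: "?T \<subseteq> {..<length l}" "?T \<noteq> {}"
      using support_in_simplex_complex[OF z] assms(2) by (auto simp: simplex_complex_def lessThan_Suc_atMost)
    \<comment> \<open>The pairs over the support of \<open>z\<close> form an admissible list of
      their own: its weight is the weight at \<open>z\<close>, and its vertices are the carrier of
      the image.\<close>
    let ?m = "map ((!) l) (sorted_list_of_set ?T)"
    have fin: "finite ?T" using T(1) finite_subset by blast
    have m: "set ?m = (!) l ` ?T" "?m \<noteq> []" using fin T(2) by auto
    have "set ?m \<subseteq> set l" using m(1) T(1) by auto
    then have adm: "admissible (set ?m)" using admissible_subset[OF assms(1)] m(2) by (metis set_empty)
    have "linear_simplex (map fst l) z \<in> P" "car (linear_simplex (map fst l) z) = (!) (map fst l) ` ?T"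
      using linear_simplex_coord[OF K, of z] z assms(2) by auto
    moreover have "(!) (map fst l) ` ?T = fst ` set ?m" using m(1) T(1) by (auto simp: image_image intro!: image_cong)
    moreover have "pair_weight ?m = simplex_weight (pair_face_weight l) z"
      unfolding pair_weight_def m(1) simplex_weight_def pair_face_weight_def by (simp add: image_image)
    ultimately show "weight_le t (wP (linear_simplex (map fst l) z)) (simplex_weight (pair_face_weight l) z)"
      using vertex_le_pair_weight[OF adm m(2)] by (simp add: wP)
  qed simp
  then show ?thesis using pair_simplex_eq[OF assms(2)] by simp
qed

lemma pair_weight_barycentre:
  assumes "is \<noteq> []" "set is \<subseteq> {..<length l}"
  shows "simplex_weight (pair_face_weight l) (barycentre (map simplex_vertex is)) = pair_weight (map ((!) l) is)"
proof -
  note u = uniform_point[OF lessThan_in_simplex_complex[OF assms(1)]]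
  have "(!) is ` {..<length is} = set is" by (auto simp: in_set_conv_nth)
  then show ?thesis
    using support_affine_map_vertices[OF assms(1) u(1)] u(2)
    by (simp add: simplex_weight_def pair_face_weight_def pair_weight_def barycentre_def image_image)
qed

lemma wbd_pair_simplex:
  assumes "admissible (set l)" "length l = Suc n" "0 < n"
  shows "weighted_singular_boundary t n (frag_of (pair_simplex l))
       = weighted t pair_weight (\<lambda>m. frag_of (pair_simplex m)) (pair_weight l) (list_bd l)"
proof -
  let ?g = "linear_simplex (map fst l)" and ?\<omega> = "simplex_weight (pair_face_weight l)"
  have ml: "map ((!) l) [0..<Suc n] = l" by (rule map_nth_upt[OF assms(2)])
  have "weighted_singular_boundary t n (frag_of (pair_simplex l)) = piece_chain t ?g ?\<omega> (?\<omega> (barycentre (simplex_vertices n))) (list_bd (simplex_vertices n))"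
    unfolding pair_simplex_eq[OF assms(2)] by (rule boundary_affine_piece) (use assms in auto)
  also have "?\<omega> (barycentre (simplex_vertices n)) = pair_weight l"
    unfolding simplex_vertices_map using pair_weight_barycentre[of "[0..<Suc n]" l] assms(2) ml by (simp add: atLeast0LessThan del: upt_Suc)
  also have "piece_chain t ?g ?\<omega> (pair_weight l) (list_bd (simplex_vertices n))
     = weighted t (\<lambda>is. ?\<omega> (barycentre (map simplex_vertex is))) (\<lambda>is. frag_of (affine_piece ?g ?\<omega> (map simplex_vertex is))) (pair_weight l) (list_bd [0..<Suc n])"
    unfolding simplex_vertices_map frag_image_map_list_bd[symmetric] weighted_image ..
  also have "\<dots> = weighted t (\<lambda>is. pair_weight (map ((!) l) is)) (\<lambda>is. frag_of (pair_simplex (map ((!) l) is))) (pair_weight l) (list_bd [0..<Suc n])"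
  proof (rule weighted_cong)
    fix "is" assume k: "is \<in> Poly_Mapping.keys (list_bd [0..<Suc n])"
    have "is \<noteq> []" "set is \<subseteq> {..<length l}" using list_bd_keysD[OF k] assms by auto
    then show "?\<omega> (barycentre (map simplex_vertex is)) = pair_weight (map ((!) l) is) \<and>
       frag_of (affine_piece ?g ?\<omega> (map simplex_vertex is)) = frag_of (pair_simplex (map ((!) l) is))"
      using pair_weight_barycentre affine_piece_pair by simp
  qed
  also have "\<dots> = weighted t pair_weight (\<lambda>m. frag_of (pair_simplex m)) (pair_weight l) (list_bd l)"
    using weighted_image[of t pair_weight "\<lambda>m. frag_of (pair_simplex m)" "pair_weight l" "map ((!) l)" "list_bd [0..<Suc n]"]
    unfolding frag_image_map_list_bd ml by simp
  finally show ?thesis .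
qed

text \<open>The comparison map on generators: a simplex of \<open>K\<close> as a linear singular
  simplex with the weights of \<open>K\<close>.\<close>

definition simplex_of :: "'v list \<Rightarrow> 'a wsimplex" where
  "simplex_of vs = pair_simplex (map lift vs)"

lemma wbd_simplex_of:
  assumes "set vs \<in> K" "length vs = Suc n" "0 < n"
  shows "weighted_singular_boundary t n (frag_of (simplex_of vs)) = frag_image simplex_of (weighted_bd t vweight vs)"
proof -
  have adm: "admissible (set (map lift vs))" using admissible_lift_simplex[OF assms(1)] by simp
  have "weighted_singular_boundary t n (frag_of (simplex_of vs))
    = weighted t pair_weight (\<lambda>m. frag_of (pair_simplex m)) (vweight vs) (frag_image (map lift) (list_bd vs))"
    unfolding simplex_of_def frag_image_map_list_bd pair_weight_lift[OF assms(1), symmetric]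
    by (rule wbd_pair_simplex[OF adm]) (use assms in auto)
  also have "\<dots> = weighted t (\<lambda>m. pair_weight (map lift m)) (\<lambda>m. frag_of (simplex_of m)) (vweight vs) (list_bd vs)"
    by (simp add: weighted_image simplex_of_def)
  also have "\<dots> = weighted t vweight (\<lambda>m. frag_of (simplex_of m)) (vweight vs) (list_bd vs)"
  proof (rule weighted_cong)
    fix m assume m: "m \<in> Poly_Mapping.keys (list_bd vs)"
    have "m \<noteq> []" "set m \<subseteq> set vs" using list_bd_keysD[OF m] assms by auto
    then have "set m \<in> K" using simplexD(3)[OF assms(1)] by simp
    then show "pair_weight (map lift m) = vweight m \<and> frag_of (simplex_of m) = frag_of (simplex_of m)"
      by (simp add: pair_weight_lift)
  qed
  also have "\<dots> = frag_image simplex_of (weighted_bd t vweight vs)"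
    by (simp add: weighted_bd_def frag_image_weighted_frag_of)
  finally show ?thesis .
qed

lemma simplex_of_singular: "set vs \<in> K \<Longrightarrow> length vs = Suc n \<Longrightarrow> simplex_of vs \<in> WS n"
  unfolding simplex_of_def using admissible_lift_simplex by (intro pair_simplex_singular) simp_all

subsection \<open>Orienting lists of weighted vertices\<close>

text \<open>Projects a list of weighted vertices to simplicial chains; the coefficient is the ratio
  of the inherited weight to the weight in \<open>K\<close>, and degenerate lists go to 0.\<close>

definition orient :: "('v \<times> nat) list \<Rightarrow> ('v list \<Rightarrow>\<^sub>0 int)" where
  "orient l = weighted t vweight frag_of (pair_weight l) (sort_alt (map fst l))"

lemma keys_orient:
  assumes "length l = Suc n" "fst ` set l \<in> K"
  shows "Poly_Mapping.keys (orient l) \<subseteq> sorted_simplices n"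
  unfolding orient_def
  by (rule keys_weighted) (use keys_sort_alt[of "map fst l"] assms in \<open>auto simp: keys_frag_of sorted_simplices_def\<close>)

lemma orient_bd:
  assumes "admissible (set l)" "2 \<le> length l"
  shows "frag_extend orient (weighted_bd t pair_weight l) = vbd (orient l)"
proof -
  have "weight_le t (\<mu> (fst ` set m)) (pair_weight m)" if "m \<noteq> []" "set m \<subseteq> set l" for m
    by (rule vertex_le_pair_weight[OF admissible_subset[OF assms(1) that(2)] that(1)]) (use that in simp)
  then show ?thesis
    unfolding orient_def[abs_def]
    by (intro weighted_normalize_bd list_weight_pair) (use assms in \<open>auto simp: admissible_def\<close>)
qed

text \<open>The chain map sorts the vertices alternatingly and resets each weight to that of
  \<open>K\<close>. The formula for the cone holds for any apex; choosing the head of the list keeps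
  the homotopy within the simplex and its admissible set.\<close>

abbreviation "lift_sort l \<equiv> frag_image (map lift) (sort_alt (map fst l))"
abbreviation "orient_cone \<equiv> cone_htpy hd lift_sort"

definition orient_htpy :: "('v \<times> nat) list \<Rightarrow> ('a wsimplex \<Rightarrow>\<^sub>0 int)" where
  "orient_htpy l = weighted t pair_weight (\<lambda>m. frag_of (pair_simplex m)) (pair_weight l) (orient_cone l)"

lemma keys_orient_cone:
  "Poly_Mapping.keys (orient_cone l) \<subseteq> {m. length m = Suc (length l) \<and> set m \<subseteq> set l \<union> lift ` fst ` set l}"
proof (rule keys_cone_htpy)
  let ?D = "set l \<union> lift ` fst ` set l"
  show "hd m \<in> ?D" if "m \<noteq> []" "set m \<subseteq> ?D" for m using that by (cases m) auto
  fix m assume m: "set m \<subseteq> ?D"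
  have fD: "fst ` ?D = fst ` set l" by force
  have fm: "fst ` set m \<subseteq> fst ` set l" using image_mono[OF m, of fst] unfolding fD .
  show "Poly_Mapping.keys (lift_sort m) \<subseteq> {m'. length m' = length m \<and> set m' \<subseteq> ?D}"
  proof
    fix y assume "y \<in> Poly_Mapping.keys (lift_sort m)"
    then obtain x where x: "x \<in> Poly_Mapping.keys (sort_alt (map fst m))" "y = map lift x" by (elim keys_frag_imageE) blast
    then have "set x = fst ` set m" "length x = length m" using keys_sort_alt[of "map fst m"] by auto
    then show "y \<in> {m'. length m' = length m \<and> set m' \<subseteq> ?D}" using x(2) fm by auto
  qed
qed auto

lemma wbd_pair_chain:
  assumes "admissible S" "0 < a" "0 < n" "Poly_Mapping.keys c \<subseteq> {m. length m = Suc n \<and> set m \<subseteq> S}"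
    and "\<And>m. m \<in> Poly_Mapping.keys c \<Longrightarrow> weight_le t (pair_weight m) a"
  shows "weighted_singular_boundary t n (weighted t pair_weight (\<lambda>m. frag_of (pair_simplex m)) a c)
    = weighted t pair_weight (\<lambda>m. frag_of (pair_simplex m)) a (list_chain_bd c)"
  unfolding weighted_singular_boundary_def
proof (rule frag_extend_weighted_weighted[OF assms(2)])
  note lw = list_weight_pair[OF assms(1)]
  fix m assume m: "m \<in> Poly_Mapping.keys c"
  then have m': "length m = Suc n" "set m \<subseteq> S" using assms(4) by auto
  then have ne: "m \<noteq> []" by auto
  show "0 < pair_weight m \<and> weight_le t (pair_weight m) a"
    using list_weightD(1)[OF lw ne m'(2)] assms(5)[OF m] by simp
  have "admissible (set m)" using admissible_subset[OF assms(1) m'(2)] ne by simp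
  from wbd_pair_simplex[OF this m'(1) assms(3)]
  show "frag_extend (\<lambda>(\<xi>, \<theta>). \<Sum>j\<le>n. frag_cmul ((- 1) ^ j * weight_coeff t \<xi> {..n} ({..n} - {j}))
      (frag_of (weighted_singular_face n j (\<xi>, \<theta>)))) (frag_of (pair_simplex m))
     = weighted t pair_weight (\<lambda>m. frag_of (pair_simplex m)) (pair_weight m) (list_bd m)"
    unfolding weighted_singular_boundary_def .
  fix y assume y: "y \<in> Poly_Mapping.keys (list_bd m)"
  have "y \<noteq> []" "set y \<subseteq> set m" using list_bd_keysD[OF y] m'(1) assms(3) by auto
  then show "0 < pair_weight y \<and> weight_le t (pair_weight y) (pair_weight m)"
    using list_weightD(1)[OF lw, of y] list_weightD(2)[OF lw, of y m] m'(2) by auto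
qed

text \<open>A lift has the weight of its vertex, which is dominated by the pair it came from; so
  neither sorting nor coning exceeds the weight of \<open>l\<close>.\<close>

lemma pair_weight_cone:
  assumes l: "admissible (set l)" "l \<noteq> []" and m: "m \<noteq> []" "set m \<subseteq> set l \<union> lift ` fst ` set l"
  shows "0 < pair_weight m" "weight_le t (pair_weight m) (pair_weight l)"
proof -
  let ?S = "set l \<union> lift ` fst ` set l"
  have S: "admissible ?S" by (rule admissible_lift[OF l(1)])
  note lw = list_weight_pair[OF S]
  show "0 < pair_weight m" by (rule list_weightD(1)[OF lw m])
  have ch: "chain_weights t (snd ` ?S)" by (rule admissible_chain[OF S])
  have chl: "chain_weights t (snd ` set l)" by (rule chain_weights_subset[OF ch]) auto
  have le: "weight_le t a (pair_weight l)" if "a \<in> snd ` ?S" for a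
  proof -
    have "\<exists>x\<in>set l. weight_le t a (snd x)"
    proof (cases "a \<in> snd ` set l")
      case False
      then have "a \<in> (\<lambda>x. \<mu> {fst x}) ` set l" using that by force
      then obtain x where "x \<in> set l" "a = \<mu> {fst x}" by blast
      then show ?thesis using l(1) unfolding admissible_def by blast
    qed (use weight_le_refl in blast)
    then obtain x where x: "x \<in> set l" "weight_le t a (snd x)" by blast
    have "weight_le t (snd x) (pair_weight l)" unfolding pair_weight_def using x(1) by (intro max_weight(2)[OF chl]) auto
    with x(2) show ?thesis by (rule weight_le_trans)
  qed
  have "pair_weight m \<in> snd ` set m"
    unfolding pair_weight_def by (rule max_weight(1)[OF chain_weights_subset[OF ch]]) (use m in auto)
  then have "pair_weight m \<in> snd ` ?S" using m(2) by blast
  then show "weight_le t (pair_weight m) (pair_weight l)" by (rule le)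
qed

text \<open>\<open>orient_cone\<close> joins the identity to \<open>lift_sort\<close>; realized with
  weights, the latter is \<open>simplex_of\<close> applied to \<open>orient\<close>.\<close>

lemma wbd_orient_htpy:
  assumes l: "admissible (set l)" "length l = Suc n"
  shows "weighted_singular_boundary t (Suc n) (orient_htpy l) = frag_of (pair_simplex l) - frag_image simplex_of (orient l)
     - (if n = 0 then 0 else frag_extend orient_htpy (weighted_bd t pair_weight l))"
proof -
  let ?W = "weighted t pair_weight (\<lambda>m. frag_of (pair_simplex m)) (pair_weight l)"
  let ?S = "set l \<union> lift ` fst ` set l"
  have ne: "l \<noteq> []" using l by auto
  have pos: "0 < pair_weight l" using pair_weight_cone(1)[OF l(1) ne ne] by blast
  have cm: "list_chain_bd (lift_sort m) = frag_extend lift_sort (list_bd m)" for m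
  proof -
    have "list_chain_bd (lift_sort m) = frag_image (map lift) (frag_extend sort_alt (list_bd (map fst m)))"
      by (simp add: list_chain_bd_sort_alt flip: frag_image_map_list_chain_bd)
    then show ?thesis by (simp add: frag_image_extend frag_extend_image flip: frag_image_map_list_bd)
  qed
  have "weighted_singular_boundary t (Suc n) (orient_htpy l) = ?W (list_chain_bd (orient_cone l))"
    unfolding orient_htpy_def
  proof (rule wbd_pair_chain[OF admissible_lift[OF l(1)] pos])
    show "Poly_Mapping.keys (orient_cone l) \<subseteq> {m. length m = Suc (Suc n) \<and> set m \<subseteq> ?S}" using keys_orient_cone[of l] l(2) by simp
    fix m assume "m \<in> Poly_Mapping.keys (orient_cone l)"
    then have "m \<noteq> []" "set m \<subseteq> ?S" using keys_orient_cone[of l] by auto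
    then show "weight_le t (pair_weight m) (pair_weight l)" by (rule pair_weight_cone(2)[OF l(1) ne])
  qed simp
  also have "\<dots> = ?W (frag_of l) - ?W (lift_sort l) - ?W (frag_extend orient_cone (list_bd l))"
    by (simp add: list_chain_bd_cone_htpy[of lift_sort, OF cm] del: weighted_simps(2))
  also have "?W (frag_of l) = frag_of (pair_simplex l)" using pos by simp
  also have "?W (lift_sort l) = frag_image simplex_of (orient l)"
  proof -
    have "?W (lift_sort l) = weighted t (\<lambda>m. pair_weight (map lift m)) (\<lambda>m. frag_of (simplex_of m)) (pair_weight l) (sort_alt (map fst l))"
      by (simp add: weighted_image simplex_of_def)
    also have "\<dots> = weighted t vweight (\<lambda>m. frag_of (simplex_of m)) (pair_weight l) (sort_alt (map fst l))"
    proof (rule weighted_cong)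
      fix m assume "m \<in> Poly_Mapping.keys (sort_alt (map fst l))"
      then have "set m \<in> K" using keys_sort_alt[of "map fst l"] l(1) by (auto simp: admissible_def)
      then show "pair_weight (map lift m) = vweight m \<and> frag_of (simplex_of m) = frag_of (simplex_of m)" by (simp add: pair_weight_lift)
    qed
    also have "\<dots> = frag_image simplex_of (orient l)" unfolding orient_def by (rule frag_image_weighted_frag_of[symmetric])
    finally show ?thesis .
  qed
  also have "?W (frag_extend orient_cone (list_bd l)) = (if n = 0 then 0 else frag_extend orient_htpy (weighted_bd t pair_weight l))"
  proof (cases "n = 0")
    case True
    then obtain x where "l = [x]" using l(2) by (cases l) auto
    \<comment> \<open>The only face is the empty list, on which the cone homotopy is 0.\<close>
    then show ?thesis using True by simp
  next
    case False
    have "frag_extend orient_htpy (weighted_bd t pair_weight l) = ?W (frag_extend orient_cone (list_bd l))"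
      unfolding weighted_bd_def
    proof (rule frag_extend_weighted_weighted[OF pos])
      fix m assume m: "m \<in> Poly_Mapping.keys (list_bd l)"
      then have m': "m \<noteq> []" "set m \<subseteq> set l" using list_bd_keysD[OF m] l False by auto
      show "0 < pair_weight m \<and> weight_le t (pair_weight m) (pair_weight l)"
        using pair_weight_cone[OF l(1) ne m'(1)] m'(2) by blast
      show "frag_extend orient_htpy (frag_of m) = weighted t pair_weight (\<lambda>m. frag_of (pair_simplex m)) (pair_weight m) (orient_cone m)"
        by (simp add: orient_htpy_def)
      fix y assume "y \<in> Poly_Mapping.keys (orient_cone m)"
      then have y: "y \<noteq> []" "set y \<subseteq> set m \<union> lift ` fst ` set m" using keys_orient_cone[of m] by auto
      have "admissible (set m)" using admissible_subset[OF l(1) m'(2)] m'(1) by simp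
      then show "0 < pair_weight y \<and> weight_le t (pair_weight y) (pair_weight m)"
        using pair_weight_cone[OF _ m'(1) y] by simp
    qed
    with False show ?thesis by simp
  qed
  finally show ?thesis .
qed

lemma keys_orient_htpy:
  assumes l: "admissible (set l)" "length l = Suc n"
  shows "Poly_Mapping.keys (orient_htpy l) \<subseteq> WS (Suc n)"
  unfolding orient_htpy_def
proof (rule keys_weighted)
  fix m assume "m \<in> Poly_Mapping.keys (orient_cone l)"
  then have m: "length m = Suc (Suc n)" "set m \<subseteq> set l \<union> lift ` fst ` set l" using keys_orient_cone[of l] l(2) by auto
  then have "m \<noteq> []" by auto
  then have "admissible (set m)" using admissible_subset[OF admissible_lift[OF l(1)] m(2)] by simp
  then show "Poly_Mapping.keys (frag_of (pair_simplex m)) \<subseteq> WS (Suc n)"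
    using pair_simplex_singular m(1) by (simp add: keys_frag_of)
qed

end

section \<open>Labellings of subdivisions\<close>

context strict_total_order
begin

text \<open>A Sperner labelling of an iterated subdivision has degree one. In place of a count of fully
  labelled simplices: both sides have the same boundary, by induction, and involve the same vertices.\<close>

lemma sort_alt_subdivide:
  assumes lab: "\<And>z. z \<in> standard_simplex n \<Longrightarrow> \<exists>i. z i \<noteq> 0 \<and> lab z = vs ! i"
    and "set is \<subseteq> {..n}"
  shows "frag_extend (\<lambda>l. sort_alt (map lab l)) ((frag_extend subdivide ^^ m) (frag_of (map simplex_vertex is)))
       = sort_alt (map ((!) vs) is)"
  using assms(2)
proof (induction "is" rule: list_bd_induct)
  case Nil
  have "(frag_extend subdivide ^^ m) (frag_of ([] :: point list)) = frag_of []" by (induction m) auto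
  then show ?case by simp
next
  case (step "is")
  let ?L = "frag_extend (\<lambda>l. sort_alt (map lab l))"
  let ?A = "\<lambda>is. ?L ((frag_extend subdivide ^^ m) (frag_of (map simplex_vertex is)))"
  let ?c = "?A is - sort_alt (map ((!) vs) is)"
  \<comment> \<open>The face spanned by \<open>is\<close>: it is closed under barycentres, and
    labels of its points come from \<open>is\<close>.\<close>
  let ?D = "{z \<in> standard_simplex n. {k. z k \<noteq> 0} \<subseteq> set is}"
  have bary: "barycentre l \<in> ?D" if "l \<noteq> []" "set l \<subseteq> ?D" for l
    using barycentre_standard_simplex[OF that(1), of n] support_barycentre[OF that(1), of n] that(2) by auto
  have "set (map simplex_vertex is) \<subseteq> ?D" using step.prems by (auto simp: simplex_vertex_def split: if_splits)
  note keys = keys_iterated_subdivide_gen[of ?D, OF bary this, where m = m]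
  have "Poly_Mapping.keys ?c \<subseteq> {y. sorted_wrt lt y \<and> length y = length is \<and> set y \<subseteq> (!) vs ` set is}"
  proof (rule keys_diff_subset)
    show "Poly_Mapping.keys (?A is) \<subseteq> {y. sorted_wrt lt y \<and> length y = length is \<and> set y \<subseteq> (!) vs ` set is}"
    proof (rule keys_frag_extend_subset[OF keys])
      fix l assume l: "l \<in> {q. length q = length (map simplex_vertex is) \<and> set q \<subseteq> ?D}"
      have "lab z \<in> (!) vs ` set is" if "z \<in> ?D" for z using lab[of z] that by auto
      then have "lab ` set l \<subseteq> (!) vs ` set is" using l by auto
      then show "Poly_Mapping.keys (sort_alt (map lab l)) \<subseteq> {y. sorted_wrt lt y \<and> length y = length is \<and> set y \<subseteq> (!) vs ` set is}"
        using keys_sort_alt[of "map lab l"] l by (simp add: subset_iff)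
    qed
    show "Poly_Mapping.keys (sort_alt (map ((!) vs) is)) \<subseteq> {y. sorted_wrt lt y \<and> length y = length is \<and> set y \<subseteq> (!) vs ` set is}"
      using keys_sort_alt[of "map ((!) vs) is"] by auto
  qed
  \<comment> \<open>A strictly sorted list of length \<open>length is\<close> has that many
    different labels, so it uses all labels available. Both chains are thus multiples of one
    simplex, or 0 if labels repeat.\<close>
  moreover have "set y = (!) vs ` set is" if y: "sorted_wrt lt y" "length y = length is" "set y \<subseteq> (!) vs ` set is" for y
  proof (rule card_seteq)
    have "card ((!) vs ` set is) \<le> card (set is)" by (rule card_image_le) simp
    also have "\<dots> \<le> length is" by (rule card_length)
    also have "\<dots> = card (set y)" using y sorted_imp_distinct[OF y(1)] by (simp add: distinct_card)
    finally show "card ((!) vs ` set is) \<le> card (set y)" .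
  qed (use y in auto)
  ultimately have kc: "Poly_Mapping.keys ?c \<subseteq> {y. sorted_wrt lt y \<and> length y = length is \<and> set y = (!) vs ` set is}" by blast
  \<comment> \<open>Labelling and subdividing commute with the boundary, and on the faces the two
    sides agree by the induction hypothesis.\<close>
  have bd: "list_chain_bd ?c = 0"
  proof -
    have "list_chain_bd (?L d) = ?L (list_chain_bd d)" for d
      by (simp add: frag_extend_extend list_chain_bd_sort_alt frag_extend_image flip: frag_image_map_list_bd)
    then have "list_chain_bd (?A is) = ?L ((frag_extend subdivide ^^ m) (frag_image (map simplex_vertex) (list_bd is)))"
      by (simp add: list_chain_bd_iterated_subdivide frag_image_map_list_bd)
    also have "\<dots> = frag_extend ?A (list_bd is)"
      by (subst iterated_frag_extend) (simp add: frag_extend_extend frag_extend_image)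
    also have "\<dots> = frag_extend (\<lambda>is. sort_alt (map ((!) vs) is)) (list_bd is)"
      by (rule frag_extend_list_bd_cong) (use step in auto)
    also have "\<dots> = list_chain_bd (sort_alt (map ((!) vs) is))"
      by (simp add: list_chain_bd_sort_alt frag_extend_image flip: frag_image_map_list_bd)
    finally show ?thesis by (simp add: frag_extend_diff)
  qed
  have "?c = 0"
  proof (cases "Poly_Mapping.keys ?c = {}")
    case False
    then obtain y where y: "y \<in> Poly_Mapping.keys ?c" by blast
    then have y': "sorted_wrt lt y" "length y = length is" "set y = (!) vs ` set is" using kc by auto
    have "Poly_Mapping.keys ?c \<subseteq> {y}"
    proof
      fix x assume "x \<in> Poly_Mapping.keys ?c"
      then have "sorted_wrt lt x" "set x = (!) vs ` set is" using kc by auto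
      then show "x \<in> {y}" using sorted_unique[of x y] y' by simp
    qed
    moreover have "y \<noteq> []" using y' step(1) by auto
    ultimately show ?thesis using bd sorted_imp_distinct[OF y'(1)] by (intro multiple_sorted_eq_0[of ?c y])
  qed simp
  then show ?case by simp
qed

end

section \<open>Simplicial approximation\<close>

context triangulated
begin

definition label :: "(point \<Rightarrow> 'a) \<Rightarrow> (point \<Rightarrow> nat) \<Rightarrow> point \<Rightarrow> 'v \<times> nat" where
  "label g \<omega> z = (top_vertex (g z), \<omega> z)"

text \<open>Only corners are consulted, so passing to a face drops a label, and labelling commutes
  with the boundary in \<open>labels_wbd\<close>.\<close>

definition labels :: "nat \<Rightarrow> 'a wsimplex \<Rightarrow> ('v \<times> nat) list" where
  "labels n \<tau> = map (\<lambda>i. (top_vertex (snd \<tau> (simplex_vertex i)), fst \<tau> {i})) [0..<Suc n]"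

definition small :: "nat \<Rightarrow> 'a wsimplex \<Rightarrow> bool" where
  "small n \<tau> \<longleftrightarrow> (\<forall>y\<in>standard_simplex n. \<forall>y'\<in>standard_simplex n. top_vertex (snd \<tau> y) \<in> car (snd \<tau> y'))"

lemma labels_affine_piece:
  assumes "length l = Suc n"
  shows "labels n (affine_piece g \<omega> l) = map (label g \<omega>) l"
proof (rule nth_equalityI)
  fix i assume "i < length (labels n (affine_piece g \<omega> l))"
  then have i: "i \<le> n" by (simp add: labels_def)
  have "simplex_vertex i \<in> standard_simplex n" using i by (simp add: simplex_vertex_def)
  moreover have "{i} \<in> simplex_complex n" using i by (simp add: simplex_complex_def)
  ultimately show "labels n (affine_piece g \<omega> l) ! i = map (label g \<omega>) l ! i"
    using i assms by (simp add: labels_def label_def affine_piece_def uniform_point_singleton affine_map_vertex del: upt_Suc)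
qed (use assms in \<open>simp add: labels_def\<close>)

lemma pair_weight_label:
  assumes "weight_function t D \<omega>" "l \<noteq> []" "set l \<subseteq> D"
  shows "pair_weight (map (label g \<omega>) l) = \<omega> (barycentre l)"
  using max_weight_barycentre[OF assms chain_weights_weight_function[OF assms(1) finite_set assms(3)]]
  by (simp add: pair_weight_def label_def image_image)

lemma labels_piece_chain:
  assumes "weight_function t D \<omega>" "Poly_Mapping.keys c \<subseteq> {l. length l = Suc n \<and> set l \<subseteq> D}"
  shows "frag_image (labels n) (piece_chain t g \<omega> a c) = weighted t pair_weight frag_of a (frag_image (map (label g \<omega>)) c)"
  unfolding frag_image_weighted weighted_image frag_image_simps
proof (rule weighted_cong)
  fix l assume "l \<in> Poly_Mapping.keys c"
  then have l: "length l = Suc n" "set l \<subseteq> D" using assms(2) by auto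
  then have "l \<noteq> []" by auto
  then show "\<omega> (barycentre l) = pair_weight (map (label g \<omega>) l) \<and>
      frag_of (labels n (affine_piece g \<omega> l)) = frag_of (map (label g \<omega>) l)"
    using pair_weight_label[OF assms(1) _ l(2)] labels_affine_piece[OF l(1)] by simp
qed

lemma labels_eq:
  assumes "\<tau> \<in> WS n"
  shows "labels n \<tau> = map (label (snd \<tau>) (simplex_weight (fst \<tau>))) (simplex_vertices n)"
    "pair_weight (labels n \<tau>) = fst \<tau> {..n}"
proof -
  obtain \<xi> \<theta> where \<tau>: "\<tau> = (\<xi>, \<theta>)" by (cases \<tau>)
  note D = weighted_singular_simplexD[OF assms[unfolded \<tau>]]
  show l: "labels n \<tau> = map (label (snd \<tau>) (simplex_weight (fst \<tau>))) (simplex_vertices n)"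
    using labels_affine_piece[of "simplex_vertices n" n \<theta> "simplex_weight \<xi>"] D(4) \<tau> by simp
  show "pair_weight (labels n \<tau>) = fst \<tau> {..n}"
    unfolding l using pair_weight_label[OF D(1) _ set_simplex_vertices, of \<theta>] D(5) \<tau> by simp
qed

lemma labels_wbd:
  assumes "\<tau> \<in> WS (Suc n)"
  shows "frag_image (labels n) (wbd t (Suc n) (frag_of \<tau>)) = weighted_bd t pair_weight (labels (Suc n) \<tau>)"
  unfolding wbd_frag_of[OF assms zero_less_Suc]
    labels_piece_chain[OF piece_chain_bd_conditions(1,2)[OF assms]] frag_image_map_list_bd weighted_bd_def labels_eq(2)[OF assms]
  by (simp add: labels_eq(1)[OF assms])

lemma singular_in_P:
  assumes "\<tau> \<in> WS n" "y \<in> standard_simplex n"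
  shows "snd \<tau> y \<in> P" "weight_le t (wP (snd \<tau> y)) (simplex_weight (fst \<tau>) y)"
proof -
  obtain \<xi> \<theta> where \<tau>: "\<tau> = (\<xi>, \<theta>)" by (cases \<tau>)
  note D = weighted_singular_simplexD[OF assms(1)[unfolded \<tau>]]
  show "snd \<tau> y \<in> P" using continuous_map_image_subset_topspace[OF D(2)] assms(2) \<tau> by auto
  show "weight_le t (wP (snd \<tau> y)) (simplex_weight (fst \<tau>) y)" using D(3)[OF assms(2)] \<tau> by simp
qed

text \<open>Smallness puts all labels into the carrier of every image point, so they span a simplex
  of \<open>K\<close>. For a label \<open>u\<close> and a corner \<open>z\<close>, the weight of
  \<open>u\<close> is bounded by the weight of the carrier of the image of \<open>z\<close>, and
  W-continuity bounds the latter by the weight at \<open>z\<close>. Every vertex weight thus lies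
  below every corner weight, and the two chains combine into one.\<close>

lemma admissible_labels:
  assumes \<tau>: "\<tau> \<in> WS n" and small: "small n \<tau>"
  shows "admissible (set (labels n \<tau>))"
    "y \<in> standard_simplex n \<Longrightarrow> fst ` set (labels n \<tau>) \<subseteq> car (snd \<tau> y)"
proof -
  let ?\<omega> = "simplex_weight (fst \<tau>)" and ?V = "set (simplex_vertices n)"
  let ?U = "(\<lambda>z. top_vertex (snd \<tau> z)) ` ?V"
  have l: "fst ` set (labels n \<tau>) = ?U" "snd ` set (labels n \<tau>) = ?\<omega> ` ?V"
    unfolding labels_eq(1)[OF \<tau>] by (simp_all add: label_def image_image)
  have sub: "?U \<subseteq> car (snd \<tau> y)" if "y \<in> standard_simplex n" for y
    using small that set_simplex_vertices[of n] unfolding small_def by blast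
  then show "fst ` set (labels n \<tau>) \<subseteq> car (snd \<tau> y)" if "y \<in> standard_simplex n" using that l by simp
  obtain e where e: "e \<in> ?V" using simplex_vertices_ne[of n] by (cases "simplex_vertices n") auto
  then have e': "e \<in> standard_simplex n" using set_simplex_vertices by blast
  have "?U \<noteq> {}" by simp
  then have U: "?U \<in> K" by (rule simplexD(3)[OF coord(1)[OF singular_in_P(1)[OF \<tau> e']] sub[OF e']])
  have le: "weight_le t (\<mu> {u}) (?\<omega> z)" if "u \<in> ?U" "z \<in> ?V" for u z
  proof -
    have z: "z \<in> standard_simplex n" using that(2) set_simplex_vertices by blast
    have "weight_le t (\<mu> {u}) (\<mu> (car (snd \<tau> z)))"
      using sub[OF z] that(1) coord(1)[OF singular_in_P(1)[OF \<tau> z]] by (intro weight_mono) auto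
    also have "\<mu> (car (snd \<tau> z)) = wP (snd \<tau> z)" using wP[OF singular_in_P(1)[OF \<tau> z]] by simp
    also have "weight_le t \<dots> (?\<omega> z)" by (rule singular_in_P(2)[OF \<tau> z])
    finally show ?thesis .
  qed
  obtain \<xi> \<theta> where \<tau>': "\<tau> = (\<xi>, \<theta>)" by (cases \<tau>)
  have c1: "chain_weights t (?\<omega> ` ?V)"
    using chain_weights_weight_function[OF weighted_singular_simplexD(1)[OF \<tau>[unfolded \<tau>']] finite_set set_simplex_vertices] \<tau>' by simp
  have c2: "chain_weights t ((\<lambda>v. \<mu> {v}) ` ?U)" by (rule vertex_chain[OF U])
  have "chain_weights t (?\<omega> ` ?V \<union> (\<lambda>v. \<mu> {v}) ` ?U)"
    unfolding chain_weights_def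
  proof (intro conjI ballI)
    show "finite (?\<omega> ` ?V \<union> (\<lambda>v. \<mu> {v}) ` ?U)" by simp
    show "0 < a" if "a \<in> ?\<omega> ` ?V \<union> (\<lambda>v. \<mu> {v}) ` ?U" for a
      using that c1 c2 unfolding chain_weights_def by blast
    fix a b assume "a \<in> ?\<omega> ` ?V \<union> (\<lambda>v. \<mu> {v}) ` ?U" "b \<in> ?\<omega> ` ?V \<union> (\<lambda>v. \<mu> {v}) ` ?U"
    then consider "a \<in> ?\<omega> ` ?V" "b \<in> ?\<omega> ` ?V" | "a \<in> (\<lambda>v. \<mu> {v}) ` ?U" "b \<in> (\<lambda>v. \<mu> {v}) ` ?U"
      | "a \<in> (\<lambda>v. \<mu> {v}) ` ?U" "b \<in> ?\<omega> ` ?V" | "a \<in> ?\<omega> ` ?V" "b \<in> (\<lambda>v. \<mu> {v}) ` ?U" by blast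
    then show "weight_le t a b \<or> weight_le t b a"
    proof cases
      case 1
      then show ?thesis using c1 unfolding chain_weights_def by blast
    next
      case 2
      then show ?thesis using c2 unfolding chain_weights_def by blast
    next
      case 3
      then have "weight_le t a b" using le by blast
      then show ?thesis ..
    next
      case 4
      then have "weight_le t b a" using le by blast
      then show ?thesis ..
    qed
  qed
  moreover have "weight_le t (\<mu> {fst x}) (snd x)" if "x \<in> set (labels n \<tau>)" for x
    using that le unfolding labels_eq(1)[OF \<tau>] by (auto simp: label_def)
  ultimately show "admissible (set (labels n \<tau>))" using U l by (simp add: admissible_def)
qed

subsection \<open>The straight-line homotopy\<close>

text \<open>A point of the prism over the standard simplex is encoded as a function on the naturals with
  the time at \<open>0\<close> and the barycentric coordinates shifted by one.\<close>

definition at_time :: "real \<Rightarrow> point \<Rightarrow> point" where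
  "at_time s y = (\<lambda>k. case k of 0 \<Rightarrow> s | Suc i \<Rightarrow> y i)"

definition position :: "point \<Rightarrow> point" where
  "position z = (\<lambda>k. z (Suc k))"

definition prism :: "nat \<Rightarrow> point set" where
  "prism n = {z. 0 \<le> z 0 \<and> z 0 \<le> 1 \<and> position z \<in> standard_simplex n}"

definition prism_map :: "(point \<Rightarrow> 'a) \<Rightarrow> 'v list \<Rightarrow> point \<Rightarrow> 'a" where
  "prism_map \<theta> vs z = (1 - z 0) *\<^sub>R \<theta> (position z) + z 0 *\<^sub>R linear_simplex vs (position z)"

abbreviation "prism_list \<equiv> map (\<lambda>z. (at_time 0 z, at_time 1 z))"

definition prism_operator :: "nat \<Rightarrow> 'a wsimplex \<Rightarrow> ('a wsimplex \<Rightarrow>\<^sub>0 int)" where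
  "prism_operator n \<tau> = piece_chain t (prism_map (snd \<tau>) (map fst (labels n \<tau>))) (\<lambda>z. simplex_weight (fst \<tau>) (position z))
     (fst \<tau> {..n}) (prism_chain (prism_list (simplex_vertices n)))"

lemma at_time_simps [simp]: "at_time s y 0 = s" "position (at_time s y) = y"
  by (auto simp: at_time_def position_def)

lemma at_time_position: "at_time (z 0) (position z) = z"
  by (auto simp: at_time_def position_def fun_eq_iff split: nat.split)

lemma position_affine_map: "position (affine_map l x) = affine_map (map position l) x"
  by (simp add: position_def affine_map_def)

lemma position_barycentre: "position (barycentre l) = barycentre (map position l)"
  by (simp add: barycentre_def position_affine_map)

lemma affine_map_at_time:
  assumes "l \<noteq> []" "x \<in> standard_simplex (length l - 1)"
  shows "affine_map (map (at_time s) l) x = at_time s (affine_map l x)"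
proof -
  have "(\<Sum>i<length l. x i * s) = s"
    using sum_standard_simplex[OF assms(2,1)] by (simp flip: sum_distrib_right)
  then have "affine_map (map (at_time s) l) x 0 = s" by (simp add: affine_map_def)
  moreover have "position (affine_map (map (at_time s) l) x) = affine_map l x"
    by (simp add: position_affine_map o_def)
  ultimately show ?thesis using at_time_position by metis
qed

text \<open>The weight is constant in time and \<open>position\<close> commutes with affine maps, so
  attainment is inherited from the simplex.\<close>

lemma weight_function_prism:
  assumes "weight_function t (standard_simplex n) \<omega>"
  shows "weight_function t (prism n) (\<lambda>z. \<omega> (position z))"
  unfolding weight_function_def
proof (intro allI impI)
  fix l :: "point list" and x assume l: "l \<noteq> []" "set l \<subseteq> prism n" "x \<in> standard_simplex (length l - 1)"
  have pl: "map position l \<noteq> []" "set (map position l) \<subseteq> standard_simplex n" "x \<in> standard_simplex (length (map position l) - 1)"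
    using l by (auto simp: prism_def)
  have l0: "0 \<le> (l ! i) 0" "(l ! i) 0 \<le> 1" if "i < length l" for i
    using l(2) nth_mem[OF that] by (auto simp: prism_def)
  have "0 \<le> affine_map l x 0"
    unfolding affine_map_def using l0 standard_simplexD(1)[OF l(3)] by (intro sum_nonneg) auto
  moreover have "affine_map l x 0 \<le> (\<Sum>i<length l. x i * 1)"
    unfolding affine_map_def using l0 standard_simplexD(1)[OF l(3)] by (intro sum_mono mult_left_mono) auto
  then have "affine_map l x 0 \<le> 1" using sum_standard_simplex[OF l(3,1)] by simp
  ultimately have "affine_map l x \<in> prism n"
    using affine_map_standard_simplex[OF pl] by (simp add: prism_def position_affine_map)
  moreover have nth: "\<omega> (map position l ! i) = \<omega> (position (l ! i))" if "x i \<noteq> 0" for i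
  proof -
    have "i < length l" by (rule support_index[OF l(3,1) that])
    then show ?thesis by simp
  qed
  ultimately show "affine_map l x \<in> prism n \<and> 0 < \<omega> (position (affine_map l x)) \<and>
     (\<forall>i. x i \<noteq> 0 \<longrightarrow> weight_le t (\<omega> (position (l ! i))) (\<omega> (position (affine_map l x)))) \<and>
     (\<exists>i. x i \<noteq> 0 \<and> \<omega> (position (affine_map l x)) = \<omega> (position (l ! i)))"
    unfolding position_affine_map
    using weight_functionD(2)[OF assms pl] weight_functionD(3)[OF assms pl] weight_functionD(4)[OF assms pl] nth by metis
qed

lemma prism_map_properties:
  assumes \<tau>: "\<tau> \<in> WS n" and small: "small n \<tau>"
  shows "continuous_map (subtopology (powertop_real UNIV) (prism n)) (top_of_set P) (prism_map (snd \<tau>) (map fst (labels n \<tau>)))"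
    "z \<in> prism n \<Longrightarrow> weight_le t (wP (prism_map (snd \<tau>) (map fst (labels n \<tau>)) z)) (simplex_weight (fst \<tau>) (position z))"
proof -
  let ?vs = "map fst (labels n \<tau>)" and ?\<theta> = "snd \<tau>"
  obtain \<xi> \<theta> where \<tau>': "\<tau> = (\<xi>, \<theta>)" by (cases \<tau>)
  note D = weighted_singular_simplexD[OF \<tau>[unfolded \<tau>']]
  have vs: "set ?vs \<in> K" "length ?vs = Suc n"
  proof -
    have "fst ` set (labels n \<tau>) \<in> K" using admissible_labels(1)[OF \<tau> small] by (simp only: admissible_def)
    then show "set ?vs \<in> K" by simp
    show "length ?vs = Suc n" by (simp add: labels_def)
  qed
  have segment: "prism_map ?\<theta> ?vs z \<in> P" "car (prism_map ?\<theta> ?vs z) \<subseteq> car (?\<theta> (position z))" "car (prism_map ?\<theta> ?vs z) \<noteq> {}"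
    if z: "z \<in> prism n" for z
  proof -
    have y: "position z \<in> standard_simplex n" and s: "0 \<le> z 0" "z 0 \<le> 1" using z by (auto simp: prism_def)
    have L: "linear_simplex ?vs (position z) \<in> P" "car (linear_simplex ?vs (position z)) = (!) ?vs ` {i. position z i \<noteq> 0}"
      using linear_simplex_coord[OF vs(1)] vs(2) y by auto
    have "i < length ?vs" if "position z i \<noteq> 0" for i using standard_simplexD(3)[OF y, of i] that vs(2) by (cases "n < i") simp_all
    then have "(!) ?vs ` {i. position z i \<noteq> 0} \<subseteq> set ?vs" by force
    then have "car (linear_simplex ?vs (position z)) \<subseteq> car (?\<theta> (position z))"
      using L(2) admissible_labels(2)[OF \<tau> small y] by auto
    from segment_coord[OF singular_in_P(1)[OF \<tau> y] L(1) this s]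
    show "prism_map ?\<theta> ?vs z \<in> P" "car (prism_map ?\<theta> ?vs z) \<subseteq> car (?\<theta> (position z))" "car (prism_map ?\<theta> ?vs z) \<noteq> {}"
      by (simp_all add: prism_map_def)
  qed
  have cont: "continuous_on (standard_simplex n) ?\<theta>"
    using D(2) \<tau>' unfolding simplex_topology continuous_map_subtopology_eu by simp
  have pos: "continuous_on (prism n) position"
    unfolding position_def
    by (intro continuous_on_coordinatewise_then_product continuous_on_subset[OF continuous_on_product_coordinates subset_UNIV])
  have "continuous_on (prism n) (prism_map ?\<theta> ?vs)"
    unfolding prism_map_def
    by (intro continuous_intros continuous_on_subset[OF continuous_on_product_coordinates subset_UNIV]
        continuous_on_compose2[OF cont pos] continuous_on_compose2[OF continuous_linear_simplex[of UNIV] pos])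
       (auto simp: prism_def)
  then show "continuous_map (subtopology (powertop_real UNIV) (prism n)) (top_of_set P) (prism_map ?\<theta> ?vs)"
    unfolding simplex_topology continuous_map_subtopology_eu using segment(1) by auto
  assume z: "z \<in> prism n"
  then have y: "position z \<in> standard_simplex n" by (auto simp: prism_def)
  note yP = singular_in_P[OF \<tau> y]
  have "weight_le t (\<mu> (car (prism_map ?\<theta> ?vs z))) (\<mu> (car (?\<theta> (position z))))"
    by (rule weight_mono[OF coord(1)[OF yP(1)] segment(2,3)[OF z]])
  then show "weight_le t (wP (prism_map ?\<theta> ?vs z)) (simplex_weight (fst \<tau>) (position z))"
    using yP(2) unfolding wP[OF yP(1)] wP[OF segment(1)[OF z]] by (rule weight_le_trans)
qed

lemma keys_prism_list:
  assumes "m \<in> Poly_Mapping.keys (prism_chain (prism_list f))"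
  shows "length m = Suc (length f)" "set (map position m) \<subseteq> set f" "set m \<subseteq> at_time 0 ` set f \<union> at_time 1 ` set f"
proof -
  have m: "length m = Suc (length f)" "set m \<subseteq> at_time 0 ` set f \<union> at_time 1 ` set f"
    using keys_prism[of "prism_list f"] assms by (auto simp: image_image)
  then show "length m = Suc (length f)" "set m \<subseteq> at_time 0 ` set f \<union> at_time 1 ` set f" by simp_all
  have "position z \<in> set f" if "z \<in> set m" for z
  proof -
    have "z \<in> at_time 0 ` set f \<union> at_time 1 ` set f" using m(2) that by blast
    then show ?thesis by auto
  qed
  then show "set (map position m) \<subseteq> set f" by auto
qed

lemma keys_prism_list_prism:
  assumes "m \<in> Poly_Mapping.keys (prism_chain (prism_list f))" "set f \<subseteq> standard_simplex n"
  shows "set m \<subseteq> prism n"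
proof
  fix z assume "z \<in> set m"
  then have "z \<in> at_time 0 ` set f \<union> at_time 1 ` set f" using keys_prism_list(3)[OF assms(1)] by blast
  then show "z \<in> prism n" using assms(2) by (auto simp: prism_def)
qed

lemma prism_weight_le:
  assumes "weight_function t (standard_simplex n) \<omega>" "set f \<subseteq> standard_simplex n" "m \<in> Poly_Mapping.keys (prism_chain (prism_list f))"
  shows "0 < \<omega> (position (barycentre m))" "weight_le t (\<omega> (position (barycentre m))) (\<omega> (barycentre f))"
proof -
  note m = keys_prism_list[OF assms(3)]
  have "map position m \<noteq> []" using m(1) by auto
  then show "0 < \<omega> (position (barycentre m))" "weight_le t (\<omega> (position (barycentre m))) (\<omega> (barycentre f))"
    unfolding position_barycentre
    using list_weightD[OF list_weight_barycentre[OF assms(1)], of "map position m"] m(2) assms(2) by auto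
qed

lemma affine_piece_bottom:
  assumes "l \<noteq> []"
  shows "affine_piece (prism_map \<theta> vs) (\<lambda>z. \<omega> (position z)) (map (at_time 0) l) = affine_piece \<theta> \<omega> l"
    "affine_piece (prism_map \<theta> vs) (\<lambda>z. \<omega> (position z)) (map (at_time 1) l) = affine_piece (linear_simplex vs) \<omega> l"
proof -
  have "affine_map (map (at_time s) l) (uniform_point T) = at_time s (affine_map l (uniform_point T))"
    if "T \<in> simplex_complex (length l - 1)" for s T
    by (rule affine_map_at_time[OF assms uniform_point(1)[OF that]])
  then show "affine_piece (prism_map \<theta> vs) (\<lambda>z. \<omega> (position z)) (map (at_time 0) l) = affine_piece \<theta> \<omega> l"
    "affine_piece (prism_map \<theta> vs) (\<lambda>z. \<omega> (position z)) (map (at_time 1) l) = affine_piece (linear_simplex vs) \<omega> l"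
    unfolding affine_piece_def using affine_map_at_time[OF assms] by (auto simp: prism_map_def intro!: restrict_ext)
qed

text \<open>Both weights are divisible and agree at the corners, so
  \<open>weight_function_unique\<close> makes them agree everywhere.\<close>

lemma pair_simplex_labels:
  assumes \<tau>: "\<tau> \<in> WS n" and small: "small n \<tau>"
  shows "affine_piece (linear_simplex (map fst (labels n \<tau>))) (simplex_weight (fst \<tau>)) (simplex_vertices n) = pair_simplex (labels n \<tau>)"
proof -
  obtain \<xi> \<theta> where \<tau>': "\<tau> = (\<xi>, \<theta>)" by (cases \<tau>)
  have w: "weight_function t (standard_simplex n) (simplex_weight (fst \<tau>))" using weighted_singular_simplexD(1)[OF \<tau>[unfolded \<tau>']] \<tau>' by simp
  have len: "length (labels n \<tau>) = Suc n" by (simp add: labels_def)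
  note w' = weight_function_pair[OF admissible_labels(1)[OF \<tau> small] len]
  have vert: "simplex_weight (fst \<tau>) z = simplex_weight (pair_face_weight (labels n \<tau>)) z" if z: "z \<in> set (simplex_vertices n)" for z
  proof -
    obtain i where i: "z = simplex_vertex i" "i \<le> n" using z by (auto simp: simplex_vertices_def less_Suc_eq_le simp del: upt_Suc)
    have "pair_face_weight (labels n \<tau>) {i} = fst \<tau> {i}"
      using i(2) by (simp add: pair_face_weight_def max_weight_def labels_def split: weight_type.split del: upt_Suc)
    then show ?thesis using i(1) by (simp add: simplex_weight_def simplex_vertex_def)
  qed
  have "simplex_weight (fst \<tau>) (affine_map (simplex_vertices n) x) = simplex_weight (pair_face_weight (labels n \<tau>)) (affine_map (simplex_vertices n) x)"
    if "x \<in> standard_simplex n" for x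
    by (rule weight_function_unique[OF w w' _ set_simplex_vertices _ vert]) (use that in auto)
  then show ?thesis
    unfolding pair_simplex_eq[OF len] affine_piece_def using uniform_point(1) by (auto intro!: restrict_ext)
qed

lemma prism_operator_face:
  assumes \<tau>: "\<tau> \<in> WS n" and f: "is \<noteq> []" "set is \<subseteq> {..n}" "length is = Suc k"
  shows "prism_operator k (affine_piece (snd \<tau>) (simplex_weight (fst \<tau>)) (map simplex_vertex is))
     = piece_chain t (prism_map (snd \<tau>) (map fst (labels n \<tau>))) (\<lambda>z. simplex_weight (fst \<tau>) (position z))
         (simplex_weight (fst \<tau>) (barycentre (map simplex_vertex is))) (prism_chain (prism_list (map simplex_vertex is)))"
proof -
  let ?f = "map simplex_vertex is" and ?\<theta> = "snd \<tau>" and ?\<omega> = "simplex_weight (fst \<tau>)"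
  let ?\<tau> = "affine_piece ?\<theta> ?\<omega> ?f"
  let ?vs = "map fst (labels n \<tau>)" and ?vs' = "map fst (labels k ?\<tau>)"
  obtain \<xi> \<theta> where \<tau>': "\<tau> = (\<xi>, \<theta>)" by (cases \<tau>)
  have w: "weight_function t (standard_simplex n) ?\<omega>" using weighted_singular_simplexD(1)[OF \<tau>[unfolded \<tau>']] \<tau>' by simp
  have fne: "?f \<noteq> []" "set ?f \<subseteq> standard_simplex n" "length ?f = Suc k" using f by (auto simp: simplex_vertex_def)
  \<comment> \<open>\<open>F\<close> maps the prism over the face affinely into the prism over the
    simplex and keeps the time.\<close>
  define F where "F z = at_time (z 0) (affine_map ?f (position z))" for z
  have F_affine: "F (affine_map m x) = affine_map (map F m) x" for m x
  proof -
    have "affine_map (map F m) x 0 = affine_map m x 0" by (simp add: affine_map_def F_def)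
    moreover have "position (affine_map (map F m) x) = affine_map ?f (position (affine_map m x))"
      by (simp add: position_affine_map affine_map_compose F_def o_def)
    ultimately show ?thesis using at_time_position[of "affine_map (map F m) x"] by (simp add: F_def)
  qed
  have top: "fst ?\<tau> {..k} = ?\<omega> (barycentre ?f)" using affine_piece_top_weight[OF fne(1), of ?\<theta> ?\<omega>] fne(3) by simp
  have vs': "?vs' = map ((!) ?vs) is"
  proof -
    have "?vs' = map (\<lambda>i. top_vertex (?\<theta> (simplex_vertex i))) is"
      unfolding labels_affine_piece[OF fne(3)] by (simp add: label_def)
    also have "\<dots> = map ((!) ?vs) is" using f(2) by (auto simp: labels_def nth_append subset_iff less_Suc_eq_le simp del: upt_Suc)
    finally show ?thesis .
  qed
  have L: "linear_simplex ?vs' y = linear_simplex ?vs (affine_map ?f y)" for y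
    unfolding vs' using linear_simplex_affine_map[of "is" ?vs y] f(2) by (auto simp: labels_def less_Suc_eq_le subset_iff)
  have gF: "prism_map (snd ?\<tau>) ?vs' z = prism_map ?\<theta> ?vs (F z)" if "z \<in> prism k" for z
    unfolding prism_map_def L using that fne(3) by (simp add: F_def affine_piece_def prism_def)
  have \<omega>F: "simplex_weight (fst ?\<tau>) (position z) = ?\<omega> (position (F z))" if "z \<in> prism k" for z
    using affine_piece_weight[OF w fne(1,2), of "position z" ?\<theta>] that fne(3) by (simp add: F_def prism_def)
  have w': "weight_function t (standard_simplex k) (simplex_weight (fst ?\<tau>))"
  proof -
    have "?\<tau> \<in> WS (length ?f - 1)"
      by (rule affine_piece_singular[OF w fne(1,2)])
         (use weighted_singular_simplexD[OF \<tau>[unfolded \<tau>']] \<tau>' in auto)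
    then show ?thesis using weighted_singular_simplexD(1)[of "fst ?\<tau>" "snd ?\<tau>"] fne(3) by simp
  qed
  note wp = weight_function_prism[OF w']
  have "prism_operator k ?\<tau> = weighted t (\<lambda>m. ?\<omega> (position (barycentre (map F m))))
      (\<lambda>m. frag_of (affine_piece (prism_map ?\<theta> ?vs) (\<lambda>z. ?\<omega> (position z)) (map F m))) (?\<omega> (barycentre ?f)) (prism_chain (prism_list (simplex_vertices k)))"
    unfolding prism_operator_def top
  proof (rule weighted_cong)
    fix m assume m: "m \<in> Poly_Mapping.keys (prism_chain (prism_list (simplex_vertices k)))"
    have mp: "set m \<subseteq> prism k" by (rule keys_prism_list_prism[OF m set_simplex_vertices])
    have ne: "m \<noteq> []" using keys_prism_list(1)[OF m] by auto
    have mem: "affine_map m x \<in> prism k" if "x \<in> standard_simplex (length m - 1)" for x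
      by (rule weight_functionD(1)[OF wp ne mp that])
    have "simplex_weight (fst ?\<tau>) (position (barycentre m)) = ?\<omega> (position (barycentre (map F m)))"
      using \<omega>F[OF mem[OF uniform_point(1)[OF lessThan_in_simplex_complex[OF ne]]]] by (simp add: barycentre_def F_affine)
    moreover have "affine_piece (prism_map (snd ?\<tau>) ?vs') (\<lambda>z. simplex_weight (fst ?\<tau>) (position z)) m
        = affine_piece (prism_map ?\<theta> ?vs) (\<lambda>z. ?\<omega> (position z)) (map F m)"
      unfolding affine_piece_def[of _ _ m] affine_piece_def[of _ _ "map F m"] length_map using gF[OF mem] \<omega>F[OF mem[OF uniform_point(1)]]
      by (auto intro!: restrict_ext simp: F_affine)
    ultimately show "simplex_weight (fst ?\<tau>) (position (barycentre m)) = ?\<omega> (position (barycentre (map F m))) \<and>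
      frag_of (affine_piece (prism_map (snd ?\<tau>) ?vs') (\<lambda>z. simplex_weight (fst ?\<tau>) (position z)) m)
        = frag_of (affine_piece (prism_map ?\<theta> ?vs) (\<lambda>z. ?\<omega> (position z)) (map F m))" by simp
  qed
  also have "\<dots> = piece_chain t (prism_map ?\<theta> ?vs) (\<lambda>z. ?\<omega> (position z)) (?\<omega> (barycentre ?f))
      (frag_image (map F) (prism_chain (prism_list (simplex_vertices k))))"
    by (simp add: weighted_image)
  also have "frag_image (map F) (prism_chain (prism_list (simplex_vertices k))) = prism_chain (prism_list (map (affine_map ?f) (simplex_vertices k)))"
    unfolding prism_natural by (simp add: F_def o_def)
  also have "map (affine_map ?f) (simplex_vertices k) = ?f" by (rule map_affine_map_vertices[OF fne(3)])
  finally show ?thesis .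
qed

lemma wbd_prism_operator:
  assumes \<tau>: "\<tau> \<in> WS n" and small: "small n \<tau>"
  shows "wbd t (Suc n) (prism_operator n \<tau>) = frag_of (pair_simplex (labels n \<tau>)) - frag_of \<tau>
     - (if n = 0 then 0 else frag_extend (prism_operator (n - 1)) (wbd t n (frag_of \<tau>)))"
    "Poly_Mapping.keys (prism_operator n \<tau>) \<subseteq> WS (Suc n)"
proof -
  let ?\<theta> = "snd \<tau>" and ?\<omega> = "simplex_weight (fst \<tau>)" and ?vs = "map fst (labels n \<tau>)"
  let ?g = "prism_map ?\<theta> ?vs" and ?\<omega>' = "\<lambda>z. simplex_weight (fst \<tau>) (position z)" and ?std = "simplex_vertices n"
  let ?P = "piece_chain t ?g ?\<omega>' (fst \<tau> {..n})"
  obtain \<xi> \<theta> where \<tau>': "\<tau> = (\<xi>, \<theta>)" by (cases \<tau>)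
  note D = weighted_singular_simplexD[OF \<tau>[unfolded \<tau>']]
  have w: "weight_function t (standard_simplex n) ?\<omega>" and top: "?\<omega> (barycentre ?std) = fst \<tau> {..n}" using D \<tau>' by simp_all
  note wp = weight_function_prism[OF w]
  note pos = frag_of_wsing(2)[OF \<tau>]
  have keys: "Poly_Mapping.keys (prism_chain (prism_list ?std)) \<subseteq> {m. length m = Suc (Suc n) \<and> set m \<subseteq> prism n}"
    using keys_prism_list(1)[of _ ?std] keys_prism_list_prism[OF _ set_simplex_vertices] by fastforce
  show "Poly_Mapping.keys (prism_operator n \<tau>) \<subseteq> WS (Suc n)"
    unfolding prism_operator_def
    by (rule keys_piece_chain[OF wp prism_map_properties[OF \<tau> small] keys])
  have "wbd t (Suc n) (prism_operator n \<tau>) = ?P (list_chain_bd (prism_chain (prism_list ?std)))"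
    unfolding prism_operator_def
  proof (rule boundary_piece_chain[OF wp keys _ pos])
    show "weight_le t (?\<omega>' (barycentre m)) (fst \<tau> {..n})" if "m \<in> Poly_Mapping.keys (prism_chain (prism_list ?std))" for m
      using prism_weight_le(2)[OF w set_simplex_vertices that] top by simp
  qed simp
  also have "list_chain_bd (prism_chain (prism_list ?std)) = frag_of (map (at_time 1) ?std) - frag_of (map (at_time 0) ?std)
      - frag_extend (\<lambda>f. prism_chain (prism_list f)) (list_bd ?std)"
    by (simp add: list_chain_bd_prism o_def frag_extend_image flip: frag_image_map_list_bd)
  also have "?P \<dots> = ?P (frag_of (map (at_time 1) ?std)) - ?P (frag_of (map (at_time 0) ?std))
      - ?P (frag_extend (\<lambda>f. prism_chain (prism_list f)) (list_bd ?std))" by (simp only: weighted_simps)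
  also have "?P (frag_of (map (at_time 1) ?std)) = frag_of (pair_simplex (labels n \<tau>))"
    using affine_piece_bottom(2)[of ?std ?\<theta> ?vs ?\<omega>] pair_simplex_labels[OF \<tau> small] top pos by (simp add: position_barycentre o_def)
  also have "?P (frag_of (map (at_time 0) ?std)) = frag_of \<tau>"
    using affine_piece_bottom(1)[of ?std ?\<theta> ?vs ?\<omega>] D(4) \<tau>' top pos by (simp add: position_barycentre o_def)
  also have "?P (frag_extend (\<lambda>f. prism_chain (prism_list f)) (list_bd ?std)) =
     (if n = 0 then 0 else frag_extend (prism_operator (n - 1)) (wbd t n (frag_of \<tau>)))"
  proof (cases n)
    case 0
    \<comment> \<open>The prism over the empty list is 0.\<close>
    then show ?thesis by (simp add: simplex_vertices_def)
  next
    case (Suc k)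
    have "frag_extend (prism_operator k) (piece_chain t ?\<theta> ?\<omega> (fst \<tau> {..n}) (list_bd ?std))
        = ?P (frag_extend (\<lambda>f. prism_chain (prism_list f)) (list_bd ?std))"
    proof (rule frag_extend_weighted_weighted[OF pos])
      fix f assume fk: "f \<in> Poly_Mapping.keys (list_bd ?std)"
      then obtain js where js: "js \<in> Poly_Mapping.keys (list_bd [0..<Suc n])" "f = map simplex_vertex js"
        unfolding simplex_vertices_map frag_image_map_list_bd[symmetric] by (elim keys_frag_imageE)
      have js': "js \<noteq> []" "set js \<subseteq> {..n}" "length js = Suc k" using list_bd_keysD[OF js(1)] Suc by (auto simp: subset_iff)
      have f: "f \<noteq> []" "set f \<subseteq> standard_simplex n" using js' js(2) by (auto simp: simplex_vertex_def)
      show "0 < ?\<omega> (barycentre f) \<and> weight_le t (?\<omega> (barycentre f)) (fst \<tau> {..n})"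
        using weight_le_simplex[OF w f] top by simp
      show "frag_extend (prism_operator k) (frag_of (affine_piece ?\<theta> ?\<omega> f)) = piece_chain t ?g ?\<omega>' (?\<omega> (barycentre f)) (prism_chain (prism_list f))"
        using prism_operator_face[OF \<tau> js'] js(2) by simp
      fix m assume "m \<in> Poly_Mapping.keys (prism_chain (prism_list f))"
      then show "0 < ?\<omega>' (barycentre m) \<and> weight_le t (?\<omega>' (barycentre m)) (?\<omega> (barycentre f))"
        using prism_weight_le[OF w f(2)] by blast
    qed
    then show ?thesis using Suc wbd_frag_of[OF \<tau>] by simp
  qed
  finally show "wbd t (Suc n) (prism_operator n \<tau>) = frag_of (pair_simplex (labels n \<tau>)) - frag_of \<tau>
     - (if n = 0 then 0 else frag_extend (prism_operator (n - 1)) (wbd t n (frag_of \<tau>)))" .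
qed

section \<open>The labelling as an inverse of the comparison map in homology\<close>

lemma sd_eventually_small:
  assumes "Poly_Mapping.keys c \<subseteq> WS n"
  shows "\<exists>m. \<forall>\<tau>\<in>Poly_Mapping.keys ((sd t n ^^ m) c). small n \<tau>"
proof -
  have "\<exists>m. \<forall>\<tau>\<in>Poly_Mapping.keys ((sd t n ^^ m) c). \<exists>V\<in>small_nbhd ` P. snd \<tau> ` standard_simplex n \<subseteq> V"
    by (rule sd_small[OF assms]) (use small_nbhd(1) topspace_small_nbhd in auto)
  moreover have "small n \<tau>" if "V \<in> small_nbhd ` P" "snd \<tau> ` standard_simplex n \<subseteq> V" for \<tau> V
    using that small_nbhd(3) unfolding small_def by blast
  ultimately show ?thesis by meson
qed

text \<open>The chain map property on small chains: \<open>labels_wbd\<close> carries the boundary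
  over to lists of pairs and \<open>orient_bd\<close> from there to simplicial chains.\<close>

lemma orient_labels_bd:
  assumes c: "Poly_Mapping.keys c \<subseteq> WS (Suc n)" and small: "\<And>\<tau>. \<tau> \<in> Poly_Mapping.keys c \<Longrightarrow> small (Suc n) \<tau>"
  shows "vbd (frag_extend (\<lambda>\<tau>. orient (labels (Suc n) \<tau>)) c) = frag_extend (\<lambda>\<tau>. orient (labels n \<tau>)) (wbd t (Suc n) c)"
    "Poly_Mapping.keys (frag_extend (\<lambda>\<tau>. orient (labels (Suc n) \<tau>)) c) \<subseteq> sorted_simplices (Suc n)"
proof -
  have "vbd (orient (labels (Suc n) \<tau>)) = frag_extend (\<lambda>\<tau>. orient (labels n \<tau>)) (wbd t (Suc n) (frag_of \<tau>))"
    if "\<tau> \<in> Poly_Mapping.keys c" for \<tau>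
  proof -
    have \<tau>: "\<tau> \<in> WS (Suc n)" using that c by blast
    have "vbd (orient (labels (Suc n) \<tau>)) = frag_extend orient (weighted_bd t pair_weight (labels (Suc n) \<tau>))"
      by (rule orient_bd[OF admissible_labels(1)[OF \<tau> small[OF that]], symmetric]) (simp add: labels_def)
    also have "\<dots> = frag_extend orient (frag_image (labels n) (wbd t (Suc n) (frag_of \<tau>)))" by (simp add: labels_wbd[OF \<tau>])
    finally show ?thesis by (simp add: frag_extend_image)
  qed
  then have "vbd (frag_extend (\<lambda>\<tau>. orient (labels (Suc n) \<tau>)) c) =
     frag_extend (\<lambda>\<tau>. frag_extend (\<lambda>\<tau>. orient (labels n \<tau>)) (wbd t (Suc n) (frag_of \<tau>))) c"
    unfolding frag_extend_extend by (rule frag_extend_eq)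
  then show "vbd (frag_extend (\<lambda>\<tau>. orient (labels (Suc n) \<tau>)) c) = frag_extend (\<lambda>\<tau>. orient (labels n \<tau>)) (wbd t (Suc n) c)"
    unfolding wbd_eq[of t "Suc n" c] frag_extend_extend .
  have "Poly_Mapping.keys (orient (labels (Suc n) \<tau>)) \<subseteq> sorted_simplices (Suc n)" if "\<tau> \<in> Poly_Mapping.keys c" for \<tau>
    using admissible_labels(1)[OF _ small[OF that]] that c by (intro keys_orient) (auto simp: labels_def admissible_def)
  then show "Poly_Mapping.keys (frag_extend (\<lambda>\<tau>. orient (labels (Suc n) \<tau>)) c) \<subseteq> sorted_simplices (Suc n)"
    by (rule keys_frag_extend_subset[OF order.refl])
qed

text \<open>A strict left inverse of the comparison map after any number of subdivisions. Without
  weights it is the Sperner statement \<open>sort_alt_subdivide\<close>, and the weights of the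
  intermediate pieces cancel.\<close>

lemma orient_labels_simplex_of:
  assumes vs: "vs \<in> sorted_simplices n"
  shows "frag_extend (\<lambda>\<tau>. orient (labels n \<tau>)) ((sd t n ^^ m) (frag_of (simplex_of vs))) = frag_of vs"
proof -
  have vs': "sorted_wrt lt vs" "length vs = Suc n" "set vs \<in> K" using vs by (auto simp: sorted_simplices_def)
  let ?\<tau> = "simplex_of vs"
  let ?g = "snd ?\<tau>" and ?\<omega> = "simplex_weight (fst ?\<tau>)" and ?L = "map lift vs"
  let ?c = "(frag_extend subdivide ^^ m) (frag_of (simplex_vertices n))"
  have \<tau>: "?\<tau> \<in> WS n" by (rule simplex_of_singular[OF vs'(3,2)])
  have w: "weight_function t (standard_simplex n) ?\<omega>"
    using weighted_singular_simplexD(1)[of "fst ?\<tau>" "snd ?\<tau>"] \<tau> by simp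
  have mapfst: "map fst ?L = vs" by (simp add: o_def)
  have g: "?g z = linear_simplex vs z" if "z \<in> standard_simplex n" for z
    using that vs'(2) mapfst by (simp add: simplex_of_def pair_simplex_def)
  have supp: "{i. z i \<noteq> 0} \<subseteq> {..n}" "{i. z i \<noteq> 0} \<noteq> {}" if "z \<in> standard_simplex n" for z
    using support_in_simplex_complex[OF that] by (auto simp: simplex_complex_def)
  have nth_K: "(!) vs ` {i. z i \<noteq> 0} \<in> K" if "z \<in> standard_simplex n" for z
    using simplexD(3)[OF vs'(3), of "(!) vs ` {i. z i \<noteq> 0}"] supp[OF that] vs'(2) by (fastforce simp: less_Suc_eq_le)
  have \<omega>: "?\<omega> z = \<mu> ((!) vs ` {i. z i \<noteq> 0})" if "z \<in> standard_simplex n" for z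
  proof -
    have "?\<omega> z = pair_face_weight ?L {i. z i \<noteq> 0}"
      using support_in_simplex_complex[OF that] vs'(2) by (simp add: simplex_weight_def simplex_of_def pair_simplex_def)
    also have "\<dots> = max_weight t ((\<lambda>v. \<mu> {v}) ` (!) vs ` {i. z i \<noteq> 0})"
      unfolding pair_face_weight_def image_image
      using supp(1)[OF that] vs'(2) by (intro arg_cong[where f = "max_weight t"] image_cong) auto
    also have "\<dots> = \<mu> ((!) vs ` {i. z i \<noteq> 0})" by (rule max_weight_vertices[OF nth_K[OF that]])
    finally show ?thesis .
  qed
  \<comment> \<open>The Sperner condition: the top vertex lies in the carrier, which is spanned by
    the positions in the support of \<open>z\<close>.\<close>
  have lab: "top_vertex (?g z) \<in> (!) vs ` {i. z i \<noteq> 0}" if "z \<in> standard_simplex n" for z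
  proof -
    have z: "z \<in> standard_simplex (length vs - 1)" using that vs'(2) by simp
    show ?thesis
      using top_vertex(2)[OF linear_simplex_coord(1)[OF vs'(3) z]] unfolding g[OF that] linear_simplex_coord(2)[OF vs'(3) z] .
  qed
  have pos: "0 < fst ?\<tau> {..n}" by (rule frag_of_wsing(2)[OF \<tau>])
  have top: "fst ?\<tau> {..n} = vweight vs"
  proof -
    have "fst ?\<tau> {..n} = ?\<omega> (barycentre (simplex_vertices n))"
      using weighted_singular_simplexD(5)[of "fst ?\<tau>" "snd ?\<tau>"] \<tau> by simp
    also have "\<dots> = pair_weight ?L"
    proof -
      have "{..n} \<in> simplex_complex n" by (auto simp: simplex_complex_def)
      then have "fst ?\<tau> {..n} = max_weight t ((\<lambda>i. snd (?L ! i)) ` {..n})"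
        using vs'(2) by (simp add: simplex_of_def pair_simplex_def pair_face_weight_def)
      moreover have "(\<lambda>i. snd (?L ! i)) ` {..n} = snd ` set ?L"
        using vs'(2) by (force simp: set_conv_nth less_Suc_eq_le image_iff)
      ultimately show ?thesis
        using weighted_singular_simplexD(5)[of "fst ?\<tau>" "snd ?\<tau>"] \<tau> by (simp add: pair_weight_def)
    qed
    finally show ?thesis using pair_weight_lift[OF vs'(3)] by simp
  qed
  have "frag_extend (\<lambda>\<tau>. orient (labels n \<tau>)) ((sd t n ^^ m) (frag_of ?\<tau>))
    = frag_extend (\<lambda>\<tau>. orient (labels n \<tau>)) (piece_chain t ?g ?\<omega> (fst ?\<tau> {..n}) ?c)"
    using iterated_sd_frag_of[OF \<tau>] by simp
  also have "\<dots> = weighted t vweight frag_of (fst ?\<tau> {..n}) (frag_extend (\<lambda>l. sort_alt (map (\<lambda>z. top_vertex (?g z)) l)) ?c)"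
  proof (rule frag_extend_weighted_weighted[OF pos])
    fix l assume "l \<in> Poly_Mapping.keys ?c"
    then have l: "length l = Suc n" "set l \<subseteq> standard_simplex n" using keys_iterated_subdivide by blast+
    then have ne: "l \<noteq> []" by auto
    show "0 < ?\<omega> (barycentre l) \<and> weight_le t (?\<omega> (barycentre l)) (fst ?\<tau> {..n})"
      using weight_le_simplex[OF w ne l(2)] weighted_singular_simplexD(5)[of "fst ?\<tau>" "snd ?\<tau>"] \<tau> by simp
    show "frag_extend (\<lambda>\<tau>. orient (labels n \<tau>)) (frag_of (affine_piece ?g ?\<omega> l))
      = weighted t vweight frag_of (?\<omega> (barycentre l)) (sort_alt (map (\<lambda>z. top_vertex (?g z)) l))"
      using labels_affine_piece[OF l(1), of ?g ?\<omega>] pair_weight_label[OF w ne l(2), of ?g]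
      by (simp add: orient_def o_def label_def)
    fix y assume "y \<in> Poly_Mapping.keys (sort_alt (map (\<lambda>z. top_vertex (?g z)) l))"
    then have y: "set y = (\<lambda>z. top_vertex (?g z)) ` set l" using keys_sort_alt by fastforce
    have b: "barycentre l \<in> standard_simplex n" by (rule barycentre_standard_simplex[OF ne l(2)])
    have sub: "set y \<subseteq> (!) vs ` {i. barycentre l i \<noteq> 0}"
      unfolding y support_barycentre[OF ne l(2)] using lab l(2) by blast
    have "set y \<noteq> {}" using y ne by simp
    then have "set y \<in> K" using simplexD(3)[OF nth_K[OF b] sub] by blast
    then show "0 < vweight y \<and> weight_le t (vweight y) (?\<omega> (barycentre l))"
      using is_weightD(1)[OF weight] weight_mono[OF nth_K[OF b] sub \<open>set y \<noteq> {}\<close>] \<omega>[OF b] by simp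
  qed
  also have "frag_extend (\<lambda>l. sort_alt (map (\<lambda>z. top_vertex (?g z)) l)) ?c = sort_alt (map ((!) vs) [0..<Suc n])"
    unfolding simplex_vertices_map
    by (rule sort_alt_subdivide[of n]) (use lab in \<open>auto simp: image_iff\<close>)
  also have "map ((!) vs) [0..<Suc n] = vs" by (rule map_nth_upt[OF vs'(2)])
  \<comment> \<open>The starting weight and the weight of the resulting simplex are both
    \<open>vweight vs\<close>, so the ratio is 1.\<close>
  also have "weighted t vweight frag_of (fst ?\<tau> {..n}) (sort_alt vs) = frag_of vs"
    using pos by (simp add: sort_alt_sorted[OF vs'(1)] top)
  finally show ?thesis .
qed

text \<open>\<open>orient_labels_simplex_of\<close> holds for every \<open>m\<close>, so the number
  of subdivisions may be dictated by the bounding chain \<open>w\<close>; labelling the subdivided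
  \<open>w\<close> then bounds \<open>s\<close>.\<close>

lemma simplex_of_injective:
  assumes s: "Poly_Mapping.keys s \<subseteq> sorted_simplices n" and w: "Poly_Mapping.keys w \<subseteq> WS (Suc n)"
    and eq: "frag_image simplex_of s = wbd t (Suc n) w"
  shows "\<exists>e. Poly_Mapping.keys e \<subseteq> sorted_simplices (Suc n) \<and> s = vbd e"
proof -
  obtain m where m: "\<forall>\<tau>\<in>Poly_Mapping.keys ((sd t (Suc n) ^^ m) w). small (Suc n) \<tau>" using sd_eventually_small[OF w] by blast
  let ?w = "(sd t (Suc n) ^^ m) w"
  have kw: "Poly_Mapping.keys ?w \<subseteq> WS (Suc n)" by (rule keys_iterated_sd[OF w])
  let ?e = "frag_extend (\<lambda>\<tau>. orient (labels (Suc n) \<tau>)) ?w"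
  have "vbd ?e = frag_extend (\<lambda>\<tau>. orient (labels n \<tau>)) ((sd t n ^^ m) (frag_image simplex_of s))"
    using orient_labels_bd(1)[OF kw] m eq wbd_iterated_sd[OF w] by simp
  also have "\<dots> = frag_extend (\<lambda>vs. frag_extend (\<lambda>\<tau>. orient (labels n \<tau>)) ((sd t n ^^ m) (frag_of (simplex_of vs)))) s"
    unfolding sd_def by (subst iterated_frag_extend) (simp add: frag_extend_image frag_extend_extend)
  also have "\<dots> = frag_extend frag_of s"
    by (rule frag_extend_eq) (use orient_labels_simplex_of s in blast)
  finally have "s = vbd ?e" by (simp flip: frag_expansion)
  then show ?thesis using orient_labels_bd(2)[OF kw] m by blast
qed

text \<open>Three bounding chains are collected: one for subdividing, one for moving straight to the
  labels, one for sorting the labels and resetting their weights. On cycles the boundary terms of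
  the homotopies vanish.\<close>

lemma simplex_of_surjective:
  assumes z: "Poly_Mapping.keys z \<subseteq> WS n" "0 < n \<longrightarrow> wbd t n z = 0"
  shows "\<exists>c w. Poly_Mapping.keys c \<subseteq> sorted_simplices n \<and> (0 < n \<longrightarrow> vbd c = 0) \<and>
     Poly_Mapping.keys w \<subseteq> WS (Suc n) \<and> z = wbd t (Suc n) w + frag_image simplex_of c"
proof -
  obtain m where m: "\<forall>\<tau>\<in>Poly_Mapping.keys ((sd t n ^^ m) z). small n \<tau>" using sd_eventually_small[OF z(1)] by blast
  let ?z = "(sd t n ^^ m) z"
  obtain w1 where w1: "Poly_Mapping.keys w1 \<subseteq> WS (Suc n)" "z = wbd t (Suc n) w1 + ?z" and zc: "Poly_Mapping.keys ?z \<subseteq> WS n" "0 < n \<longrightarrow> wbd t n ?z = 0"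
    using iterated_sd[of z t "top_of_set P" wP n m] z by blast
  let ?w2 = "frag_extend (prism_operator n) ?z" and ?w3 = "frag_extend (\<lambda>\<tau>. orient_htpy (labels n \<tau>)) ?z"
  let ?c = "frag_extend (\<lambda>\<tau>. orient (labels n \<tau>)) ?z"
  have sing: "\<tau> \<in> WS n" "small n \<tau>" "admissible (set (labels n \<tau>))" if "\<tau> \<in> Poly_Mapping.keys ?z" for \<tau>
    using that zc(1) m admissible_labels(1) by blast+
  have len: "length (labels n \<tau>) = Suc n" for \<tau> by (simp add: labels_def)
  have kw2: "Poly_Mapping.keys ?w2 \<subseteq> WS (Suc n)"
    by (rule keys_frag_extend_subset[OF order.refl]) (rule wbd_prism_operator(2)[OF sing(1,2)])
  have kw3: "Poly_Mapping.keys ?w3 \<subseteq> WS (Suc n)"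
    by (rule keys_frag_extend_subset[OF order.refl]) (rule keys_orient_htpy[OF sing(3) len])
  have kc: "Poly_Mapping.keys ?c \<subseteq> sorted_simplices n"
    by (rule keys_frag_extend_subset[OF order.refl]) (rule keys_orient[OF len], use sing(3) in \<open>simp add: admissible_def\<close>)
  have bd0: "wbd t n ?z = frag_extend (\<lambda>\<tau>. wbd t n (frag_of \<tau>)) ?z" by (rule wbd_eq)
  have "wbd t (Suc n) ?w2 = frag_extend (\<lambda>\<tau>. frag_of (pair_simplex (labels n \<tau>)) - frag_of \<tau>
      - (if n = 0 then 0 else frag_extend (prism_operator (n - 1)) (wbd t n (frag_of \<tau>)))) ?z"
    unfolding wbd_extend by (intro frag_extend_eq wbd_prism_operator(1) sing)
  also have "\<dots> = frag_extend (\<lambda>\<tau>. frag_of (pair_simplex (labels n \<tau>))) ?z - ?z"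
  proof (cases "n = 0")
    case False
    have "frag_extend (prism_operator (n - 1)) (frag_extend (\<lambda>\<tau>. wbd t n (frag_of \<tau>)) ?z) = 0"
      using zc(2) False unfolding bd0[symmetric] by simp
    with False show ?thesis by (simp add: frag_extend_fun_diff frag_extend_extend flip: frag_expansion)
  qed (simp add: frag_extend_fun_diff frag_extend_eq_0 flip: frag_expansion)
  finally have b2: "wbd t (Suc n) ?w2 = frag_extend (\<lambda>\<tau>. frag_of (pair_simplex (labels n \<tau>))) ?z - ?z" .
  have lab: "frag_extend (weighted_bd t pair_weight) (frag_image (labels n) ?z) = 0" if n: "0 < n"
  proof -
    obtain k where k: "n = Suc k" using n by (cases n) auto
    have "frag_extend (weighted_bd t pair_weight) (frag_image (labels n) ?z) = frag_extend (\<lambda>\<tau>. frag_image (labels k) (wbd t n (frag_of \<tau>))) ?z"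
      unfolding frag_extend_image using sing(1) k by (intro frag_extend_eq) (simp add: labels_wbd)
    also have "\<dots> = frag_image (labels k) (wbd t n ?z)" unfolding bd0 frag_image_extend ..
    finally show ?thesis using zc(2) n by simp
  qed
  have "wbd t (Suc n) ?w3 = frag_extend (\<lambda>\<tau>. frag_of (pair_simplex (labels n \<tau>)) - frag_image simplex_of (orient (labels n \<tau>))
      - (if n = 0 then 0 else frag_extend orient_htpy (weighted_bd t pair_weight (labels n \<tau>)))) ?z"
    unfolding wbd_extend by (intro frag_extend_eq wbd_orient_htpy sing len)
  also have "\<dots> = frag_extend (\<lambda>\<tau>. frag_of (pair_simplex (labels n \<tau>))) ?z - frag_image simplex_of ?c"
  proof -
    have "frag_extend (\<lambda>\<tau>. if n = 0 then 0 else frag_extend orient_htpy (weighted_bd t pair_weight (labels n \<tau>))) ?z = 0"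
    proof (cases "n = 0")
      case False
      then have "frag_extend orient_htpy (frag_extend (weighted_bd t pair_weight) (frag_image (labels n) ?z)) = 0" using lab by simp
      then show ?thesis using False by (simp add: frag_extend_image frag_extend_extend)
    qed (simp add: frag_extend_eq_0)
    then show ?thesis unfolding frag_extend_fun_diff frag_image_extend by simp
  qed
  finally have b3: "wbd t (Suc n) ?w3 = frag_extend (\<lambda>\<tau>. frag_of (pair_simplex (labels n \<tau>))) ?z - frag_image simplex_of ?c" .
  \<comment> \<open>Both \<open>?w2\<close> and \<open>?w3\<close> have the labelled linear
    simplices as the positive part of their boundary, so in the difference these drop out.\<close>
  have "z = wbd t (Suc n) (w1 - ?w2 + ?w3) + frag_image simplex_of ?c"
    using w1(2) b2 b3 by (simp add: wbd_add wbd_diff)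
  moreover have "Poly_Mapping.keys (w1 - ?w2 + ?w3) \<subseteq> WS (Suc n)"
    using keys_add[of "w1 - ?w2" ?w3] keys_diff_subset[OF w1(1) kw2] kw3 by blast
  moreover have "vbd ?c = 0" if n: "0 < n"
  proof -
    obtain k where k: "n = Suc k" using n by (cases n) auto
    have "vbd ?c = frag_extend (\<lambda>\<tau>. orient (labels k \<tau>)) (wbd t (Suc k) ?z)"
      using orient_labels_bd(1)[of ?z k] zc(1) sing(2) unfolding k by blast
    then show ?thesis using zc(2) k by simp
  qed
  ultimately show ?thesis using kc by blast
qed

end

section \<open>The comparison theorem\<close>

lemma weighted_singular_complex:
  fixes t :: weight_type and X :: "'b topology" and wX :: "'b \<Rightarrow> nat"
  shows "comm_group (weighted_singular_chain_group t X wX n)"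
    and "weighted_singular_boundary t (Suc n) \<in>
      hom (weighted_singular_chain_group t X wX (Suc n)) (weighted_singular_chain_group t X wX n)"
    and "c \<in> carrier (weighted_singular_chain_group t X wX (Suc (Suc n))) \<Longrightarrow>
      weighted_singular_boundary t (Suc n) (weighted_singular_boundary t (Suc (Suc n)) c)
        = \<one>\<^bsub>weighted_singular_chain_group t X wX n\<^esub>"
  by (auto simp: weighted_singular_chain_group_def abelian_free_Abelian_group wbd_add wbd_wbd hom_def
      dest: keys_wbd[THEN subsetD])

lemma weighted_singular_cycle_set:
  "z \<in> cycle_set (weighted_singular_chain_group t X wX) (weighted_singular_boundary t) n \<longleftrightarrow>
     Poly_Mapping.keys z \<subseteq> weighted_singular_simplices t X wX n \<and> (0 < n \<longrightarrow> weighted_singular_boundary t n z = 0)"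
  by (auto simp: cycle_set_def kernel_def weighted_singular_chain_group_def)

lemma weighted_singular_boundary_set:
  "z \<in> boundary_set (weighted_singular_chain_group t X wX) (weighted_singular_boundary t) n \<longleftrightarrow>
     (\<exists>w. Poly_Mapping.keys w \<subseteq> weighted_singular_simplices t X wX (Suc n) \<and> z = weighted_singular_boundary t (Suc n) w)"
  by (simp add: boundary_set_def weighted_singular_chain_group_def image_iff Bex_def)

theorem (in triangulated) weighted_homology_polyhedron:
  "weighted_simplicial_homology t K \<mu> n \<cong> weighted_singular_homology t (top_of_set P) wP n"
  unfolding weighted_singular_homology_def
proof (rule oriented_homology_iso[where j = "\<lambda>n. frag_image simplex_of"])
  have sing: "Poly_Mapping.keys (frag_image simplex_of c) \<subseteq> WS n" if "Poly_Mapping.keys c \<subseteq> sorted_simplices n" for c n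
    using keys_frag_image[of simplex_of c] simplex_of_singular that by (fastforce simp: sorted_simplices_def)
  show "frag_image simplex_of \<in> hom (free_Abelian_group (sorted_simplices n)) (weighted_singular_chain_group t (top_of_set P) wP n)" for n
    using sing[of _ n] by (auto simp: hom_def weighted_singular_chain_group_def)
  show "frag_image simplex_of (vbd c) = weighted_singular_boundary t (Suc n) (frag_image simplex_of c)"
    if "Poly_Mapping.keys c \<subseteq> sorted_simplices (Suc n)" for n c
  proof -
    have "weighted_singular_boundary t (Suc n) (frag_image simplex_of c)
        = frag_extend (\<lambda>vs. weighted_singular_boundary t (Suc n) (frag_of (simplex_of vs))) c"
      by (simp add: frag_image_def wbd_extend)
    also have "\<dots> = frag_extend (\<lambda>vs. frag_image simplex_of (weighted_bd t vweight vs)) c"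
      using that by (intro frag_extend_eq wbd_simplex_of) (auto simp: sorted_simplices_def)
    finally show ?thesis by (simp add: frag_image_extend)
  qed
  show "\<exists>c w. Poly_Mapping.keys c \<subseteq> sorted_simplices n \<and> (0 < n \<longrightarrow> vbd c = 0) \<and>
      w \<in> carrier (weighted_singular_chain_group t (top_of_set P) wP (Suc n)) \<and>
      z = weighted_singular_boundary t (Suc n) w \<otimes>\<^bsub>weighted_singular_chain_group t (top_of_set P) wP n\<^esub> frag_image simplex_of c"
    if "z \<in> cycle_set (weighted_singular_chain_group t (top_of_set P) wP) (weighted_singular_boundary t) n" for n z
    using simplex_of_surjective[of z n] that
    unfolding weighted_singular_cycle_set by (simp add: weighted_singular_chain_group_def)
  show "\<exists>e. Poly_Mapping.keys e \<subseteq> sorted_simplices (Suc n) \<and> c = vbd e"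
    if "Poly_Mapping.keys c \<subseteq> sorted_simplices n"
      "frag_image simplex_of c \<in> boundary_set (weighted_singular_chain_group t (top_of_set P) wP) (weighted_singular_boundary t) n" for n c
    using simplex_of_injective[OF that(1)] that(2) unfolding weighted_singular_boundary_set by blast
qed (rule weighted_singular_complex; assumption?)+

section \<open>Invariance under isomorphisms of weighted spaces\<close>

definition push_simplex :: "('b \<Rightarrow> 'c) \<Rightarrow> nat \<Rightarrow> 'b wsimplex \<Rightarrow> 'c wsimplex" where
  "push_simplex f n \<sigma> = (fst \<sigma>, restrict (\<lambda>x. f (snd \<sigma> x)) (standard_simplex n))"

lemma push_simplex_singular:
  assumes f: "continuous_map X Y f" "\<And>x. x \<in> topspace X \<Longrightarrow> wY (f x) = wX x"
    and \<sigma>: "\<sigma> \<in> weighted_singular_simplices t X wX n"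
  shows "push_simplex f n \<sigma> \<in> weighted_singular_simplices t Y wY n"
proof -
  obtain \<xi> \<theta> where \<sigma>': "\<sigma> = (\<xi>, \<theta>)" by (cases \<sigma>)
  let ?S = "subtopology (powertop_real UNIV) (standard_simplex n)"
  have cont: "continuous_map ?S X \<theta>" using weighted_singular_simplexD(2)[OF \<sigma>[unfolded \<sigma>']] .
  have "continuous_map ?S Y (\<lambda>x\<in>standard_simplex n. f (\<theta> x))"
    by (rule continuous_map_eq[OF continuous_map_compose[OF cont f(1)]]) simp
  moreover have "\<theta> x \<in> topspace X" if "x \<in> standard_simplex n" for x
    using continuous_map_image_subset_topspace[OF cont] that by auto
  ultimately show ?thesis
    using \<sigma> f(2) by (cases t) (auto simp: \<sigma>' push_simplex_def weighted_singular_simplices_def W_continuous_def)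
qed

lemma push_simplex_face:
  assumes "j \<le> n" "0 < n"
  shows "weighted_singular_face n j (push_simplex f n \<sigma>) = push_simplex f (n - 1) (weighted_singular_face n j \<sigma>)"
  using simplical_face_in_standard_simplex[of n j] assms
  by (auto simp: weighted_singular_face_def push_simplex_def singular_face_def case_prod_beta fun_eq_iff restrict_def)

lemma wbd_push_simplex:
  assumes "0 < n"
  shows "weighted_singular_boundary t n (frag_image (push_simplex f n) c)
    = frag_image (push_simplex f (n - 1)) (weighted_singular_boundary t n c)"
proof -
  have "weighted_singular_boundary t n (frag_of (push_simplex f n \<sigma>)) = frag_image (push_simplex f (n - 1)) (weighted_singular_boundary t n (frag_of \<sigma>))" for \<sigma> :: "'b wsimplex"
  proof -
    have "weighted_singular_boundary t n (frag_of (push_simplex f n \<sigma>)) =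
       (\<Sum>j\<le>n. frag_cmul ((-1) ^ j * weight_coeff t (fst \<sigma>) {..n} ({..n} - {j})) (frag_of (weighted_singular_face n j (push_simplex f n \<sigma>))))"
      by (simp add: weighted_singular_boundary_def case_prod_beta) (simp add: push_simplex_def)
    also have "\<dots> = (\<Sum>j\<le>n. frag_image (push_simplex f (n - 1)) (frag_cmul ((-1) ^ j * weight_coeff t (fst \<sigma>) {..n} ({..n} - {j})) (frag_of (weighted_singular_face n j \<sigma>))))"
      using assms by (intro sum.cong) (simp_all add: push_simplex_face)
    also have "\<dots> = frag_image (push_simplex f (n - 1)) (weighted_singular_boundary t n (frag_of \<sigma>))"
      unfolding frag_image_def by (simp add: weighted_singular_boundary_def case_prod_beta frag_extend_sum o_def)
    finally show ?thesis .
  qed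
  then show ?thesis
    unfolding frag_image_def[of "push_simplex f n"] wbd_extend wbd_eq[of t n c] frag_image_extend by simp
qed

text \<open>Pushing along the inverse homeomorphism inverts the chain map itself, so cycles and
  boundaries correspond without any homotopy.\<close>

lemma weighted_singular_homology_iso:
  assumes "weighted_space_iso X wX Y wY f"
  shows "weighted_singular_homology t X wX n \<cong> weighted_singular_homology t Y wY n"
proof -
  obtain g where fg: "homeomorphic_maps X Y f g" using assms unfolding weighted_space_iso_def homeomorphic_map_maps by blast
  have f: "continuous_map X Y f" "\<And>x. x \<in> topspace X \<Longrightarrow> wY (f x) = wX x" "\<And>x. x \<in> topspace X \<Longrightarrow> g (f x) = x"
    using fg assms by (auto simp: homeomorphic_maps_def weighted_space_iso_def)
  have g: "continuous_map Y X g" "\<And>y. y \<in> topspace Y \<Longrightarrow> f (g y) = y"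
    using fg by (auto simp: homeomorphic_maps_def)
  have wg: "wX (g y) = wY y" if "y \<in> topspace Y" for y
    using f(2)[of "g y"] g(2)[OF that] continuous_map_image_subset_topspace[OF g(1)] that by auto
  have keysf: "Poly_Mapping.keys (frag_image (push_simplex f n) c) \<subseteq> weighted_singular_simplices t Y wY n"
    if "Poly_Mapping.keys c \<subseteq> weighted_singular_simplices t X wX n" for n c
    using keys_frag_image[of "push_simplex f n" c] push_simplex_singular[of X Y f wY wX _ t n, OF f(1,2)] that by blast
  have keysg: "Poly_Mapping.keys (frag_image (push_simplex g n) c) \<subseteq> weighted_singular_simplices t X wX n"
    if "Poly_Mapping.keys c \<subseteq> weighted_singular_simplices t Y wY n" for n c
    using keys_frag_image[of "push_simplex g n" c] push_simplex_singular[of Y X g wX wY _ t n, OF g(1) wg] that by blast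
  have inverse: "push_simplex v n (push_simplex u n \<sigma>) = \<sigma>"
    if "\<sigma> \<in> weighted_singular_simplices t A wA n" "\<And>x. x \<in> topspace A \<Longrightarrow> v (u x) = x"
    for A :: "'z topology" and wA and u :: "'z \<Rightarrow> 'y" and v \<sigma> n
  proof -
    obtain \<xi> \<theta> where \<sigma>: "\<sigma> = (\<xi>, \<theta>)" by (cases \<sigma>)
    have "\<theta> x \<in> topspace A" if "x \<in> standard_simplex n" for x
      using continuous_map_image_subset_topspace[OF weighted_singular_simplexD(2)] \<open>\<sigma> \<in> _\<close> that unfolding \<sigma> by fastforce
    moreover have "\<theta> \<in> extensional (standard_simplex n)" using that(1) by (simp add: \<sigma> weighted_singular_simplices_def)
    ultimately show ?thesis using that(2) by (auto simp: \<sigma> push_simplex_def fun_eq_iff restrict_def extensional_def)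
  qed
  have gf: "frag_image (push_simplex g n) (frag_image (push_simplex f n) c) = c"
    if "Poly_Mapping.keys c \<subseteq> weighted_singular_simplices t X wX n" for n c
    unfolding frag_image_image by (rule frag_image_id) (use inverse[of _ X wX n g f] f(3) that in blast)
  have fg': "frag_image (push_simplex f n) (frag_image (push_simplex g n) c) = c"
    if "Poly_Mapping.keys c \<subseteq> weighted_singular_simplices t Y wY n" for n c
    unfolding frag_image_image by (rule frag_image_id) (use inverse[of _ Y wY n f g] g(2) that in blast)
  show ?thesis
    unfolding weighted_singular_homology_def
  proof (rule complex_homology_iso[where h = "\<lambda>n. frag_image (push_simplex f n)"])
    show "frag_image (push_simplex f n) \<in> hom (weighted_singular_chain_group t X wX n) (weighted_singular_chain_group t Y wY n)" for n
      using keysf[of _ n] by (auto simp: hom_def weighted_singular_chain_group_def)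
    show "frag_image (push_simplex f n) (weighted_singular_boundary t (Suc n) c) = weighted_singular_boundary t (Suc n) (frag_image (push_simplex f (Suc n)) c)" for n c
      using wbd_push_simplex[of "Suc n" t f c] by simp
    show "\<exists>c\<in>cycle_set (weighted_singular_chain_group t X wX) (weighted_singular_boundary t) n.
        \<exists>w\<in>carrier (weighted_singular_chain_group t Y wY (Suc n)).
          z = weighted_singular_boundary t (Suc n) w \<otimes>\<^bsub>weighted_singular_chain_group t Y wY n\<^esub> frag_image (push_simplex f n) c"
      if "z \<in> cycle_set (weighted_singular_chain_group t Y wY) (weighted_singular_boundary t) n" for n z
    proof (intro bexI)
      have z: "Poly_Mapping.keys z \<subseteq> weighted_singular_simplices t Y wY n" "0 < n \<Longrightarrow> weighted_singular_boundary t n z = 0"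
        using that unfolding weighted_singular_cycle_set by auto
      \<comment> \<open>Since \<open>z\<close> is literally an image, the bounding chain is
        0.\<close>
      show "z = weighted_singular_boundary t (Suc n) 0 \<otimes>\<^bsub>weighted_singular_chain_group t Y wY n\<^esub> frag_image (push_simplex f n) (frag_image (push_simplex g n) z)"
        using fg'[OF z(1)] by (simp add: weighted_singular_chain_group_def)
      show "0 \<in> carrier (weighted_singular_chain_group t Y wY (Suc n))" by (simp add: weighted_singular_chain_group_def)
      show "frag_image (push_simplex g n) z \<in> cycle_set (weighted_singular_chain_group t X wX) (weighted_singular_boundary t) n"
        unfolding weighted_singular_cycle_set using keysg[OF z(1)] wbd_push_simplex[of n t g z] z(2) by simp
    qed
    show "c \<in> boundary_set (weighted_singular_chain_group t X wX) (weighted_singular_boundary t) n"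
      if c: "c \<in> cycle_set (weighted_singular_chain_group t X wX) (weighted_singular_boundary t) n"
        and fc: "frag_image (push_simplex f n) c \<in> boundary_set (weighted_singular_chain_group t Y wY) (weighted_singular_boundary t) n" for n c
    proof -
      obtain w where w: "Poly_Mapping.keys w \<subseteq> weighted_singular_simplices t Y wY (Suc n)"
        "frag_image (push_simplex f n) c = weighted_singular_boundary t (Suc n) w"
        using fc unfolding weighted_singular_boundary_set by blast
      have "c = frag_image (push_simplex g n) (weighted_singular_boundary t (Suc n) w)"
        using gf[of c n] c w(2) unfolding weighted_singular_cycle_set by simp
      also have "\<dots> = weighted_singular_boundary t (Suc n) (frag_image (push_simplex g (Suc n)) w)"
        using wbd_push_simplex[of "Suc n" t g w] by simp
      finally show ?thesis unfolding weighted_singular_boundary_set using keysg[OF w(1)] by blast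
    qed
  qed (rule weighted_singular_complex; assumption?)+
qed

theorem theorem4p14:
  fixes t :: weight_type
    and K :: "'v set set"
    and \<mu> :: "'v set \<Rightarrow> nat"
    and p :: "'v \<Rightarrow> 'a::euclidean_space"
    and X :: "'b topology"
    and wX :: "'b \<Rightarrow> nat"
  assumes "divisibly_weighted_triangulation t K \<mu> p X wX"
  shows "\<forall>n. weighted_simplicial_homology t K \<mu> n \<cong> weighted_singular_homology t X wX n"
proof
  fix n
  \<comment> \<open>The order only selects an orientation of each simplex; neither homology group in
    the claim depends on it.\<close>
  obtain lt :: "'v \<Rightarrow> 'v \<Rightarrow> bool" where lt: "strict_total_order lt" using ex_strict_total_order by blast
  have K: "weighted_complex t K \<mu>" "geometric_realization K p" "\<And>\<sigma>. \<sigma> \<in> K \<Longrightarrow> \<exists>v\<in>\<sigma>. \<mu> \<sigma> = \<mu> {v}"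
    using assms unfolding divisibly_weighted_triangulation_def weighted_triangulation_def divisibly_weighted_iff by blast+
  obtain f where f: "weighted_space_iso (top_of_set (polyhedron_of K p)) (polyhedron_weight K \<mu> p) X wX f"
    using assms unfolding divisibly_weighted_triangulation_def weighted_triangulation_def by blast
  have "triangulated lt t K \<mu> p"
    using lt K unfolding triangulated_def triangulated_axioms_def ordered_weighted_complex_def
      ordered_weighted_complex_axioms_def geometric_complex_def weighted_complex_def by blast
  then have "weighted_simplicial_homology t K \<mu> n \<cong> weighted_singular_homology t (top_of_set (polyhedron_of K p)) (polyhedron_weight K \<mu> p) n"
    by (rule triangulated.weighted_homology_polyhedron)
  also have "\<dots> \<cong> weighted_singular_homology t X wX n"
    by (rule weighted_singular_homology_iso[OF f])
  finally show "weighted_simplicial_homology t K \<mu> n \<cong> weighted_singular_homology t X wX n" .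
qed

end
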